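(* Let $\Lambda=(\rho,\Psi,\widetilde\Psi)$ be an abstract spectral datum, where the measure $\rho$ is absolutely continuous with $\mathrm{supp}\,\rho=[a,b]$, $0<a<b<\infty$, and $\Psi(s)=e^{is}$, $\widetilde\Psi(s)=1$. Then $\Lambda\notin\Lambda(\mathrm{BMOA}_{\mathrm{simp}})$, i.e. there is no $u\in\mathrm{BMOA}_{\mathrm{simp}}(\mathbb T)$ whose spectral datum $\Lambda(u)$ equals $\Lambda$.
   Context: Abstract spectral datum. Let $\rho$ be a finite Borel measure with bounded support on $(0,\infty)$ (no atom at $0$) satisfying $\int_0^\infty s^{-2}d\rho(s)\le1$. Let $\mathcal M$ be multiplication by $s$ in $L^2(\rho)$, $\mathbf 1\in L^2(\rho)$ the function identically $1$, and $\widetilde{\mathcal M}:=(\mathcal M^2-\langle\cdot,\mathbf 1\rangle\mathbf 1)^{1/2}$. Let $\widetilde\rho$ be the spectral measure of $\widetilde{\mathcal M}$ corresponding to $\mathbf 1$ and $\widetilde\rho_0=\widetilde\rho|_{(0,\infty)}$. An abstract spectral datum is a triple $(\rho,\Psi,\widetilde\Psi)$ with such $\rho$ and unimodular complex-valued functions $\Psi\in L^\infty(\rho)$, $\widetilde\Psi\in L^\infty(\widetilde\rho_0)$. Spectral datum of a Hankel operator. $H^2=H^2(\mathbb T)$ is the Hardy space on the unit circle, $P:L^2(\mathbb T)\to H^2$ the orthogonal projection, $S$ the shift $Sf(z)=zf(z)$. For $u\in\mathrm{BMOA}(\mathbb T)$, $H_uf=P(u\overline f)$ is the bounded anti-linear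 Hankel operator on $H^2$, and $\widetilde H_u:=S^*H_u=H_uS$. The operators $H_u^2,\widetilde H_u^2$ are linear and positive semi-definite; $|H_u|:=(H_u^2)^{1/2}$, $|\widetilde H_u|:=(\widetilde H_u^2)^{1/2}$. $H_u^{\mathrm e}$, $\widetilde H_u^{\mathrm e}$ are the restrictions of $H_u$, $\widetilde H_u$ to the (invariant) closure $\overline{\mathrm{Ran}}\,H_u$ of the range of $H_u$. $\mathrm{BMOA}_{\mathrm{simp}}(\mathbb T)$ is the set of $u\in\mathrm{BMOA}(\mathbb T)$ such that $(H_u^{\mathrm e})^2$ and $(\widetilde H_u^{\mathrm e})^2$ both have simple spectra (possess a cyclic vector). For such $u$, the vector $u$ is cyclic for both $|H_u^{\mathrm e}|$ and $|\widetilde H_u^{\mathrm e}|$; put $\int f\,d\rho=\langle f(|H_u|)u,u\rangle$ and $\int f\,d\widetilde\rho=\langle f(|\widetilde H_u|)u,u\rangle$ for continuous $f$ (this $\widetilde\rho$ coincides with the measure built from $\rho$ above). There are unimodular $\Psi_u$, unique in $L^\infty(\rho)$, and $\widetilde\Psi_u$, unique in $L^\infty(\widetilde\rho_0)$, with $$H_u^{\mathrm e}f(|H_u^{\mathrm e}|)u=|H_u^{\mathrm e}|\overline{\Psi_u}(|H_u^{\mathrm e}|)\overline f(|H_u^{\mathrm e}|)u\ (f\in L^2(\rho)),\quad \widetilde H_u^{\mathrm e}f(|\widetilde H_u^{\mathrm e}|)u=|\widetilde H_u^{\mathrm e}|\widetilde\Psi_u(|\widetilde H_u^{\mathrm e}|)\overline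 f(|\widetilde H_u^{\mathrm e}|)u\ (f\in L^2(\widetilde\rho)).$$ The spectral datum of $u$ is $\Lambda(u)=(\rho,\Psi_u,\widetilde\Psi_u)$, and $\Lambda(\mathrm{BMOA}_{\mathrm{simp}})=\{\Lambda(u):u\in\mathrm{BMOA}_{\mathrm{simp}}(\mathbb T)\}$. *)

theory Defs
  imports "HOL-Analysis.Analysis" "HOL-Computational_Algebra.Polynomial"
begin

text \<open>
  Elements of an \<open>L\<^sup>2\<close> space are represented by functions, identified when they agree almost
  everywhere. A Hilbert space is a pair of a measure \<open>M\<close> and a set \<open>V\<close> of square-integrable
  functions (a closed subspace of \<open>L2 M\<close>, stable under a.e. equality); operators on it are maps on
  functions, of which only the values on \<open>V\<close>, up to a.e. equality, matter. In particular the
  restriction of an operator to a smaller subspace is the same map with a smaller \<open>V\<close>.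
\<close>

section \<open>Operators on spaces of square-integrable functions\<close>

definition L2 :: "'a measure \<Rightarrow> ('a \<Rightarrow> complex) set" where
  "L2 M = {f \<in> borel_measurable M. integrable M (\<lambda>x. (cmod (f x))\<^sup>2)}"

definition ip :: "'a measure \<Rightarrow> ('a \<Rightarrow> complex) \<Rightarrow> ('a \<Rightarrow> complex) \<Rightarrow> complex" where
  "ip M f g = (LINT x|M. f x * cnj (g x))"

definition nrm :: "'a measure \<Rightarrow> ('a \<Rightarrow> complex) \<Rightarrow> real" where
  "nrm M f = sqrt (LINT x|M. (cmod (f x))\<^sup>2)"

text \<open>Being linear and bounded, such a map respects a.e. equality on \<open>V\<close>.\<close>

definition bounded_op ::
  "'a measure \<Rightarrow> ('a \<Rightarrow> complex) set \<Rightarrow> (('a \<Rightarrow> complex) \<Rightarrow> 'a \<Rightarrow> complex) \<Rightarrow> bool" where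
  "bounded_op M V A \<longleftrightarrow>
     (\<forall>f\<in>V. A f \<in> V) \<and>
     (\<forall>f\<in>V. \<forall>g\<in>V. AE x in M. A (\<lambda>x. f x + g x) x = A f x + A g x) \<and>
     (\<forall>f\<in>V. \<forall>c. AE x in M. A (\<lambda>x. c * f x) x = c * A f x) \<and>
     (\<exists>C. \<forall>f\<in>V. nrm M (A f) \<le> C * nrm M f)"

definition selfadjoint_op ::
  "'a measure \<Rightarrow> ('a \<Rightarrow> complex) set \<Rightarrow> (('a \<Rightarrow> complex) \<Rightarrow> 'a \<Rightarrow> complex) \<Rightarrow> bool" where
  "selfadjoint_op M V A \<longleftrightarrow>
     bounded_op M V A \<and> (\<forall>f\<in>V. \<forall>g\<in>V. ip M (A f) g = ip M f (A g))"

text \<open>\<open>B = A\<^sup>1\<^sup>/\<^sup>2\<close>, the positive semi-definite square root (unique up to a.e. equality).\<close>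

definition is_pos_sqrt ::
  "'a measure \<Rightarrow> ('a \<Rightarrow> complex) set \<Rightarrow> (('a \<Rightarrow> complex) \<Rightarrow> 'a \<Rightarrow> complex) \<Rightarrow>
   (('a \<Rightarrow> complex) \<Rightarrow> 'a \<Rightarrow> complex) \<Rightarrow> bool" where
  "is_pos_sqrt M V A B \<longleftrightarrow>
     selfadjoint_op M V B \<and> (\<forall>f\<in>V. 0 \<le> Re (ip M (B f) f)) \<and>
     (\<forall>f\<in>V. AE x in M. B (B f) x = A f x)"

text \<open>\<open>B = |T|\<close>, where \<open>T\<close> is linear or anti-linear with \<open>T\<^sup>2\<close> positive semi-definite.\<close>

definition is_modulus ::
  "'a measure \<Rightarrow> ('a \<Rightarrow> complex) set \<Rightarrow> (('a \<Rightarrow> complex) \<Rightarrow> 'a \<Rightarrow> complex) \<Rightarrow>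
   (('a \<Rightarrow> complex) \<Rightarrow> 'a \<Rightarrow> complex) \<Rightarrow> bool" where
  "is_modulus M V T B \<longleftrightarrow> is_pos_sqrt M V (\<lambda>f. T (T f)) B"

definition has_cyclic_vector ::
  "'a measure \<Rightarrow> ('a \<Rightarrow> complex) set \<Rightarrow> (('a \<Rightarrow> complex) \<Rightarrow> 'a \<Rightarrow> complex) \<Rightarrow> bool" where
  "has_cyclic_vector M V A \<longleftrightarrow>
     (\<exists>v\<in>V. \<forall>g\<in>V. \<forall>e>0. \<exists>p :: complex poly.
        nrm M (\<lambda>x. g x - (\<Sum>i\<le>degree p. coeff p i * (A ^^ i) v x)) < e)"

section \<open>Spectral measures and functional calculus\<close>

text \<open>A projection-valued measure on the Borel sets of the line, strongly countably additive.\<close>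

definition is_pvm ::
  "'a measure \<Rightarrow> ('a \<Rightarrow> complex) set \<Rightarrow> (real set \<Rightarrow> ('a \<Rightarrow> complex) \<Rightarrow> 'a \<Rightarrow> complex) \<Rightarrow> bool" where
  "is_pvm M V E \<longleftrightarrow>
     (\<forall>X\<in>sets borel. selfadjoint_op M V (E X) \<and> (\<forall>f\<in>V. AE x in M. E X (E X f) x = E X f x)) \<and>
     (\<forall>f\<in>V. AE x in M. E UNIV f x = f x) \<and>
     (\<forall>X. range X \<subseteq> sets borel \<longrightarrow> disjoint_family X \<longrightarrow>
        (\<forall>f\<in>V. (\<lambda>n. nrm M (\<lambda>x. (\<Sum>i<n. E (X i) f x) - E (\<Union>i. X i) f x)) \<longlonglongrightarrow> 0))"

definition pvm_measure ::
  "'a measure \<Rightarrow> (real set \<Rightarrow> ('a \<Rightarrow> complex) \<Rightarrow> 'a \<Rightarrow> complex) \<Rightarrow> ('a \<Rightarrow> complex) \<Rightarrow> real measure" where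
  "pvm_measure M E v = measure_of UNIV (sets borel) (\<lambda>X. ennreal (Re (ip M (E X v) v)))"

definition pvm_simple_integral ::
  "(real set \<Rightarrow> ('a \<Rightarrow> complex) \<Rightarrow> 'a \<Rightarrow> complex) \<Rightarrow> (real \<Rightarrow> complex) \<Rightarrow> ('a \<Rightarrow> complex) \<Rightarrow> 'a \<Rightarrow> complex"
  where
  "pvm_simple_integral E s v = (\<lambda>x. \<Sum>c\<in>range s. c * E (s -` {c}) v x)"

text \<open>
  \<open>y = (\<integral> f dE) v\<close> for a possibly unbounded Borel function \<open>f\<close>: the vector \<open>v\<close> is in the domain of
  the integral iff \<open>f\<close> is square-integrable for \<open>\<langle>E(\<cdot>)v, v\<rangle>\<close>, and \<open>f \<mapsto> (\<integral> f dE) v\<close> is the isometric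
  extension of the integral of simple functions.
\<close>

definition has_pvm_integral ::
  "'a measure \<Rightarrow> ('a \<Rightarrow> complex) set \<Rightarrow> (real set \<Rightarrow> ('a \<Rightarrow> complex) \<Rightarrow> 'a \<Rightarrow> complex) \<Rightarrow>
   (real \<Rightarrow> complex) \<Rightarrow> ('a \<Rightarrow> complex) \<Rightarrow> ('a \<Rightarrow> complex) \<Rightarrow> bool" where
  "has_pvm_integral M V E f v y \<longleftrightarrow>
     v \<in> V \<and> y \<in> V \<and> f \<in> L2 (pvm_measure M E v) \<and>
     (\<exists>s. (\<forall>n. simple_function borel (s n)) \<and>
        (\<lambda>n. nrm (pvm_measure M E v) (\<lambda>t. s n t - f t)) \<longlonglongrightarrow> 0 \<and>
        (\<lambda>n. nrm M (\<lambda>x. pvm_simple_integral E (s n) v x - y x)) \<longlonglongrightarrow> 0)"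

text \<open>
  \<open>E\<close> is the spectral measure of the bounded self-adjoint operator \<open>A\<close>, i.e. \<open>A = \<integral> t dE(t)\<close>.
  For such \<open>E\<close>, \<open>has_pvm_integral M V E f v y\<close> says that \<open>y = f(A) v\<close>.
\<close>

definition is_spectral_resolution ::
  "'a measure \<Rightarrow> ('a \<Rightarrow> complex) set \<Rightarrow> (('a \<Rightarrow> complex) \<Rightarrow> 'a \<Rightarrow> complex) \<Rightarrow>
   (real set \<Rightarrow> ('a \<Rightarrow> complex) \<Rightarrow> 'a \<Rightarrow> complex) \<Rightarrow> bool" where
  "is_spectral_resolution M V A E \<longleftrightarrow>
     selfadjoint_op M V A \<and> is_pvm M V E \<and>
     (\<forall>v\<in>V. has_pvm_integral M V E complex_of_real v (A v))"

text \<open>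
  \<open>\<mu>\<close> is the spectral measure of \<open>A\<close> corresponding to the vector \<open>v\<close>:
  \<open>\<integral> f d\<mu> = \<langle>f(A)v, v\<rangle>\<close> for all continuous \<open>f\<close>.
\<close>

definition is_spectral_measure_at ::
  "'a measure \<Rightarrow> ('a \<Rightarrow> complex) set \<Rightarrow> (('a \<Rightarrow> complex) \<Rightarrow> 'a \<Rightarrow> complex) \<Rightarrow> ('a \<Rightarrow> complex) \<Rightarrow>
   real measure \<Rightarrow> bool" where
  "is_spectral_measure_at M V A v \<mu> \<longleftrightarrow>
     sets \<mu> = sets borel \<and> finite_measure \<mu> \<and>
     (\<exists>E. is_spectral_resolution M V A E \<and>
        (\<forall>f :: real \<Rightarrow> complex. continuous_on UNIV f \<longrightarrow>
           integrable \<mu> f \<and> (\<exists>y. has_pvm_integral M V E f v y \<and> (LINT s|\<mu>. f s) = ip M y v)))"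

section \<open>Abstract spectral data\<close>

definition msupport :: "real measure \<Rightarrow> real set" where
  "msupport \<rho> = {s. \<forall>U. open U \<longrightarrow> s \<in> U \<longrightarrow> emeasure \<rho> U \<noteq> 0}"

text \<open>The spectral measure corresponding to \<open>1\<close> of the square root of
  \<open>\<M>\<^sup>2 - \<langle>\<cdot>, 1\<rangle> 1\<close>, \<open>\<M>\<close> being multiplication by \<open>s\<close> in \<open>L2 \<rho>\<close>.\<close>

definition rho_tilde :: "real measure \<Rightarrow> real measure" where
  "rho_tilde \<rho> = (THE \<rho>t. \<exists>B.
     is_pos_sqrt \<rho> (L2 \<rho>) (\<lambda>g s. (complex_of_real s)\<^sup>2 * g s - ip \<rho> g (\<lambda>_. 1) * 1) B \<and>
     is_spectral_measure_at \<rho> (L2 \<rho>) B (\<lambda>_. 1) \<rho>t)"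

text \<open>The measure \<open>\<rho>\<close> on \<open>(0,\<infinity>)\<close> is a Borel measure on the line vanishing on \<open>(-\<infinity>,0]\<close>; the classes
  \<open>\<Psi>\<close> and \<open>\<Psi>t\<close> are represented by Borel functions on the line, whose values on \<open>(-\<infinity>,0]\<close> are
  immaterial.\<close>

definition is_unimodular :: "real measure \<Rightarrow> (real \<Rightarrow> complex) \<Rightarrow> bool" where
  "is_unimodular \<mu> \<Phi> \<longleftrightarrow> \<Phi> \<in> borel_measurable borel \<and> (AE s in \<mu>. cmod (\<Phi> s) = 1)"

type_synonym spectral_datum = "real measure \<times> (real \<Rightarrow> complex) \<times> (real \<Rightarrow> complex)"

definition abstract_spectral_datum :: "spectral_datum \<Rightarrow> bool" where
  "abstract_spectral_datum \<Lambda> \<longleftrightarrow> (case \<Lambda> of (\<rho>, \<Psi>, \<Psi>t) \<Rightarrow>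
     sets \<rho> = sets borel \<and> finite_measure \<rho> \<and> emeasure \<rho> {..0} = 0 \<and> bounded (msupport \<rho>) \<and>
     (\<integral>\<^sup>+ s. ennreal (1 / s\<^sup>2) \<partial>\<rho>) \<le> 1 \<and>
     is_unimodular \<rho> \<Psi> \<and> is_unimodular (restrict_space (rho_tilde \<rho>) {0<..}) \<Psi>t)"

section \<open>Hankel operators on the Hardy space\<close>

text \<open>Normalised arc length, as a measure on the complex plane concentrated on the unit circle.\<close>

definition circ :: "complex measure" where
  "circ = distr (uniform_measure lborel {0..2 * pi}) borel cis"

definition fourier_coeff :: "(complex \<Rightarrow> complex) \<Rightarrow> int \<Rightarrow> complex" where
  "fourier_coeff f n = (LINT z|circ. f z * z powi (- n))"

definition H2 :: "(complex \<Rightarrow> complex) set" where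
  "H2 = {f \<in> L2 circ. \<forall>n<0. fourier_coeff f n = 0}"

definition BMOA :: "(complex \<Rightarrow> complex) set" where
  "BMOA = {u \<in> H2. \<exists>C. \<forall>\<alpha> \<beta> :: real. \<alpha> < \<beta> \<longrightarrow> \<beta> \<le> \<alpha> + 2 * pi \<longrightarrow>
     (LBINT t:{\<alpha>..\<beta>}. cmod (u (cis t) - (LBINT r:{\<alpha>..\<beta>}. u (cis r)) / complex_of_real (\<beta> - \<alpha>)))
       / (\<beta> - \<alpha>) \<le> C}"

text \<open>
  The orthogonal projection from \<open>L2 circ\<close> onto \<open>H2\<close>, acting on Fourier series. For \<open>u\<close> in BMOA and
  \<open>f\<close> in \<open>H2\<close> the product \<open>u * cnj f\<close> is in general only integrable; its projection still
  exists in \<open>H2\<close> and agrees with the bounded extension of \<open>f \<mapsto> P (u * cnj f)\<close> from polynomials.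
\<close>

definition szego_proj :: "(complex \<Rightarrow> complex) \<Rightarrow> complex \<Rightarrow> complex" where
  "szego_proj h = (SOME g. g \<in> H2 \<and> (\<forall>n\<ge>0. fourier_coeff g n = fourier_coeff h n))"

definition shift :: "(complex \<Rightarrow> complex) \<Rightarrow> complex \<Rightarrow> complex" where
  "shift f = (\<lambda>z. z * f z)"

definition hankel :: "(complex \<Rightarrow> complex) \<Rightarrow> (complex \<Rightarrow> complex) \<Rightarrow> complex \<Rightarrow> complex" where
  "hankel u f = szego_proj (\<lambda>z. u z * cnj (f z))"

text \<open>This is \<open>H\<^sub>u S\<close>, which equals \<open>S\<^sup>* H\<^sub>u\<close>.\<close>

definition hankel_tilde :: "(complex \<Rightarrow> complex) \<Rightarrow> (complex \<Rightarrow> complex) \<Rightarrow> complex \<Rightarrow> complex" where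
  "hankel_tilde u f = hankel u (shift f)"

text \<open>The space of \<open>H\<^sub>u\<^sup>e\<close> and of its tilde version: the closure in \<open>H2\<close> of the range of
  \<open>H\<^sub>u\<close>.\<close>

definition hankel_ran :: "(complex \<Rightarrow> complex) \<Rightarrow> (complex \<Rightarrow> complex) set" where
  "hankel_ran u = {g \<in> H2. \<forall>e>0. \<exists>f\<in>H2. nrm circ (\<lambda>z. g z - hankel u f z) < e}"

definition BMOA_simp :: "(complex \<Rightarrow> complex) set" where
  "BMOA_simp = {u \<in> BMOA.
     has_cyclic_vector circ (hankel_ran u) (\<lambda>f. hankel u (hankel u f)) \<and>
     has_cyclic_vector circ (hankel_ran u) (\<lambda>f. hankel_tilde u (hankel_tilde u f))}"

section \<open>Spectral data of Hankel operators\<close>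

text \<open>\<open>T f(|T|) v = |T| \<Phi>(|T|) \<open>cnj f\<close>(|T|) v\<close> for all \<open>f\<close> in \<open>L2 \<mu>\<close>, on the space \<open>V\<close>.\<close>

definition acts_as ::
  "'a measure \<Rightarrow> ('a \<Rightarrow> complex) set \<Rightarrow> (('a \<Rightarrow> complex) \<Rightarrow> 'a \<Rightarrow> complex) \<Rightarrow> ('a \<Rightarrow> complex) \<Rightarrow>
   real measure \<Rightarrow> (real \<Rightarrow> complex) \<Rightarrow> bool" where
  "acts_as M V T v \<mu> \<Phi> \<longleftrightarrow>
     (\<exists>B E. is_modulus M V T B \<and> is_spectral_resolution M V B E \<and>
        (\<forall>f\<in>L2 \<mu>. \<exists>x y z.
           has_pvm_integral M V E f v x \<and>
           has_pvm_integral M V E (\<lambda>s. cnj (f s)) v y \<and>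
           has_pvm_integral M V E \<Phi> y z \<and>
           (AE w in M. T x w = B z w)))"

text \<open>
  \<open>has_spectral_datum u (\<rho>, \<Psi>, \<Psi>t)\<close> says that \<open>(\<rho>, \<Psi>, \<Psi>t)\<close> is the spectral datum of \<open>u\<close>. As
  \<open>\<Psi>\<close> and \<open>\<Psi>t\<close> are determined by \<open>u\<close> up to null sets of \<open>\<rho>\<close> and of \<open>\<rho>t\<close> restricted to
  \<open>(0,\<infinity>)\<close>, the triples related to \<open>u\<close> are precisely the representatives of one datum.
\<close>

definition has_spectral_datum :: "(complex \<Rightarrow> complex) \<Rightarrow> spectral_datum \<Rightarrow> bool" where
  "has_spectral_datum u \<Lambda> \<longleftrightarrow> (case \<Lambda> of (\<rho>, \<Psi>, \<Psi>t) \<Rightarrow>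
     (\<exists>B. is_modulus circ H2 (hankel u) B \<and> is_spectral_measure_at circ H2 B u \<rho>) \<and>
     is_unimodular \<rho> \<Psi> \<and>
     acts_as circ (hankel_ran u) (hankel u) u \<rho> (\<lambda>s. cnj (\<Psi> s)) \<and>
     (\<exists>\<rho>t. (\<exists>Bt. is_modulus circ H2 (hankel_tilde u) Bt \<and> is_spectral_measure_at circ H2 Bt u \<rho>t) \<and>
        is_unimodular (restrict_space \<rho>t {0<..}) \<Psi>t \<and>
        acts_as circ (hankel_ran u) (hankel_tilde u) u \<rho>t \<Psi>t))"

definition Lambda_BMOA_simp :: "spectral_datum set" where
  "Lambda_BMOA_simp = {\<Lambda>. \<exists>u\<in>BMOA_simp. has_spectral_datum u \<Lambda>}"

end

theory Submission imports Defs begin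

text \<open>
  On \<open>K = hankel_ran u\<close> let \<open>B = |H\<^sub>u|\<close> and let \<open>A\<close> be the modulus of \<open>H\<^sub>u S\<close>. In the spectral
  representation of \<open>B\<close> the datum \<open>\<Psi>(s) = e\<^sup>i\<^sup>s\<close>, \<open>\<Psi>t = 1\<close> turns the backward shift on \<open>K\<close> into
  \<open>T = A B\<^sup>-\<^sup>1 U\<close>, where \<open>U\<close> is multiplication by \<open>e\<^sup>i\<^sup>s\<close>. As \<open>B\<^sup>2 - A\<^sup>2 = \<langle>\<cdot>, u\<rangle> u\<close>, the difference
  \<open>D = B - A\<close> solves a Sylvester equation with a right-hand side of rank one, so \<open>T\<close> is close to the unitary
  \<open>U\<close>, whose spectrum is absolutely continuous. But powers of the backward shift tend to \<open>0\<close> strongly.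

  To make the contradiction quantitative, take \<open>e\<^sub>k = U\<^sup>k 1\<^sub>\<Delta>\<close> for a set \<open>\<Delta>\<close> of diameter at most \<open>2\<pi>\<close> on which
  \<open>\<rho>\<close> has bounded density: by Parseval on \<open>\<Delta>\<close> the \<open>e\<^sub>k\<close> form a Bessel sequence. Since \<open>T e\<^sub>k\<close> is nearly
  \<open>e\<^sub>k\<^sub>+\<^sub>1\<close>, the mass of the first \<open>N\<close> Fourier coefficients of \<open>e\<^sub>k\<close> is almost the same for all large \<open>k\<close>,
  with an error independent of \<open>N\<close> that tends to \<open>0\<close> as \<open>k\<close> grows. It tends to \<open>0\<close> as \<open>k \<rightarrow> \<infinity>\<close> because the
  sequence is Bessel, and to \<open>\<parallel>e\<^sub>k\<parallel>\<^sup>2 = \<rho>(\<Delta>) > 0\<close> as \<open>N \<rightarrow> \<infinity>\<close>.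
\<close>

text \<open>The obstacle is the defect \<open>D\<close>. Its cross terms with the first
  \<open>N\<close> coefficients of the \<open>e k\<close> must be summed over \<open>k\<close> with
  a bound free of \<open>N\<close>, and \<open>A\<close>, unlike \<open>B\<close> on the window,
  comes without a positive lower bound. With \<open>R = 1 - 2 A / \<kappa>\<close> and
  \<open>R' = 1 - 2 B / \<kappa>\<close> the Sylvester equation reads
  \<open>D = (R D + D R') / 2 + <., u> u / \<kappa>\<close>. For large \<open>\<kappa>\<close>,
  \<open>R\<close> is a contraction and \<open>R'\<close> has norm at most \<open>r < 1\<close> on
  the window. The defect is therefore tested against all families of functionals with a common
  Bessel bound: this class is stable under composition with \<open>R\<close>, so a supremum over it
  absorbs \<open>R D\<close>, while each \<open>R'\<close> gains a factor \<open>r\<close>. A second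
  obstacle is that \<open>\<rho>\<close> comes from a modulus on \<open>H2\<close>,
  \<open>\<Psi>\<close> from a modulus on \<open>K\<close>, and \<open>hankel u\<close> is pinned
  down only where the projection exists. The common ground of the moduli is their squares, all equal
  to \<open>H^2\<close>; hence the even powers and even polynomials throughout.\<close>

section \<open>Square-integrable functions\<close>

lemma borel_measurable_cnj [measurable (raw)]:
  "f \<in> borel_measurable M \<Longrightarrow> (\<lambda>x. cnj (f x)) \<in> borel_measurable M"
  by (rule borel_measurable_continuous_on[OF continuous_on_cnj[OF continuous_on_id]])

lemma L2_measurable: "f \<in> L2 M \<Longrightarrow> f \<in> borel_measurable M"
  by (simp add: L2_def)

lemma L2_integrable_sq: "f \<in> L2 M \<Longrightarrow> integrable M (\<lambda>x. (cmod (f x))\<^sup>2)"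
  by (simp add: L2_def)

lemma L2_dominated:
  assumes "f \<in> borel_measurable M" "integrable M g" "AE x in M. (cmod (f x))\<^sup>2 \<le> g x"
  shows "f \<in> L2 M"
  unfolding L2_def
proof (intro CollectI conjI)
  show "integrable M (\<lambda>x. (cmod (f x))\<^sup>2)"
    by (rule Bochner_Integration.integrable_bound[OF assms(2)])
      (use assms in auto)
qed (use assms in auto)

lemma norm_add_sq_le: "(norm (a + b))\<^sup>2 \<le> 2 * (norm a)\<^sup>2 + 2 * (norm (b :: 'a :: real_normed_vector))\<^sup>2"
proof -
  have "(norm (a + b))\<^sup>2 \<le> (norm a + norm b)\<^sup>2"
    by (intro power_mono norm_triangle_ineq) auto
  also have "\<dots> \<le> 2 * (norm a)\<^sup>2 + 2 * (norm b)\<^sup>2"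
    using sum_squares_bound[of "norm a" "norm b"] by (simp add: power2_sum)
  finally show ?thesis .
qed

lemma L2_add:
  assumes "f \<in> L2 M" "g \<in> L2 M"
  shows "(\<lambda>x. f x + g x) \<in> L2 M"
  by (rule L2_dominated[where g = "\<lambda>x. 2 * (cmod (f x))\<^sup>2 + 2 * (cmod (g x))\<^sup>2"])
    (use assms norm_add_sq_le in \<open>auto simp: L2_def\<close>)

lemma L2_scale:
  assumes "f \<in> L2 M"
  shows "(\<lambda>x. c * f x) \<in> L2 M"
  by (rule L2_dominated[where g = "\<lambda>x. (cmod c)\<^sup>2 * (cmod (f x))\<^sup>2"])
    (use assms in \<open>auto simp: L2_def norm_mult power_mult_distrib\<close>)

lemma L2_diff:
  assumes "f \<in> L2 M" "g \<in> L2 M"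
  shows "(\<lambda>x. f x - g x) \<in> L2 M"
  using L2_add[OF assms(1) L2_scale[OF assms(2), of "-1"]] by simp

lemma L2_zero: "(\<lambda>_. 0) \<in> L2 M"
  by (simp add: L2_def)

lemma L2_sum:
  assumes "\<And>i. i \<in> I \<Longrightarrow> f i \<in> L2 M"
  shows "(\<lambda>x. \<Sum>i\<in>I. f i x) \<in> L2 M"
  using assms by (induction I rule: infinite_finite_induct) (auto simp: L2_zero intro: L2_add)

lemma L2_cnj: "f \<in> L2 M \<Longrightarrow> (\<lambda>x. cnj (f x)) \<in> L2 M"
  by (auto simp: L2_def)

lemma L2_bounded_mult:
  assumes "f \<in> L2 M" "h \<in> borel_measurable M" "AE x in M. cmod (h x) \<le> C"
  shows "(\<lambda>x. h x * f x) \<in> L2 M"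
proof (rule L2_dominated[where g = "\<lambda>x. C\<^sup>2 * (cmod (f x))\<^sup>2"])
  show "AE x in M. (cmod (h x * f x))\<^sup>2 \<le> C\<^sup>2 * (cmod (f x))\<^sup>2"
    using assms(3)
    by eventually_elim (auto simp: norm_mult power_mult_distrib intro!: mult_right_mono power_mono)
qed (use assms in \<open>auto simp: L2_def\<close>)

lemma L2_bounded:
  assumes "finite_measure M" "h \<in> borel_measurable M" "AE x in M. cmod (h x) \<le> C"
  shows "h \<in> L2 M"
  by (rule L2_dominated[where g = "\<lambda>x. C\<^sup>2"])
    (use assms in \<open>auto intro!: power_mono simp: finite_measure.integrable_const\<close>)

lemma integrable_ip:
  assumes "f \<in> L2 M" "g \<in> L2 M"
  shows "integrable M (\<lambda>x. f x * cnj (g x))"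
proof (rule Bochner_Integration.integrable_bound[where f = "\<lambda>x. (cmod (f x))\<^sup>2 + (cmod (g x))\<^sup>2"])
  have "a * b \<le> a\<^sup>2 + b\<^sup>2" if "a \<ge> 0" "b \<ge> 0" for a b :: real
    using sum_squares_bound[of a b] mult_nonneg_nonneg[OF that] by linarith
  then show "AE x in M. norm (f x * cnj (g x)) \<le> norm ((cmod (f x))\<^sup>2 + (cmod (g x))\<^sup>2)"
    by (intro AE_I2) (auto simp: norm_mult)
qed (use assms in \<open>auto simp: L2_def\<close>)

lemma ip_add_left: "f \<in> L2 M \<Longrightarrow> g \<in> L2 M \<Longrightarrow> h \<in> L2 M \<Longrightarrow>
    ip M (\<lambda>x. f x + g x) h = ip M f h + ip M g h"
  unfolding ip_def distrib_right by (intro Bochner_Integration.integral_add integrable_ip)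

lemma ip_scale_left: "ip M (\<lambda>x. c * f x) h = c * ip M f h"
  unfolding ip_def by (simp add: mult.assoc)

lemma ip_diff_left: "f \<in> L2 M \<Longrightarrow> g \<in> L2 M \<Longrightarrow> h \<in> L2 M \<Longrightarrow>
    ip M (\<lambda>x. f x - g x) h = ip M f h - ip M g h"
  unfolding ip_def left_diff_distrib by (intro Bochner_Integration.integral_diff integrable_ip)

lemma ip_commute: "ip M g f = cnj (ip M f g)"
proof -
  have "cnj (ip M f g) = (LINT x|M. cnj (f x * cnj (g x)))"
    unfolding ip_def by (rule Bochner_Integration.integral_cnj[symmetric])
  then show ?thesis by (simp add: ip_def mult.commute)
qed

lemma ip_add_right: "f \<in> L2 M \<Longrightarrow> g \<in> L2 M \<Longrightarrow> h \<in> L2 M \<Longrightarrow>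
    ip M h (\<lambda>x. f x + g x) = ip M h f + ip M h g"
  using ip_add_left[of f M g h] by (metis ip_commute complex_cnj_add)

lemma ip_diff_right: "f \<in> L2 M \<Longrightarrow> g \<in> L2 M \<Longrightarrow> h \<in> L2 M \<Longrightarrow>
    ip M h (\<lambda>x. f x - g x) = ip M h f - ip M h g"
  using ip_diff_left[of f M g h] by (metis ip_commute complex_cnj_diff)

lemma ip_scale_right: "ip M h (\<lambda>x. c * f x) = cnj c * ip M h f"
  using ip_scale_left[of M c f h] by (metis ip_commute complex_cnj_mult)

lemma ip_zero [simp]: "ip M (\<lambda>_. 0) h = 0" "ip M h (\<lambda>_. 0) = 0"
  by (auto simp: ip_def)

lemma ip_sum_left:
  assumes "\<And>i. i \<in> I \<Longrightarrow> f i \<in> L2 M" "h \<in> L2 M"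
  shows "ip M (\<lambda>x. \<Sum>i\<in>I. f i x) h = (\<Sum>i\<in>I. ip M (f i) h)"
  using assms(1)
proof (induction I rule: infinite_finite_induct)
  case (insert a F)
  then show ?case
    using ip_add_left[of "f a" M "\<lambda>x. \<Sum>i\<in>F. f i x" h] L2_sum[of F f M] assms(2) by auto
qed auto

lemma ip_sum_right:
  assumes "\<And>i. i \<in> I \<Longrightarrow> f i \<in> L2 M" "h \<in> L2 M"
  shows "ip M h (\<lambda>x. \<Sum>i\<in>I. f i x) = (\<Sum>i\<in>I. ip M h (f i))"
  using ip_sum_left[of I f M h] assms by (metis (mono_tags, lifting) cnj_sum ip_commute sum.cong)

lemma ip_self: "ip M f f = complex_of_real ((nrm M f)\<^sup>2)"
proof -
  have "ip M f f = (LINT x|M. complex_of_real ((cmod (f x))\<^sup>2))"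
    unfolding ip_def by (simp only: complex_norm_square)
  also have "\<dots> = complex_of_real (LINT x|M. (cmod (f x))\<^sup>2)"
    by (rule integral_complex_of_real)
  also have "(LINT x|M. (cmod (f x))\<^sup>2) = (nrm M f)\<^sup>2"
    unfolding nrm_def by (subst real_sqrt_pow2) auto
  finally show ?thesis .
qed

lemma nrm_sq: "(nrm M f)\<^sup>2 = (LINT x|M. (cmod (f x))\<^sup>2)"
  unfolding nrm_def by (subst real_sqrt_pow2) auto

lemma nrm_sq_ip: "(nrm M f)\<^sup>2 = Re (ip M f f)"
  by (simp add: ip_self)

lemma nrm_nonneg [simp]: "0 \<le> nrm M f"
  unfolding nrm_def by auto

lemma nrm_zero [simp]: "nrm M (\<lambda>_. 0) = 0"
  by (simp add: nrm_def)

lemma nrm_scale: "nrm M (\<lambda>x. c * f x) = cmod c * nrm M f"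
  unfolding nrm_def by (simp add: norm_mult power_mult_distrib real_sqrt_mult)

lemma nrm_minus_commute: "nrm M (\<lambda>x. f x - g x) = nrm M (\<lambda>x. g x - f x)"
  unfolding nrm_def by (simp add: norm_minus_commute)

lemma nrm_cnj [simp]: "nrm M (\<lambda>x. cnj (f x)) = nrm M f"
  unfolding nrm_def by simp

lemma ip_cong_AE:
  assumes "AE x in M. f x = f' x" "AE x in M. g x = g' x"
    "f \<in> L2 M" "f' \<in> L2 M" "g \<in> L2 M" "g' \<in> L2 M"
  shows "ip M f g = ip M f' g'"
  unfolding ip_def
  by (rule integral_cong_AE) (use assms in \<open>auto simp: L2_def\<close>)

lemma nrm_cong_AE:
  assumes "AE x in M. f x = g x" "f \<in> borel_measurable M" "g \<in> borel_measurable M"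
  shows "nrm M f = nrm M g"
  unfolding nrm_def using assms by (auto intro!: arg_cong[where f = sqrt] integral_cong_AE)

lemma nrm_eq_0_iff:
  assumes "f \<in> L2 M"
  shows "nrm M f = 0 \<longleftrightarrow> (AE x in M. f x = 0)"
proof -
  have "nrm M f = 0 \<longleftrightarrow> (LINT x|M. (cmod (f x))\<^sup>2) = 0"
    unfolding nrm_def by simp
  also have "\<dots> \<longleftrightarrow> (AE x in M. f x = 0)"
    by (subst integral_nonneg_eq_0_iff_AE) (use assms in \<open>auto simp: L2_def\<close>)
  finally show ?thesis .
qed

lemma ip_Cauchy_Schwarz:
  assumes f: "f \<in> L2 M" and g: "g \<in> L2 M"
  shows "cmod (ip M f g) \<le> nrm M f * nrm M g"
proof (cases "nrm M g = 0")
  case True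
  then have "AE x in M. g x = 0" using g nrm_eq_0_iff by blast
  then have "ip M f g = ip M f (\<lambda>_. 0)" by (intro ip_cong_AE) (auto simp: f g L2_zero)
  then show ?thesis by simp
next
  case False
  \<comment> \<open>\<open>t * g\<close> is the orthogonal projection of \<open>f\<close> onto the
    line of \<open>g\<close>; it makes the factor of \<open>cnj t\<close> below vanish.\<close>
  define t where "t = ip M f g / of_real ((nrm M g)\<^sup>2)"
  have tg: "(\<lambda>x. t * g x) \<in> L2 M" by (rule L2_scale[OF g])
  have "0 \<le> (nrm M (\<lambda>x. f x - t * g x))\<^sup>2" by simp
  also have "\<dots> = Re (ip M f f - t * ip M g f - cnj t * (ip M f g - t * ip M g g))"
    unfolding nrm_sq_ip using f g tg
    by (simp add: ip_diff_left ip_diff_right ip_scale_left ip_scale_right L2_diff)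
       (simp add: algebra_simps)
  also have "ip M f g - t * ip M g g = 0"
    using False by (simp add: t_def ip_self)
  also have "t * ip M g f = of_real ((cmod (ip M f g))\<^sup>2 / (nrm M g)\<^sup>2)"
    unfolding t_def ip_commute[of M g f] by (simp add: complex_norm_square[symmetric])
  finally have "(cmod (ip M f g))\<^sup>2 / (nrm M g)\<^sup>2 \<le> (nrm M f)\<^sup>2"
    by (simp add: ip_self)
  then have "(cmod (ip M f g))\<^sup>2 \<le> (nrm M f * nrm M g)\<^sup>2"
    using False by (simp add: field_simps)
  then show ?thesis by (rule power2_le_imp_le) simp
qed

lemma cnj_ip: "cnj (ip M f g) = ip M g f"
  by (rule ip_commute[symmetric])

lemma nrm_diff_sq:
  assumes "f \<in> L2 M" "g \<in> L2 M"
  shows "(nrm M (\<lambda>x. f x - g x))\<^sup>2 = (nrm M f)\<^sup>2 - 2 * Re (ip M f g) + (nrm M g)\<^sup>2"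
  unfolding nrm_sq_ip using assms
  by (simp add: ip_diff_left ip_diff_right L2_diff) (simp add: ip_commute[of M g f])

lemma nrm_add_sq:
  assumes "f \<in> L2 M" "g \<in> L2 M"
  shows "(nrm M (\<lambda>x. f x + g x))\<^sup>2 = (nrm M f)\<^sup>2 + 2 * Re (ip M f g) + (nrm M g)\<^sup>2"
  unfolding nrm_sq_ip using assms
  by (simp add: ip_add_left ip_add_right L2_add) (simp add: ip_commute[of M g f])

lemma nrm_triangle:
  assumes f: "f \<in> L2 M" and g: "g \<in> L2 M"
  shows "nrm M (\<lambda>x. f x + g x) \<le> nrm M f + nrm M g"
proof (rule power2_le_imp_le)
  have "(nrm M (\<lambda>x. f x + g x))\<^sup>2 = (nrm M f)\<^sup>2 + 2 * Re (ip M f g) + (nrm M g)\<^sup>2"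
    unfolding nrm_sq_ip using f g
    by (simp add: ip_add_left ip_add_right L2_add) (simp add: ip_commute[of M g f])
  also have "Re (ip M f g) \<le> nrm M f * nrm M g"
    using ip_Cauchy_Schwarz[OF f g] complex_Re_le_cmod order_trans by blast
  finally show "(nrm M (\<lambda>x. f x + g x))\<^sup>2 \<le> (nrm M f + nrm M g)\<^sup>2"
    by (simp add: power2_eq_square algebra_simps)
qed auto

lemma nrm_diff_le:
  assumes f: "f \<in> L2 M" and g: "g \<in> L2 M"
  shows "nrm M (\<lambda>x. f x - g x) \<le> nrm M f + nrm M g"
  using nrm_triangle[OF f L2_scale[OF g, of "-1"]] nrm_scale[of M "-1" g] by simp

lemma nrm_triangle_diff:
  assumes "f \<in> L2 M" "g \<in> L2 M" "h \<in> L2 M"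
  shows "nrm M (\<lambda>x. f x - h x) \<le> nrm M (\<lambda>x. f x - g x) + nrm M (\<lambda>x. g x - h x)"
  using nrm_triangle[of "\<lambda>x. f x - g x" M "\<lambda>x. g x - h x"] assms by (simp add: L2_diff)

lemma nrm_abs_diff_le:
  assumes "f \<in> L2 M" "g \<in> L2 M"
  shows "\<bar>nrm M f - nrm M g\<bar> \<le> nrm M (\<lambda>x. f x - g x)"
  using nrm_triangle[of "\<lambda>x. f x - g x" M g] nrm_triangle[of "\<lambda>x. g x - f x" M f] assms
  by (simp add: L2_diff nrm_minus_commute[of M g f])

lemma nrm_tendsto:
  assumes "\<And>n. f n \<in> L2 M" "g \<in> L2 M" "(\<lambda>n. nrm M (\<lambda>x. f n x - g x)) \<longlonglongrightarrow> 0"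
  shows "(\<lambda>n. nrm M (f n)) \<longlonglongrightarrow> nrm M g"
proof -
  have "(\<lambda>n. nrm M (f n) - nrm M g) \<longlonglongrightarrow> 0"
    by (rule Lim_null_comparison[OF _ assms(3)])
      (use nrm_abs_diff_le[OF assms(1,2)] in \<open>simp only: real_norm_def eventually_sequentially\<close>, auto)
  then show ?thesis by (simp add: LIM_zero_iff)
qed

lemma ip_tendsto:
  assumes "\<And>n. f n \<in> L2 M" "g \<in> L2 M" "(\<lambda>n. nrm M (\<lambda>x. f n x - g x)) \<longlonglongrightarrow> 0" "h \<in> L2 M"
  shows "(\<lambda>n. ip M (f n) h) \<longlonglongrightarrow> ip M g h"
proof -
  have "(\<lambda>n. ip M (f n) h - ip M g h) \<longlonglongrightarrow> 0"
  proof (rule Lim_null_comparison[OF _ tendsto_mult_left_zero[OF assms(3), of "nrm M h"]])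
    have "cmod (ip M (f n) h - ip M g h) \<le> nrm M (\<lambda>x. f n x - g x) * nrm M h" for n
      using ip_Cauchy_Schwarz[of "\<lambda>x. f n x - g x" M h] assms by (simp add: ip_diff_left L2_diff)
    then show "\<forall>\<^sub>F n in sequentially. norm (ip M (f n) h - ip M g h) \<le> nrm M (\<lambda>x. f n x - g x) * nrm M h"
      by simp
  qed
  then show ?thesis by (simp add: LIM_zero_iff)
qed

text \<open>The map from \<open>x\<close> to the coefficients \<open>ip M x (e k)\<close> is adjoint
  to the synthesis map bounded in the hypothesis, so it obeys the same bound. Pairing
  \<open>x\<close> with the sum weighted by its own coefficients gives \<open>S\<close>, and
  Cauchy-Schwarz yields \<open>S^2 \<le> C S |x|^2\<close>.\<close>

lemma Bessel_dual:
  assumes "finite F" "\<And>k. k \<in> F \<Longrightarrow> e k \<in> L2 M" "x \<in> L2 M" "C \<ge> 0"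
    and bd: "\<And>c :: 'k \<Rightarrow> complex. (nrm M (\<lambda>t. \<Sum>k\<in>F. c k * e k t))\<^sup>2 \<le> C * (\<Sum>k\<in>F. (cmod (c k))\<^sup>2)"
  shows "(\<Sum>k\<in>F. (cmod (ip M x (e k)))\<^sup>2) \<le> C * (nrm M x)\<^sup>2"
proof -
  define c where "c k = ip M x (e k)" for k
  define S where "S = (\<Sum>k\<in>F. (cmod (c k))\<^sup>2)"
  have mem: "(\<lambda>t. \<Sum>k\<in>F. c k * e k t) \<in> L2 M"
    by (intro L2_sum L2_scale assms)
  have "ip M x (\<lambda>t. \<Sum>k\<in>F. c k * e k t) = (\<Sum>k\<in>F. cnj (c k) * c k)"
    by (subst ip_sum_right) (auto simp: ip_scale_right c_def assms L2_scale)
  also have "\<dots> = of_real S"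
    unfolding S_def of_real_sum by (intro sum.cong refl) (simp only: complex_norm_square mult.commute)
  finally have eq: "ip M x (\<lambda>t. \<Sum>k\<in>F. c k * e k t) = of_real S" .
  have S0: "S \<ge> 0" unfolding S_def by (auto intro: sum_nonneg)
  have "S \<le> nrm M x * nrm M (\<lambda>t. \<Sum>k\<in>F. c k * e k t)"
    using ip_Cauchy_Schwarz[OF assms(3) mem] S0 unfolding eq by simp
  then have "S\<^sup>2 \<le> (nrm M x * nrm M (\<lambda>t. \<Sum>k\<in>F. c k * e k t))\<^sup>2"
    using S0 by (intro power_mono) auto
  also have "\<dots> \<le> (nrm M x)\<^sup>2 * (C * S)"
    unfolding power_mult_distrib S_def by (intro mult_left_mono bd) auto
  finally have "S * S \<le> (C * (nrm M x)\<^sup>2) * S"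
    by (simp add: power2_eq_square algebra_simps)
  then have "S \<le> C * (nrm M x)\<^sup>2"
    using S0 assms(4) by (cases "S = 0") auto
  then show ?thesis by (simp add: S_def c_def)
qed

section \<open>Approximation in the mean\<close>

text \<open>Closedness is left out so that the notion covers dense subspaces such as
  \<open>trig\<close> along with the spaces on which the operators act.\<close>

definition lin_sub :: "'a measure \<Rightarrow> ('a \<Rightarrow> complex) set \<Rightarrow> bool" where
  "lin_sub M V \<longleftrightarrow> V \<subseteq> L2 M \<and> (\<lambda>_. 0) \<in> V \<and> (\<forall>f\<in>V. \<forall>g\<in>V. (\<lambda>x. f x + g x) \<in> V) \<and>
     (\<forall>f\<in>V. \<forall>c. (\<lambda>x. c * f x) \<in> V)"

lemma lin_subD:
  assumes "lin_sub M V"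
  shows "f \<in> V \<Longrightarrow> f \<in> L2 M" "(\<lambda>_. 0) \<in> V" "f \<in> V \<Longrightarrow> g \<in> V \<Longrightarrow> (\<lambda>x. f x + g x) \<in> V"
    "f \<in> V \<Longrightarrow> (\<lambda>x. c * f x) \<in> V"
  using assms by (auto simp: lin_sub_def)

lemma lin_sub_diff:
  assumes "lin_sub M V" "f \<in> V" "g \<in> V"
  shows "(\<lambda>x. f x - g x) \<in> V"
  using lin_subD(3)[OF assms(1,2) lin_subD(4)[OF assms(1,3), of "-1"]] by simp

lemma lin_sub_Int:
  assumes "lin_sub M A" "lin_sub M B"
  shows "lin_sub M (A \<inter> B)"
  using assms unfolding lin_sub_def by (simp add: le_infI1)

lemma lin_sub_sum:
  assumes "lin_sub M V" "\<And>i. i \<in> I \<Longrightarrow> f i \<in> V"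
  shows "(\<lambda>x. \<Sum>i\<in>I. f i x) \<in> V"
  using assms(2)
  by (induction I rule: infinite_finite_induct) (auto intro: lin_subD[OF assms(1)])

definition L2_closure :: "'a measure \<Rightarrow> ('a \<Rightarrow> complex) set \<Rightarrow> ('a \<Rightarrow> complex) set" where
  "L2_closure M A = {f \<in> L2 M. \<forall>e>0. \<exists>g\<in>A. nrm M (\<lambda>x. f x - g x) < e}"

lemma L2_closure_lin_sub:
  assumes "lin_sub M A"
  shows "lin_sub M (L2_closure M A)"
  unfolding lin_sub_def
proof (intro conjI ballI allI)
  show "(\<lambda>_. 0) \<in> L2_closure M A"
    using lin_subD(2)[OF assms] by (auto simp: L2_closure_def L2_zero intro!: bexI[of _ "\<lambda>_. 0"])
next
  fix f g assume f: "f \<in> L2_closure M A" and g: "g \<in> L2_closure M A"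
  show "(\<lambda>x. f x + g x) \<in> L2_closure M A"
    unfolding L2_closure_def
  proof (intro CollectI conjI allI impI)
    fix e :: real assume "e > 0"
    then have "e / 2 > 0" by simp
    then obtain f' g' where *: "f' \<in> A" "nrm M (\<lambda>x. f x - f' x) < e / 2"
        "g' \<in> A" "nrm M (\<lambda>x. g x - g' x) < e / 2"
      using f g unfolding L2_closure_def by blast
    have "nrm M (\<lambda>x. (f x - f' x) + (g x - g' x)) \<le> nrm M (\<lambda>x. f x - f' x) + nrm M (\<lambda>x. g x - g' x)"
      using f g * lin_subD(1)[OF assms] by (intro nrm_triangle) (auto simp: L2_closure_def L2_diff)
    then have "nrm M (\<lambda>x. (f x + g x) - (f' x + g' x)) < e"
      using * by (simp add: algebra_simps)
    then show "\<exists>h\<in>A. nrm M (\<lambda>x. (f x + g x) - h x) < e"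
      using lin_subD(3)[OF assms *(1,3)] by (intro bexI[of _ "\<lambda>x. f' x + g' x"])
  qed (use f g in \<open>auto simp: L2_closure_def L2_add\<close>)
next
  fix f c assume f: "f \<in> L2_closure M A"
  show "(\<lambda>x. c * f x) \<in> L2_closure M A"
    unfolding L2_closure_def
  proof (intro CollectI conjI allI impI)
    fix e :: real assume "e > 0"
    \<comment> \<open>The summand 1 covers \<open>c = 0\<close>.\<close>
    then have "e / (cmod c + 1) > 0" by (simp add: add_nonneg_pos)
    then obtain f' where *: "f' \<in> A" "nrm M (\<lambda>x. f x - f' x) < e / (cmod c + 1)"
      using f unfolding L2_closure_def by blast
    have "nrm M (\<lambda>x. c * f x - c * f' x) = cmod c * nrm M (\<lambda>x. f x - f' x)"
      unfolding nrm_scale[symmetric] by (simp add: algebra_simps)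
    also have "\<dots> \<le> (cmod c + 1) * nrm M (\<lambda>x. f x - f' x)"
      by (intro mult_right_mono) auto
    also have "\<dots> < e"
      using *(2) by (subst (asm) pos_less_divide_eq) (auto simp: mult.commute add_nonneg_pos)
    finally show "\<exists>h\<in>A. nrm M (\<lambda>x. c * f x - h x) < e"
      using lin_subD(4)[OF assms *(1)] by (intro bexI[of _ "\<lambda>x. c * f' x"])
  qed (use f in \<open>auto simp: L2_closure_def L2_scale\<close>)
qed (auto simp: L2_closure_def)

lemma L2_closure_limit:
  assumes A: "A \<subseteq> L2 M" and f: "\<And>n. f n \<in> L2_closure M A" and g: "g \<in> L2 M"
    and lim: "(\<lambda>n. nrm M (\<lambda>x. f n x - g x)) \<longlonglongrightarrow> 0"
  shows "g \<in> L2_closure M A"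
  unfolding L2_closure_def
proof (intro CollectI conjI allI impI g)
  fix e :: real assume "e > 0"
  then have e: "e / 2 > 0" by simp
  obtain n where n: "nrm M (\<lambda>x. f n x - g x) < e / 2"
    using order_tendstoD(2)[OF lim e] by (auto simp: eventually_sequentially)
  obtain h where h: "h \<in> A" "nrm M (\<lambda>x. f n x - h x) < e / 2"
    using f[of n] e unfolding L2_closure_def by blast
  have "nrm M (\<lambda>x. g x - h x) \<le> nrm M (\<lambda>x. g x - f n x) + nrm M (\<lambda>x. f n x - h x)"
    using f[of n] g h A by (intro nrm_triangle_diff) (auto simp: L2_closure_def)
  then show "\<exists>h\<in>A. nrm M (\<lambda>x. g x - h x) < e"
    using n h nrm_minus_commute[of M g "f n"] by (intro bexI[of _ h]) auto
qed

lemma L2_dominated_convergence: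
  fixes f :: "nat \<Rightarrow> 'a \<Rightarrow> complex"
  assumes [measurable]: "\<And>n. f n \<in> borel_measurable M" "g \<in> borel_measurable M"
    and w: "integrable M (\<lambda>x. (w x)\<^sup>2)"
    and bd: "\<And>n. AE x in M. cmod (f n x) \<le> w x"
    and lim: "AE x in M. (\<lambda>n. f n x) \<longlonglongrightarrow> g x"
  shows "g \<in> L2 M" "(\<lambda>n. nrm M (\<lambda>x. f n x - g x)) \<longlonglongrightarrow> 0"
proof -
  have bda: "AE x in M. \<forall>n. cmod (f n x) \<le> w x" using bd by (simp add: AE_all_countable)
  have gw: "AE x in M. cmod (g x) \<le> w x"
    using bda lim
  proof eventually_elim
    case (elim x)
    then show ?case by (intro LIMSEQ_le_const2[OF tendsto_norm[OF elim(2)]]) auto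
  qed
  show "g \<in> L2 M"
    by (rule L2_dominated[OF _ w]) (use gw in \<open>auto elim!: eventually_mono intro: power_mono\<close>)
  have "(\<lambda>n. LINT x|M. (cmod (f n x - g x))\<^sup>2) \<longlonglongrightarrow> (LINT x|M. 0)"
  proof (rule integral_dominated_convergence[where w = "\<lambda>x. 4 * (w x)\<^sup>2"])
    show "AE x in M. (\<lambda>n. (cmod (f n x - g x))\<^sup>2) \<longlonglongrightarrow> 0"
      using lim
    proof eventually_elim
      case (elim x)
      have "(\<lambda>n. (cmod (f n x - g x))\<^sup>2) \<longlonglongrightarrow> (cmod (g x - g x))\<^sup>2"
        by (intro tendsto_intros elim)
      then show ?case by simp
    qed
    show "AE x in M. norm ((cmod (f n x - g x))\<^sup>2) \<le> 4 * (w x)\<^sup>2" for n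
      using bda gw
    proof eventually_elim
      case (elim x)
      have "cmod (f n x - g x) \<le> 2 * w x"
        using norm_triangle_ineq4[of "f n x" "g x"] elim(1)[rule_format, of n] elim(2) by linarith
      then have "(cmod (f n x - g x))\<^sup>2 \<le> (2 * w x)\<^sup>2" by (intro power_mono) auto
      then show ?case by (simp add: power_mult_distrib)
    qed
  qed (use w in auto)
  then have "(\<lambda>n. sqrt (LINT x|M. (cmod (f n x - g x))\<^sup>2)) \<longlonglongrightarrow> sqrt 0"
    by (intro tendsto_real_sqrt) simp
  then show "(\<lambda>n. nrm M (\<lambda>x. f n x - g x)) \<longlonglongrightarrow> 0" by (simp add: nrm_def)
qed

lemma L2_simple_approx:
  assumes "f \<in> L2 M"
  shows "\<exists>s. (\<forall>n. simple_function M (s n) \<and> s n \<in> L2 M) \<and> (\<lambda>n. nrm M (\<lambda>x. s n x - f x)) \<longlonglongrightarrow> 0"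
proof -
  have f[measurable]: "f \<in> borel_measurable M" by (rule L2_measurable[OF assms])
  obtain s where s: "\<And>i. simple_function M (s i)" "\<And>x. x \<in> space M \<Longrightarrow> (\<lambda>i. s i x) \<longlonglongrightarrow> f x"
      "\<And>i x. x \<in> space M \<Longrightarrow> cmod (s i x) \<le> 2 * cmod (f x)"
    using borel_measurable_implies_sequence_metric[OF f, of 0] by (auto simp: dist_norm) metis
  have w: "integrable M (\<lambda>x. (2 * cmod (f x))\<^sup>2)"
    using assms by (simp add: power_mult_distrib L2_def)
  have m[measurable]: "\<And>i. s i \<in> borel_measurable M" using s(1) by (rule borel_measurable_simple_function)
  have "(cmod (s n x))\<^sup>2 \<le> (2 * cmod (f x))\<^sup>2" if "x \<in> space M" for n x
    using s(3)[OF that] by (intro power_mono) auto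
  then have "s n \<in> L2 M" for n
    by (intro L2_dominated[OF _ w]) auto
  moreover have "(\<lambda>n. nrm M (\<lambda>x. s n x - f x)) \<longlonglongrightarrow> 0"
    by (rule L2_dominated_convergence(2)[OF _ _ w]) (use s in auto)
  ultimately show ?thesis using s(1) by blast
qed

lemma closed_indicator_approx:
  fixes F :: "'a::metric_space set"
  assumes "closed F"
  obtains h :: "nat \<Rightarrow> 'a \<Rightarrow> real" where "\<And>n. continuous_on UNIV (h n)" "\<And>n x. 0 \<le> h n x \<and> h n x \<le> 1"
    "\<And>x. (\<lambda>n. h n x) \<longlonglongrightarrow> indicator F x"
proof (cases "F = {}")
  case True
  then show ?thesis by (intro that[of "\<lambda>_ _. 0"]) auto
next
  case False
  \<comment> \<open>A tent of slope \<open>n\<close> over \<open>F\<close>. As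
    \<open>infdist x {}\<close> is 0, the formula would give the constant 1 for empty
    \<open>F\<close>, hence the case distinction.\<close>
  define h where "h n x = max 0 (1 - real n * infdist x F)" for n x
  have lim: "(\<lambda>n. h n x) \<longlonglongrightarrow> indicator F x" for x
  proof (cases "x \<in> F")
    case True
    then have "h n x = 1" for n by (simp add: h_def)
    then show ?thesis using True by simp
  next
    case nF: False
    then have d: "infdist x F > 0"
      using assms False in_closed_iff_infdist_zero[of F x] infdist_nonneg[of x F] by linarith
    obtain N where N: "1 / infdist x F < real N" using reals_Archimedean2 by blast
    have "h n x = 0" if "n \<ge> N" for n
    proof -
      have "1 < real N * infdist x F" using N d by (simp add: field_simps)
      also have "\<dots> \<le> real n * infdist x F" using that d by (intro mult_right_mono) auto
      finally show ?thesis by (simp add: h_def)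
    qed
    then have "\<forall>\<^sub>F n in sequentially. h n x = 0"
      unfolding eventually_sequentially by (intro exI[of _ N]) auto
    then show ?thesis using nF by (simp add: tendsto_eventually)
  qed
  show ?thesis
    by (rule that[of h]) (use lim in \<open>auto simp: h_def infdist_nonneg intro!: continuous_intros\<close>)
qed

text \<open>The closure of \<open>A\<close> is a subspace stable under limits in the mean.
  Indicators of closed sets are limits of continuous functions, and the Borel sets with indicator in
  the closure form a Dynkin system, so all Borel sets occur; then simple functions and their limits
  follow. This serves trigonometric polynomials on the circle and even polynomials on the
  line.\<close>

lemma L2_dense_if_continuous:
  fixes M :: "'a::metric_space measure"
  assumes sets[measurable_cong]: "sets M = sets borel" and fin: "finite_measure M" and A: "lin_sub M A"
    and cont: "\<And>h :: 'a \<Rightarrow> real. continuous_on UNIV h \<Longrightarrow> (\<And>x. 0 \<le> h x \<and> h x \<le> 1) \<Longrightarrow>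
       (\<lambda>x. complex_of_real (h x)) \<in> L2_closure M A"
  shows "L2_closure M A = L2 M"
proof -
  have AL: "A \<subseteq> L2 M" using A by (simp add: lin_sub_def)
  have spM: "space M = UNIV" using sets_eq_imp_space_eq[OF sets] by simp
  have cl: "lin_sub M (L2_closure M A)" by (rule L2_closure_lin_sub[OF A])
  have int1: "integrable M (\<lambda>x. (1::real)\<^sup>2)" using fin by (simp add: finite_measure.integrable_const)
  have ind: "(\<lambda>x. indicator X x :: complex) \<in> L2_closure M A" if "X \<in> sets borel" for X
  proof -
    have "Int_stable (Collect closed :: 'a set set)" "Collect closed \<subseteq> Pow (UNIV :: 'a set)"
        "X \<in> sigma_sets UNIV (Collect closed)"
      using that by (auto simp: borel_eq_closed Int_stable_def)
    then show ?thesis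
    proof (induction rule: sigma_sets_induct_disjoint)
      case (basic F)
      have [measurable]: "F \<in> sets M" using basic sets by simp
      obtain h :: "nat \<Rightarrow> 'a \<Rightarrow> real" where hc: "\<And>n. continuous_on UNIV (h n)"
        and h01: "\<And>n x. 0 \<le> h n x \<and> h n x \<le> 1" and hlim: "\<And>x. (\<lambda>n. h n x) \<longlonglongrightarrow> indicator F x"
        using closed_indicator_approx[of F] basic by auto
      have [measurable]: "h n \<in> borel_measurable M" for n
        using borel_measurable_continuous_onI[OF hc] by measurable
      have hcl: "(\<lambda>x. complex_of_real (h n x)) \<in> L2_closure M A" for n
        by (rule cont[OF hc h01])
      have lim: "(\<lambda>n. complex_of_real (h n x)) \<longlonglongrightarrow> indicator F x" for x
      proof -
        have "(\<lambda>n. complex_of_real (h n x)) \<longlonglongrightarrow> complex_of_real (indicator F x)"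
          by (rule tendsto_of_real[OF hlim])
        then show ?thesis by (cases "x \<in> F") simp_all
      qed
      note D = L2_dominated_convergence[where f = "\<lambda>n x. complex_of_real (h n x)" and
          g = "\<lambda>x. indicator F x" and w = "\<lambda>_. 1", OF _ _ int1]
      have bd: "cmod (complex_of_real (h n x)) \<le> 1" for n x using h01[of n x] by simp
      have "(\<lambda>x. indicator F x) \<in> L2 M"
          "(\<lambda>n. nrm M (\<lambda>x. complex_of_real (h n x) - indicator F x)) \<longlonglongrightarrow> 0"
        by (rule D; use bd lim in \<open>auto simp del: norm_of_real\<close>)+
      then show ?case by (rule L2_closure_limit[OF AL hcl])
    next
      case empty then show ?case using lin_subD(2)[OF cl] by simp
    next
      case (compl X)
      have "(\<lambda>x. complex_of_real 1) \<in> L2_closure M A" by (rule cont) auto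
      moreover have "(indicator (UNIV - X) :: 'a \<Rightarrow> complex) = (\<lambda>x. complex_of_real 1 - indicator X x)"
        by (auto simp: indicator_def fun_eq_iff)
      ultimately show ?case using lin_sub_diff[OF cl _ compl(2)] by simp
    next
      case (union X)
      have [measurable]: "X i \<in> sets M" for i
        using union(2) sets by (auto simp: borel_eq_closed)
      have fin_un: "(\<lambda>x. indicator (\<Union>i<n. X i) x :: complex) \<in> L2_closure M A" for n
      proof -
        have "(\<lambda>x. \<Sum>i<n. indicator (X i) x :: complex) \<in> L2_closure M A"
          by (rule lin_sub_sum[OF cl]) (rule union(3))
        moreover have "(\<Sum>i<n. indicator (X i) x :: complex) = indicator (\<Union>i<n. X i) x" for x
          by (subst indicator_UN_disjoint) (use union(1) in \<open>auto simp: disjoint_family_on_def\<close>)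
        ultimately show ?thesis by simp
      qed
      have lim: "(\<lambda>n. indicator (\<Union>i<n. X i) x :: complex) \<longlonglongrightarrow> indicator (\<Union>i. X i) x" for x
        by (rule LIMSEQ_indicator_UN)
      note D = L2_dominated_convergence[where f = "\<lambda>n x. indicator (\<Union>i<n. X i) x" and
            g = "\<lambda>x. indicator (\<Union>i. X i) x" and w = "\<lambda>_. 1", OF _ _ int1]
      show ?case
        by (rule L2_closure_limit[OF AL fin_un])
          (rule D; use lim in \<open>auto simp: indicator_def\<close>)+
    qed
  qed
  have simple: "s \<in> L2_closure M A" if s: "simple_function M s" for s :: "'a \<Rightarrow> complex"
  proof -
    have "(\<lambda>x. \<Sum>y\<in>s ` space M. y * indicator (s -` {y} \<inter> space M) x) \<in> L2_closure M A"
      by (intro lin_sub_sum[OF cl] lin_subD(4)[OF cl] ind)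
        (use s sets in \<open>auto simp: simple_function_def\<close>)
    moreover have "(\<Sum>y\<in>s ` space M. y * indicator (s -` {y} \<inter> space M) x) = s x" for x
    proof -
      have "(\<Sum>y\<in>s ` space M. y * indicator (s -` {y} \<inter> space M) x) =
          (\<Sum>y\<in>s ` space M. if y = s x then y else 0)"
        by (intro sum.cong) (auto simp: indicator_def spM)
      also have "\<dots> = s x" using s by (subst sum.delta) (auto simp: spM simple_function_def)
      finally show ?thesis .
    qed
    ultimately show ?thesis by simp
  qed
  have "f \<in> L2_closure M A" if f: "f \<in> L2 M" for f
  proof -
    obtain s where "\<forall>n. simple_function M (s n) \<and> s n \<in> L2 M" "(\<lambda>n. nrm M (\<lambda>x. s n x - f x)) \<longlonglongrightarrow> 0"
      using L2_simple_approx[OF f] by blast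
    then show ?thesis by (intro L2_closure_limit[OF AL _ f]) (auto intro: simple)
  qed
  then show ?thesis by (auto simp: L2_closure_def)
qed

section \<open>Fourier series on the circle\<close>

lemma sets_circ [measurable_cong, simp]: "sets circ = sets borel"
  by (simp add: circ_def)

lemma space_circ [simp]: "space circ = UNIV"
  by (simp add: circ_def)

lemma measurable_cis [measurable]: "cis \<in> borel_measurable borel"
  by (intro borel_measurable_continuous_onI continuous_intros)

lemma circ_density:
  "circ = distr (density lborel (\<lambda>t. ennreal (indicator {0..2 * pi} t / (2 * pi)))) borel cis"
proof -
  have "uniform_measure lborel {0..2 * pi} = density lborel (\<lambda>t. ennreal (indicator {0..2 * pi} t / (2 * pi)))"
    unfolding uniform_measure_def
    by (intro density_cong) (auto simp: indicator_def divide_ennreal[symmetric])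
  then show ?thesis by (simp add: circ_def)
qed

lemma finite_measure_circ: "finite_measure circ"
proof
  have "emeasure circ (space circ) = emeasure (density lborel (\<lambda>t. ennreal (indicator {0..2 * pi} t / (2 * pi)))) UNIV"
    unfolding circ_density by (subst emeasure_distr) auto
  also have "\<dots> = (\<integral>\<^sup>+ t. ennreal (1 / (2 * pi)) * indicator {0..2 * pi} t \<partial>lborel)"
    by (subst emeasure_density) (auto intro!: nn_integral_cong simp: indicator_def)
  also have "\<dots> < \<infinity>"
    by (subst nn_integral_cmult_indicator) (auto simp: ennreal_mult_less_top)
  finally show "emeasure circ (space circ) \<noteq> \<infinity>" by simp
qed

lemma AE_circ: "AE z in circ. cmod z = 1"
  unfolding circ_density by (subst AE_distr_iff) auto

lemma integral_circ:
  fixes f :: "complex \<Rightarrow> complex"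
  assumes [measurable]: "f \<in> borel_measurable borel"
  shows "(LINT z|circ. f z) = (LINT t|lborel. indicator {0..2*pi} t *\<^sub>R f (cis t)) / (2 * pi)"
proof -
  have "(LINT z|circ. f z) = (LINT t|lborel. (indicator {0..2 * pi} t / (2 * pi)) *\<^sub>R f (cis t))"
    unfolding circ_density by (subst integral_distr) (auto intro!: integral_density)
  also have "\<dots> = (LINT t|lborel. (indicator {0..2 * pi} t *\<^sub>R f (cis t)) / (2 * pi))"
    by (intro Bochner_Integration.integral_cong) (auto simp: indicator_def scaleR_conv_of_real field_simps)
  finally show ?thesis by simp
qed

lemma measurable_powi [measurable]: "(\<lambda>z::complex. z powi n) \<in> borel_measurable borel"
  unfolding power_int_def by (cases "n \<ge> 0") auto

lemma cnj_powi: "cmod z = 1 \<Longrightarrow> cnj z powi n = z powi (- n)"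
proof -
  assume "cmod z = 1"
  then have "z * cnj z = 1" using complex_norm_square[of z] by simp
  then have "cnj z = inverse z" by (rule inverse_unique[symmetric])
  then show ?thesis by (simp add: power_int_minus power_int_inverse)
qed

text \<open>The left end \<open>x\<close> is free because the integral is taken over
  \<open>{0..2 * pi}\<close> for the circle and over a period starting elsewhere on the spectral
  side.\<close>

lemma integral_cis_interval:
  assumes "n \<noteq> 0"
  shows "(LINT t|lborel. indicator {x..x + 2*pi} t *\<^sub>R cis (real_of_int n * t)) = 0"
proof -
  have "(LINT t|lborel. indicator {x..x + 2*pi} t *\<^sub>R cis (real_of_int n * t)) =
      cis (real_of_int n * (x + 2*pi)) / (\<i> * n) - cis (real_of_int n * x) / (\<i> * n)"
  proof (rule integral_FTC_atLeastAtMost)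
    show "((\<lambda>t. cis (real_of_int n * t) / (\<i> * n)) has_vector_derivative cis (real_of_int n * t)) (at t within {x..x+2*pi})" for t
    proof -
      have "((\<lambda>w. exp (\<i> * n * w) / (\<i> * n)) has_field_derivative exp (\<i> * n * complex_of_real t)) (at (complex_of_real t))"
        using assms by (auto intro!: derivative_eq_intros)
      from has_vector_derivative_real_field[OF this] show ?thesis
        by (auto simp: cis_conv_exp mult.assoc intro: has_vector_derivative_at_within)
    qed
  qed (auto intro!: continuous_intros)
  also have "cis (real_of_int n * (x + 2*pi)) = cis (real_of_int n * x)"
    using cis_multiple_2pi[of "real_of_int n"] by (simp add: distrib_left cis_mult[symmetric] mult.commute)
  finally show ?thesis by simp
qed

lemma integral_powi: "(LINT z|circ. z powi n) = (if n = 0 then 1 else 0)"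
proof (cases "n = 0")
  case True
  then show ?thesis by (subst integral_circ) (auto simp: scaleR_conv_of_real)
next
  case False
  then show ?thesis using integral_cis_interval[OF False, of 0]
    by (subst integral_circ) (auto simp: cis_power_int)
qed

lemma measure_circ: "measure circ UNIV = 1"
  using integral_powi[of 0] by (simp add: scaleR_conv_of_real)

lemma norm_powi: "cmod z = 1 \<Longrightarrow> cmod (z powi n) = 1"
  by (simp add: norm_power_int)

lemma powi_L2: "(\<lambda>z. z powi n) \<in> L2 circ"
  by (rule L2_bounded[OF finite_measure_circ, of _ 1]) (use AE_circ in \<open>auto elim!: eventually_mono simp: norm_powi\<close>)

text \<open>The integrands agree only on the unit circle, where \<open>z powi (- n)\<close> is the
  conjugate of \<open>z powi n\<close>; hence an almost-everywhere argument.\<close>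

lemma fourier_coeff_ip:
  assumes "f \<in> L2 circ"
  shows "fourier_coeff f n = ip circ f (\<lambda>z. z powi n)"
  unfolding fourier_coeff_def ip_def
  by (rule integral_cong_AE) (use AE_circ L2_measurable[OF assms] in \<open>auto elim!: eventually_mono simp: cnj_powi\<close>)

lemma ip_powi: "ip circ (\<lambda>z. z powi n) (\<lambda>z. z powi m) = (if n = m then 1 else 0)"
proof -
  have "ip circ (\<lambda>z. z powi n) (\<lambda>z. z powi m) = (LINT z|circ. z powi (n - m))"
    unfolding ip_def
  proof (rule integral_cong_AE)
    show "AE z in circ. z powi n * cnj (z powi m) = z powi (n - m)"
      using AE_circ
    proof eventually_elim
      case (elim z)
      then have "z powi (n + - m) = z powi n * z powi (- m)" by (intro power_int_add) auto
      then show ?case using elim by (simp add: cnj_powi)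
    qed
  qed auto
  then show ?thesis by (auto simp: integral_powi)
qed

section \<open>Density of trigonometric polynomials\<close>

inductive_set trig :: "(complex \<Rightarrow> complex) set" where
  trig_mono: "(\<lambda>z. c * z powi n) \<in> trig"
| trig_add: "f \<in> trig \<Longrightarrow> g \<in> trig \<Longrightarrow> (\<lambda>z. f z + g z) \<in> trig"

lemma trig_scale: "f \<in> trig \<Longrightarrow> (\<lambda>z. c * f z) \<in> trig"
proof (induction rule: trig.induct)
  case (trig_mono d n)
  show ?case using trig.trig_mono[of "c * d" n] by (simp add: mult.assoc)
next
  case (trig_add f g)
  then show ?case using trig.trig_add by (simp add: distrib_left)
qed

text \<open>Restricted to the circle because exponents add only for nonzero \<open>z\<close>: at 0,
  \<open>z powi 1 * z powi (-1)\<close> is 0 but \<open>z powi 0\<close> is 1.\<close>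

lemma trig_mult:
  assumes "f \<in> trig" "g \<in> trig"
  shows "\<exists>h\<in>trig. \<forall>z\<in>sphere 0 1. h z = f z * g z"
  using assms
proof (induction rule: trig.induct)
  case (trig_mono c n)
  show ?case using trig_mono.prems
  proof (induction rule: trig.induct)
    case (trig_mono d m)
    show ?case
    proof (rule bexI[OF _ trig.trig_mono[of "c * d" "n + m"]], intro ballI)
      fix z :: complex assume "z \<in> sphere 0 1"
      then have "z powi (n + m) = z powi n * z powi m" by (intro power_int_add) auto
      then show "c * d * z powi (n + m) = c * z powi n * (d * z powi m)" by simp
    qed
  next
    case (trig_add f g)
    then obtain h k where "h \<in> trig" "k \<in> trig" "\<forall>z\<in>sphere 0 1. h z = c * z powi n * f z"
      "\<forall>z\<in>sphere 0 1. k z = c * z powi n * g z" by blast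
    then show ?case by (intro bexI[of _ "\<lambda>z. h z + k z"] trig.trig_add) (auto simp: distrib_left)
  qed
next
  case (trig_add f f')
  then obtain h k where "h \<in> trig" "k \<in> trig" "\<forall>z\<in>sphere 0 1. h z = f z * g z"
    "\<forall>z\<in>sphere 0 1. k z = f' z * g z" by blast
  then show ?case by (intro bexI[of _ "\<lambda>z. h z + k z"] trig.trig_add) (auto simp: distrib_right)
qed

lemma trig_sum: "f \<in> trig \<Longrightarrow> \<exists>K c. finite K \<and> f = (\<lambda>z. \<Sum>k\<in>K. c k * z powi k)"
proof (induction rule: trig.induct)
  case (trig_mono c n)
  then show ?case by (intro exI[of _ "{n}"] exI[of _ "\<lambda>_. c"]) auto
next
  case (trig_add f g)
  then obtain K c L d where *: "finite K" "f = (\<lambda>z. \<Sum>k\<in>K. c k * z powi k)"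
    "finite L" "g = (\<lambda>z. \<Sum>k\<in>L. d k * z powi k)" by blast
  have e: "(\<Sum>k\<in>K. c k * z powi k) = (\<Sum>k\<in>K\<union>L. (if k \<in> K then c k else 0) * z powi k)"
      "(\<Sum>k\<in>L. d k * z powi k) = (\<Sum>k\<in>K\<union>L. (if k \<in> L then d k else 0) * z powi k)" for z
    using *(1,3) by (auto intro!: sum.mono_neutral_cong_left)
  show ?case
    by (rule exI[of _ "K \<union> L"], rule exI[of _ "\<lambda>k. (if k \<in> K then c k else 0) + (if k \<in> L then d k else 0)"])
      (use *(1,3) in \<open>simp add: *(2,4) e distrib_right sum.distrib\<close>)
qed

lemma trig_lin_sub: "lin_sub circ trig"
  unfolding lin_sub_def
proof (intro conjI ballI allI)
  show "trig \<subseteq> L2 circ"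
  proof
    fix f assume "f \<in> trig" then show "f \<in> L2 circ"
      by induction (auto intro: L2_scale L2_add powi_L2)
  qed
qed (use trig_mono[of 0 0] in \<open>auto intro: trig_add trig_scale\<close>)

text \<open>Stone-Weierstrass works with real functions, so the ring \<open>R\<close> collects the
  real functions that coincide on the circle with a member of \<open>trig\<close>. As
  \<open>z powi (-1)\<close> is \<open>cnj z\<close> there, \<open>Re\<close> and \<open>Im\<close>
  belong to \<open>R\<close> and separate points.\<close>

lemma trig_uniform:
  fixes h :: "complex \<Rightarrow> real"
  assumes "continuous_on UNIV h" "e > 0"
  shows "\<exists>g\<in>trig. \<forall>z\<in>sphere 0 1. cmod (complex_of_real (h z) - g z) < e"
proof -
  define R :: "(complex \<Rightarrow> real) set" where
    "R = {f. continuous_on (sphere 0 1) f \<and> (\<exists>g\<in>trig. \<forall>z\<in>sphere 0 1. complex_of_real (f z) = g z)}"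
  have powi1: "z powi (-1) = cnj z" if "cmod z = 1" for z :: complex
    using cnj_powi[OF that, of 1] by simp
  interpret function_ring_on R "sphere 0 1"
  proof
    fix f g assume f: "f \<in> R" and g: "g \<in> R"
    then obtain f' g' where *: "f' \<in> trig" "\<forall>z\<in>sphere 0 1. complex_of_real (f z) = f' z"
       "g' \<in> trig" "\<forall>z\<in>sphere 0 1. complex_of_real (g z) = g' z" unfolding R_def by blast
    show "(\<lambda>x. f x + g x) \<in> R"
      unfolding R_def using f g * 
      by (auto simp: R_def intro!: continuous_intros bexI[of _ "\<lambda>z. f' z + g' z"] trig_add)
    obtain k where "k \<in> trig" "\<forall>z\<in>sphere 0 1. k z = f' z * g' z" using trig_mult * by blast
    then show "(\<lambda>x. f x * g x) \<in> R"
      using f g * by (auto simp: R_def intro!: continuous_intros bexI[of _ k])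
  next
    show "(\<lambda>_. c) \<in> R" for c
      unfolding R_def using trig_mono[of "of_real c" 0]
      by (auto intro!: bexI[of _ "\<lambda>z. complex_of_real c * z powi 0"])
  next
    fix x y :: complex assume xy: "x \<in> sphere 0 1" "y \<in> sphere 0 1" "x \<noteq> y"
    have re: "Re \<in> R"
      unfolding R_def
    proof (intro CollectI conjI continuous_intros bexI)
      show "(\<lambda>z. 1/2 * z powi 1 + 1/2 * z powi (-1)) \<in> trig" by (intro trig_add trig_mono)
      show "\<forall>z\<in>sphere 0 1. complex_of_real (Re z) = 1/2 * z powi 1 + 1/2 * z powi (-1)"
        by (auto simp only: powi1 mem_sphere_0 power_int_1_right) (auto simp: complex_eq_iff)
    qed
    have im: "Im \<in> R"
      unfolding R_def
    proof (intro CollectI conjI continuous_intros bexI)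
      show "(\<lambda>z. - \<i>/2 * z powi 1 + \<i>/2 * z powi (-1)) \<in> trig" by (intro trig_add trig_mono)
      show "\<forall>z\<in>sphere 0 1. complex_of_real (Im z) = - \<i>/2 * z powi 1 + \<i>/2 * z powi (-1)"
        by (auto simp only: powi1 mem_sphere_0 power_int_1_right) (auto simp: complex_eq_iff)
    qed
    show "\<exists>f\<in>R. f x \<noteq> f y" using xy(3) re im complex_eq_iff by blast
  qed (auto simp: R_def)
  obtain F where F: "\<And>n. F n \<in> R" "uniform_limit (sphere 0 1) F h sequentially"
    using Stone_Weierstrass[OF continuous_on_subset[OF assms(1)]] by auto
  from uniform_limitD[OF F(2) assms(2)] obtain n where n: "\<forall>x\<in>sphere 0 1. dist (F n x) (h x) < e"
    by (auto simp: eventually_sequentially)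
  obtain g where g: "g \<in> trig" "\<forall>z\<in>sphere 0 1. complex_of_real (F n z) = g z"
    using F(1)[of n] unfolding R_def by blast
  show ?thesis
  proof (intro bexI ballI)
    fix z :: complex assume "z \<in> sphere 0 1"
    then have "cmod (complex_of_real (h z) - g z) = dist (F n z) (h z)"
      using g(2)[rule_format, of z, symmetric] by (simp only: dist_real_def norm_of_real abs_minus_commute flip: of_real_diff)
    then show "cmod (complex_of_real (h z) - g z) < e" using n \<open>z \<in> sphere 0 1\<close> by simp
  qed (rule g)
qed

lemma trig_dense: "L2_closure circ trig = L2 circ"
proof (rule L2_dense_if_continuous[OF sets_circ finite_measure_circ trig_lin_sub])
  fix h :: "complex \<Rightarrow> real" assume h: "continuous_on UNIV h" and h01: "\<And>x. 0 \<le> h x \<and> h x \<le> 1"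
  have [measurable]: "h \<in> borel_measurable borel" using h by (rule borel_measurable_continuous_onI)
  have hL: "(\<lambda>x. complex_of_real (h x)) \<in> L2 circ"
    by (rule L2_bounded[OF finite_measure_circ, of _ 1]) (use h01 in auto)
  show "(\<lambda>x. complex_of_real (h x)) \<in> L2_closure circ trig"
    unfolding L2_closure_def
  proof (intro CollectI conjI allI impI hL)
    fix e :: real assume "e > 0"
    then obtain g where g: "g \<in> trig" "\<forall>z\<in>sphere 0 1. cmod (complex_of_real (h z) - g z) < e / 2"
      using trig_uniform[OF h, of "e / 2"] by auto
    have "nrm circ (\<lambda>x. complex_of_real (h x) - g x) \<le> e / 2"
    proof (rule power2_le_imp_le)
      have gL: "g \<in> L2 circ" using g(1) lin_subD(1)[OF trig_lin_sub] by blast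
      have "(nrm circ (\<lambda>x. complex_of_real (h x) - g x))\<^sup>2 \<le> (LINT x|circ. (e / 2)\<^sup>2)"
        unfolding nrm_sq
      proof (rule integral_mono_AE)
        show "AE x in circ. (cmod (complex_of_real (h x) - g x))\<^sup>2 \<le> (e / 2)\<^sup>2"
          using AE_circ
        proof eventually_elim
          case (elim z)
          then show ?case using g(2) by (intro power_mono) (auto intro: less_imp_le)
        qed
      qed (use L2_diff[OF hL gL] finite_measure_circ in \<open>auto simp: L2_integrable_sq finite_measure.integrable_const\<close>)
      also have "\<dots> = (e / 2)\<^sup>2"
        by (simp add: measure_circ)
      finally show "(nrm circ (\<lambda>x. complex_of_real (h x) - g x))\<^sup>2 \<le> (e / 2)\<^sup>2" .
    qed (use \<open>e > 0\<close> in auto)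
    then show "\<exists>g\<in>trig. nrm circ (\<lambda>x. complex_of_real (h x) - g x) < e"
      using g(1) \<open>e > 0\<close> by (intro bexI[of _ g]) auto
  qed
qed

section \<open>Bessel, Parseval and uniqueness in \<open>H2\<close>\<close>

lemma ip_powi_sum:
  assumes "finite K"
  shows "ip circ (\<lambda>z. \<Sum>k\<in>K. c k * z powi k) (\<lambda>z. z powi n) = (if n \<in> K then c n else 0)"
  using assms by (subst ip_sum_left) (auto simp: powi_L2 L2_scale ip_scale_left ip_powi if_distrib sum.delta cong: if_cong)

text \<open>Completing the square in the coefficients. The choice \<open>c = fourier_coeff f\<close>
  gives Bessel's inequality; a good approximation with arbitrary \<open>c\<close> gives Parseval;
  \<open>f = 0\<close> gives the norm of a trigonometric polynomial.\<close>

lemma nrm_diff_trig: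
  assumes f: "f \<in> L2 circ" and K: "finite K"
  shows "(nrm circ (\<lambda>z. f z - (\<Sum>k\<in>K. c k * z powi k)))\<^sup>2 =
    (nrm circ f)\<^sup>2 - (\<Sum>k\<in>K. (cmod (fourier_coeff f k))\<^sup>2) + (\<Sum>k\<in>K. (cmod (fourier_coeff f k - c k))\<^sup>2)"
proof -
  let ?g = "\<lambda>z::complex. \<Sum>k\<in>K. c k * z powi k"
  let ?f = "\<lambda>k. fourier_coeff f k"
  have g: "?g \<in> L2 circ" by (intro L2_sum L2_scale powi_L2)
  have fg: "ip circ f ?g = (\<Sum>k\<in>K. cnj (c k) * ?f k)"
    using f by (subst ip_sum_right) (auto simp: powi_L2 L2_scale ip_scale_right fourier_coeff_ip)
  have gf: "ip circ ?g f = (\<Sum>k\<in>K. c k * cnj (?f k))"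
    unfolding ip_commute[of circ ?g f] fg by simp
  have gg: "ip circ ?g ?g = (\<Sum>k\<in>K. c k * cnj (c k))"
    using g K by (subst ip_sum_right) (auto simp: powi_L2 L2_scale ip_scale_right ip_powi_sum mult.commute intro!: sum.cong)
  have "(nrm circ (\<lambda>z. f z - ?g z))\<^sup>2 = Re (ip circ f f - ip circ ?g f - (ip circ f ?g - ip circ ?g ?g))"
    unfolding nrm_sq_ip using f g by (simp add: ip_diff_left ip_diff_right L2_diff)
  also have "\<dots> = (nrm circ f)\<^sup>2 + Re (\<Sum>k\<in>K. c k * cnj (c k) - c k * cnj (?f k) - cnj (c k) * ?f k)"
    unfolding fg gf gg by (simp add: ip_self sum_subtractf)
  also have "(\<Sum>k\<in>K. c k * cnj (c k) - c k * cnj (?f k) - cnj (c k) * ?f k) =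
     (\<Sum>k\<in>K. of_real ((cmod (?f k - c k))\<^sup>2 - (cmod (?f k))\<^sup>2))"
    unfolding of_real_diff complex_norm_square by (intro sum.cong refl) (simp add: algebra_simps)
  finally show ?thesis by (simp add: sum_subtractf)
qed

lemma fourier_Bessel:
  assumes f: "f \<in> L2 circ" and K: "finite K"
  shows "(\<Sum>k\<in>K. (cmod (fourier_coeff f k))\<^sup>2) \<le> (nrm circ f)\<^sup>2"
proof -
  have "0 \<le> (nrm circ (\<lambda>z. f z - (\<Sum>k\<in>K. fourier_coeff f k * z powi k)))\<^sup>2" by simp
  then show ?thesis unfolding nrm_diff_trig[OF assms] by simp
qed

text \<open>A trigonometric polynomial closer to \<open>f\<close> than \<open>sqrt e\<close> leaves
  less than \<open>e\<close> of the mass of \<open>f\<close> outside its set \<open>K\<close> of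
  frequencies, by \<open>nrm_diff_trig\<close>; the negative frequencies of \<open>K\<close> carry
  nothing for \<open>f\<close> in \<open>H2\<close>.\<close>

lemma H2_Parseval:
  assumes f: "f \<in> H2" and e: "e > 0"
  shows "\<exists>N. (nrm circ f)\<^sup>2 < (\<Sum>n<N. (cmod (fourier_coeff f (int n)))\<^sup>2) + e"
proof -
  have fL: "f \<in> L2 circ" using f by (simp add: H2_def)
  have "f \<in> L2_closure circ trig" using fL by (simp add: trig_dense)
  moreover have "sqrt e > 0" using e by simp
  ultimately obtain g where g: "g \<in> trig" "nrm circ (\<lambda>x. f x - g x) < sqrt e"
    unfolding L2_closure_def by blast
  obtain K c where K: "finite K" "g = (\<lambda>z. \<Sum>k\<in>K. c k * z powi k)" using trig_sum[OF g(1)] by blast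
  have "(nrm circ (\<lambda>x. f x - g x))\<^sup>2 < (sqrt e)\<^sup>2" using g(2) by (intro power_strict_mono) auto
  then have 1: "(nrm circ f)\<^sup>2 - (\<Sum>k\<in>K. (cmod (fourier_coeff f k))\<^sup>2) +
      (\<Sum>k\<in>K. (cmod (fourier_coeff f k - c k))\<^sup>2) < e"
    unfolding K(2) nrm_diff_trig[OF fL K(1)] using e by simp
  have 2: "0 \<le> (\<Sum>k\<in>K. (cmod (fourier_coeff f k - c k))\<^sup>2)" by (intro sum_nonneg) auto
  \<comment> \<open>\<open>insert 0\<close> keeps the maximum defined for empty \<open>K\<close>;
    the \<open>+ 1\<close> lets \<open>n < N\<close> reach the largest index.\<close>
  define N where "N = nat (Max (insert 0 K)) + 1"
  have sub: "{k\<in>K. 0 \<le> k} \<subseteq> int ` {..<N}"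
  proof
    fix k assume k: "k \<in> {k\<in>K. 0 \<le> k}"
    then have "k \<le> Max (insert 0 K)" using K(1) by (intro Max_ge) auto
    then have "nat k < N" unfolding N_def by linarith
    then show "k \<in> int ` {..<N}" using k by (auto intro!: image_eqI[of _ _ "nat k"])
  qed
  have "(\<Sum>k\<in>K. (cmod (fourier_coeff f k))\<^sup>2) = (\<Sum>k\<in>{k\<in>K. 0 \<le> k}. (cmod (fourier_coeff f k))\<^sup>2)"
    using f K(1) by (intro sum.mono_neutral_right) (auto simp: H2_def, metis not_le)
  also have "\<dots> \<le> (\<Sum>k\<in>int ` {..<N}. (cmod (fourier_coeff f k))\<^sup>2)"
    by (rule sum_mono2) (use sub in auto)
  also have "\<dots> = (\<Sum>n<N. (cmod (fourier_coeff f (int n)))\<^sup>2)"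
    by (subst sum.reindex) auto
  finally show ?thesis using 1 2 by (intro exI[of _ N]) linarith
qed

text \<open>Parseval for the difference. Identities between Hankel images are proved this way,
  because \<open>szego_proj\<close> prescribes exactly membership in \<open>H2\<close> and the
  nonnegative coefficients.\<close>

lemma H2_unique:
  assumes "f \<in> H2" "g \<in> H2" "\<And>n::nat. fourier_coeff f (int n) = fourier_coeff g (int n)"
  shows "AE z in circ. f z = g z"
proof -
  have L: "f \<in> L2 circ" "g \<in> L2 circ" using assms by (auto simp: H2_def)
  have c: "fourier_coeff (\<lambda>z. f z - g z) n = fourier_coeff f n - fourier_coeff g n" for n
    using L by (simp add: fourier_coeff_ip L2_diff ip_diff_left powi_L2)
  have H: "(\<lambda>z. f z - g z) \<in> H2" using assms c L by (auto simp: H2_def L2_diff)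
  have "(nrm circ (\<lambda>z. f z - g z))\<^sup>2 \<le> 0"
  proof (rule field_le_epsilon)
    fix e :: real assume "e > 0"
    from H2_Parseval[OF H this] show "(nrm circ (\<lambda>z. f z - g z))\<^sup>2 \<le> 0 + e"
      by (auto simp: c assms(3))
  qed
  then have "nrm circ (\<lambda>z. f z - g z) = 0" by simp
  then show ?thesis using nrm_eq_0_iff[OF L2_diff[OF L]] by simp
qed

section \<open>Bounded operators and spectral integrals\<close>

lemma bounded_opD:
  assumes "bounded_op M V A"
  shows "f \<in> V \<Longrightarrow> A f \<in> V"
    "f \<in> V \<Longrightarrow> g \<in> V \<Longrightarrow> AE x in M. A (\<lambda>x. f x + g x) x = A f x + A g x"
    "f \<in> V \<Longrightarrow> AE x in M. A (\<lambda>x. c * f x) x = c * A f x"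
  using assms by (auto simp: bounded_op_def)

lemma bounded_op_bound:
  assumes "bounded_op M V A"
  obtains C where "C > 0" "\<And>f. f \<in> V \<Longrightarrow> nrm M (A f) \<le> C * nrm M f"
proof -
  obtain C where C: "\<forall>f\<in>V. nrm M (A f) \<le> C * nrm M f" using assms by (auto simp: bounded_op_def)
  have "nrm M (A f) \<le> (\<bar>C\<bar> + 1) * nrm M f" if "f \<in> V" for f
    using C[rule_format, OF that] mult_right_mono[of C "\<bar>C\<bar> + 1" "nrm M f"] by fastforce
  then show ?thesis using that[of "\<bar>C\<bar> + 1"] by fastforce
qed

lemma bounded_op_diff:
  assumes "lin_sub M V" "bounded_op M V A" "f \<in> V" "g \<in> V"
  shows "AE x in M. A (\<lambda>x. f x - g x) x = A f x - A g x"
proof -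
  have "AE x in M. A (\<lambda>x. f x + (-1) * g x) x = A f x + A (\<lambda>x. (-1) * g x) x"
    using bounded_opD(2)[OF assms(2,3)] lin_subD(4)[OF assms(1,4)] by blast
  moreover have "AE x in M. A (\<lambda>x. (-1) * g x) x = (-1) * A g x"
    by (rule bounded_opD(3)[OF assms(2,4)])
  ultimately show ?thesis by eventually_elim simp
qed

lemma nrm_bounded_op_diff:
  assumes "lin_sub M V" "bounded_op M V A" "f \<in> V" "g \<in> V"
  shows "nrm M (\<lambda>x. A f x - A g x) = nrm M (A (\<lambda>x. f x - g x))"
proof (rule nrm_cong_AE)
  show "AE x in M. A f x - A g x = A (\<lambda>x. f x - g x) x"
    using bounded_op_diff[OF assms] by eventually_elim simp
  have "(\<lambda>x. A f x - A g x) \<in> V" "A (\<lambda>x. f x - g x) \<in> V"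
    using assms lin_sub_diff[OF assms(1)] bounded_opD(1)[OF assms(2)] by auto
  then show "(\<lambda>x. A f x - A g x) \<in> borel_measurable M" "A (\<lambda>x. f x - g x) \<in> borel_measurable M"
    using lin_subD(1)[OF assms(1)] L2_measurable by blast+
qed

lemma bounded_op_cong:
  assumes V: "lin_sub M V" and A: "bounded_op M V A" and f: "f \<in> V" "g \<in> V"
    and "AE x in M. f x = g x"
  shows "AE x in M. A f x = A g x"
proof -
  obtain C where C: "C > 0" "\<And>f. f \<in> V \<Longrightarrow> nrm M (A f) \<le> C * nrm M f"
    using bounded_op_bound[OF A] by metis
  have d: "(\<lambda>x. f x - g x) \<in> V" "(\<lambda>x. A f x - A g x) \<in> V"
    using f lin_sub_diff[OF V] bounded_opD(1)[OF A] by auto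
  have "nrm M (\<lambda>x. f x - g x) = 0"
    using nrm_eq_0_iff[OF lin_subD(1)[OF V d(1)]] assms(5) by simp
  then have "nrm M (\<lambda>x. A f x - A g x) \<le> 0"
    unfolding nrm_bounded_op_diff[OF V A f] using C(2)[OF d(1)] by simp
  then have "nrm M (\<lambda>x. A f x - A g x) = 0" using nrm_nonneg by (simp add: order_antisym)
  then show ?thesis using nrm_eq_0_iff[OF lin_subD(1)[OF V d(2)]] by simp
qed

lemma selfadjoint_opD:
  assumes "selfadjoint_op M V A"
  shows "bounded_op M V A" "f \<in> V \<Longrightarrow> g \<in> V \<Longrightarrow> ip M (A f) g = ip M f (A g)"
  using assms by (auto simp: selfadjoint_op_def)

lemma is_modulusD:
  assumes "is_modulus M V T B"
  shows "selfadjoint_op M V B" "f \<in> V \<Longrightarrow> 0 \<le> Re (ip M (B f) f)"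
    "f \<in> V \<Longrightarrow> AE x in M. B (B f) x = T (T f) x"
  using assms by (auto simp: is_modulus_def is_pos_sqrt_def)

locale pvm =
  fixes M :: "'a measure" and V E
  assumes V: "lin_sub M V" and E: "is_pvm M V E"
begin

lemmas VD = lin_subD[OF V]

lemma E_sa: "X \<in> sets borel \<Longrightarrow> selfadjoint_op M V (E X)"
  using E by (auto simp: is_pvm_def)

lemmas E_bop = selfadjoint_opD(1)[OF E_sa]

lemma E_in: "X \<in> sets borel \<Longrightarrow> f \<in> V \<Longrightarrow> E X f \<in> V"
  using bounded_opD(1)[OF E_bop] .

lemma E_L2: "X \<in> sets borel \<Longrightarrow> f \<in> V \<Longrightarrow> E X f \<in> L2 M"
  using E_in VD(1) by blast

lemma E_ip: "X \<in> sets borel \<Longrightarrow> f \<in> V \<Longrightarrow> g \<in> V \<Longrightarrow> ip M (E X f) g = ip M f (E X g)"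
  using selfadjoint_opD(2)[OF E_sa] .

lemma E_idem: "X \<in> sets borel \<Longrightarrow> f \<in> V \<Longrightarrow> AE x in M. E X (E X f) x = E X f x"
  using E by (auto simp: is_pvm_def)

lemma E_ip_self:
  assumes "X \<in> sets borel" "f \<in> V"
  shows "ip M (E X f) f = of_real ((nrm M (E X f))\<^sup>2)"
proof -
  have "ip M (E X f) f = ip M (E X (E X f)) f"
    by (rule ip_cong_AE) (use assms E_idem[OF assms] in \<open>auto simp: E_L2 E_in VD(1)\<close>)
  also have "\<dots> = ip M (E X f) (E X f)" using assms by (simp add: E_ip E_in)
  finally show ?thesis by (simp add: ip_self)
qed

lemma E_nrm_sq:
  assumes "X \<in> sets borel" "f \<in> V"
  shows "(nrm M (E X f))\<^sup>2 = Re (ip M (E X f) f)"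
  unfolding E_ip_self[OF assms] by simp

lemma E_nrm_le:
  assumes "X \<in> sets borel" "f \<in> V"
  shows "nrm M (E X f) \<le> nrm M f"
proof -
  have "(nrm M (E X f))\<^sup>2 = cmod (ip M (E X f) f)" by (simp only: E_ip_self[OF assms] norm_of_real) simp
  also have "\<dots> \<le> nrm M (E X f) * nrm M f"
    using assms by (intro ip_Cauchy_Schwarz) (auto simp: E_L2 VD(1))
  finally show ?thesis
    using nrm_nonneg[of M "E X f"] by (cases "nrm M (E X f) = 0") (auto simp: power2_eq_square mult_le_cancel_left)
qed

lemma E_sums:
  "range X \<subseteq> sets borel \<Longrightarrow> disjoint_family X \<Longrightarrow> f \<in> V \<Longrightarrow>
    (\<lambda>n. nrm M (\<lambda>x. (\<Sum>i<n. E (X i) f x) - E (\<Union>i. X i) f x)) \<longlonglongrightarrow> 0"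
  using E by (auto simp: is_pvm_def)

text \<open>Not postulated by \<open>is_pvm\<close>. Additivity for the constant sequence of empty
  sets makes \<open>(n - 1) E {} f\<close> tend to 0, which forces
  \<open>E {} f = 0\<close>.\<close>

lemma E_empty:
  assumes f: "f \<in> V"
  shows "AE x in M. E {} f x = 0"
proof -
  have "(\<lambda>n. nrm M (\<lambda>x. (\<Sum>i<n. E {} f x) - E {} f x)) \<longlonglongrightarrow> 0"
    using E_sums[of "\<lambda>_. {}" f] f by (auto simp: disjoint_family_on_def)
  also have "(\<lambda>n. nrm M (\<lambda>x. (\<Sum>i<n. E {} f x) - E {} f x)) = (\<lambda>n. \<bar>real n - 1\<bar> * nrm M (E {} f))"
  proof
    fix n :: nat
    have "nrm M (\<lambda>x. (\<Sum>i<n. E {} f x) - E {} f x) = nrm M (\<lambda>x. of_real (real n - 1) * E {} f x)"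
      by (simp add: algebra_simps)
    then show "nrm M (\<lambda>x. (\<Sum>i<n. E {} f x) - E {} f x) = \<bar>real n - 1\<bar> * nrm M (E {} f)"
      by (simp only: nrm_scale norm_of_real)
  qed
  finally have lim: "(\<lambda>n. \<bar>real n - 1\<bar> * nrm M (E {} f)) \<longlonglongrightarrow> 0" .
  have "nrm M (E {} f) \<le> 0"
  proof (rule LIMSEQ_le_const[OF lim], intro exI[of _ 2] allI impI)
    fix n :: nat assume "n \<ge> 2"
    then show "nrm M (E {} f) \<le> \<bar>real n - 1\<bar> * nrm M (E {} f)"
      using mult_right_mono[of 1 "\<bar>real n - 1\<bar>" "nrm M (E {} f)"] by simp
  qed
  then have "nrm M (E {} f) = 0" by (simp add: order_antisym)
  then show ?thesis using nrm_eq_0_iff[OF E_L2[of "{}", OF _ f]] by simp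
qed

lemma E_Un:
  assumes [measurable]: "X \<in> sets borel" "Y \<in> sets borel" and d: "X \<inter> Y = {}" and f: "f \<in> V"
  shows "AE x in M. E (X \<union> Y) f x = E X f x + E Y f x"
proof -
  let ?Z = "binaryset X Y"
  have r: "range ?Z \<subseteq> sets borel" by (auto simp: binaryset_def)
  have "disjoint_family ?Z" using d by (auto simp: disjoint_family_on_def binaryset_def)
  from E_sums[OF r this f]
  have lim: "(\<lambda>n. nrm M (\<lambda>x. (\<Sum>i<n. E (?Z i) f x) - E (X \<union> Y) f x)) \<longlonglongrightarrow> 0"
    by (simp add: UN_binaryset_eq)
  \<comment> \<open>After two terms only empty sets are added, so the null sequence is constant from
    there on and its value must be 0.\<close>
  have eq: "nrm M (\<lambda>x. (\<Sum>i<Suc (Suc n). E (?Z i) f x) - E (X \<union> Y) f x) =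
     nrm M (\<lambda>x. (E X f x + E Y f x) - E (X \<union> Y) f x)" for n
  proof (rule nrm_cong_AE)
    show "AE x in M. (\<Sum>i<Suc (Suc n). E (?Z i) f x) - E (X \<union> Y) f x = (E X f x + E Y f x) - E (X \<union> Y) f x"
      using E_empty[OF f]
    proof eventually_elim
      case (elim x)
      have "(\<Sum>i<Suc (Suc n). E (?Z i) f x) = E X f x + (E Y f x + (\<Sum>i<n. E {} f x))"
        by (simp only: sum.lessThan_Suc_shift) (simp add: binaryset_def)
      then show ?case using elim by simp
    qed
    have [measurable]: "E (?Z i) f \<in> borel_measurable M" for i
      using r f by (intro L2_measurable[OF E_L2]) auto
    have [measurable]: "E X f \<in> borel_measurable M" "E Y f \<in> borel_measurable M" "E (X \<union> Y) f \<in> borel_measurable M"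
      using f by (auto intro!: L2_measurable[OF E_L2])
    show "(\<lambda>x. (\<Sum>i<Suc (Suc n). E (?Z i) f x) - E (X \<union> Y) f x) \<in> borel_measurable M"
      "(\<lambda>x. (E X f x + E Y f x) - E (X \<union> Y) f x) \<in> borel_measurable M" by measurable
  qed
  have "(\<lambda>n. nrm M (\<lambda>x. (\<Sum>i<Suc (Suc n). E (?Z i) f x) - E (X \<union> Y) f x)) \<longlonglongrightarrow> 0"
    using LIMSEQ_ignore_initial_segment[OF lim, of 2] by simp
  then have "nrm M (\<lambda>x. (E X f x + E Y f x) - E (X \<union> Y) f x) = 0"
    unfolding eq by (simp add: LIMSEQ_const_iff)
  then show ?thesis
    using f by (subst (asm) nrm_eq_0_iff) (auto intro!: L2_diff L2_add E_L2 elim!: eventually_mono)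
qed

text \<open>On \<open>g = E Y f\<close> finite additivity gives
  \<open>|E (X \<union> Y) g|^2 = |E X g|^2 + |g|^2\<close>, while a projection does not increase
  the norm; nothing is left for \<open>E X g\<close>.\<close>

lemma E_disjoint:
  assumes [measurable]: "X \<in> sets borel" "Y \<in> sets borel" and d: "X \<inter> Y = {}" and f: "f \<in> V"
  shows "AE x in M. E X (E Y f) x = 0"
proof -
  let ?g = "E Y f"
  have g: "?g \<in> V" using f by (simp add: E_in)
  have L: "E X ?g \<in> L2 M" "E Y ?g \<in> L2 M" "E (X \<union> Y) ?g \<in> L2 M" "?g \<in> L2 M"
    using g by (auto intro: E_L2 VD(1))
  have "(nrm M (E (X \<union> Y) ?g))\<^sup>2 \<le> (nrm M ?g)\<^sup>2"
    using g by (intro power_mono E_nrm_le) auto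
  moreover have "(nrm M (E (X \<union> Y) ?g))\<^sup>2 = (nrm M (E X ?g))\<^sup>2 + (nrm M ?g)\<^sup>2"
  proof -
    have "(nrm M (E (X \<union> Y) ?g))\<^sup>2 = Re (ip M (E (X \<union> Y) ?g) ?g)"
      using g by (intro E_nrm_sq) auto
    also have "ip M (E (X \<union> Y) ?g) ?g = ip M (\<lambda>x. E X ?g x + E Y ?g x) ?g"
      using E_Un[OF assms(1-3) g] L by (intro ip_cong_AE L2_add) auto
    also have "Re \<dots> = (nrm M (E X ?g))\<^sup>2 + (nrm M (E Y ?g))\<^sup>2"
      using g L by (simp add: ip_add_left E_nrm_sq)
    also have "nrm M (E Y ?g) = nrm M ?g"
      using E_idem[of Y f] f L by (intro nrm_cong_AE) (auto intro: L2_measurable)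
    finally show ?thesis .
  qed
  ultimately have "nrm M (E X ?g) = 0" by simp
  then show ?thesis using g by (subst (asm) nrm_eq_0_iff) (auto simp: E_L2)
qed

text \<open>Multiplicativity follows from additivity by splitting both \<open>X\<close> and
  \<open>Y\<close> along their intersection; the cross parts vanish by
  \<open>E_disjoint\<close>.\<close>

lemma E_Int:
  assumes [measurable]: "X \<in> sets borel" "Y \<in> sets borel" and f: "f \<in> V"
  shows "AE x in M. E X (E Y f) x = E (X \<inter> Y) f x"
proof -
  let ?a = "E (X \<inter> Y) f" and ?b = "E (Y - X) f"
  have ab: "?a \<in> V" "?b \<in> V" using f by (auto simp: E_in)
  have "AE x in M. E ((X \<inter> Y) \<union> (Y - X)) f x = ?a x + ?b x"
    using f by (intro E_Un) auto
  moreover have "(X \<inter> Y) \<union> (Y - X) = Y" by auto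
  ultimately have "AE x in M. E Y f x = ?a x + ?b x" by simp
  then have "AE x in M. E X (E Y f) x = E X (\<lambda>x. ?a x + ?b x) x"
    using f ab by (intro bounded_op_cong[OF V E_bop]) (auto intro: E_in VD(3))
  moreover have "AE x in M. E X (\<lambda>x. ?a x + ?b x) x = E X ?a x + E X ?b x"
    using ab by (intro bounded_opD(2)[OF E_bop]) auto
  moreover have "AE x in M. E X ?b x = 0" using f by (intro E_disjoint) auto
  moreover have "AE x in M. E ((X \<inter> Y) \<union> (X - Y)) ?a x = E (X \<inter> Y) ?a x + E (X - Y) ?a x"
    using ab by (intro E_Un) auto
  moreover have "AE x in M. E (X - Y) ?a x = 0" using f by (intro E_disjoint) auto
  moreover have "AE x in M. E (X \<inter> Y) ?a x = ?a x" using f by (intro E_idem) auto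
  moreover have "(X \<inter> Y) \<union> (X - Y) = X" by auto
  ultimately have *: "AE x in M. E X (E Y f) x = E X (\<lambda>x. ?a x + ?b x) x"
    "AE x in M. E X (\<lambda>x. ?a x + ?b x) x = E X ?a x + E X ?b x" "AE x in M. E X ?b x = 0"
    "AE x in M. E X ?a x = E (X \<inter> Y) ?a x + E (X - Y) ?a x" "AE x in M. E (X - Y) ?a x = 0"
    "AE x in M. E (X \<inter> Y) ?a x = ?a x" by simp_all
  show ?thesis using * by eventually_elim simp
qed

lemma E_ip_Int:
  assumes [measurable]: "X \<in> sets borel" "Y \<in> sets borel" and f: "f \<in> V" "g \<in> V"
  shows "ip M (E X f) (E Y g) = ip M (E (X \<inter> Y) f) g"
proof -
  have "ip M (E X f) (E Y g) = ip M (E Y (E X f)) g" using f by (simp add: E_ip E_in)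
  also have "\<dots> = ip M (E (X \<inter> Y) f) g"
    using E_Int[of Y X f] f by (intro ip_cong_AE) (auto simp: Int_commute E_L2 E_in VD(1))
  finally show ?thesis .
qed

section \<open>Scalar spectral measures\<close>

abbreviation \<mu> where "\<mu> v \<equiv> pvm_measure M E v"

lemma sets_mu [simp, measurable_cong]: "sets (\<mu> v) = sets borel"
  unfolding pvm_measure_def by (subst sets_measure_of) (auto simp: sets.sigma_sets_eq[of borel, simplified])

lemma space_mu [simp]: "space (\<mu> v) = UNIV"
  unfolding pvm_measure_def by (subst space_measure_of) auto

text \<open>\<open>measure_of\<close> takes the intended values only once the set function is known
  to be countably additive. That follows from strong additivity of \<open>E\<close> by pairing with
  \<open>v\<close>.\<close>

lemma emeasure_mu:
  assumes v: "v \<in> V" and X: "X \<in> sets borel"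
  shows "emeasure (\<mu> v) X = ennreal ((nrm M (E X v))\<^sup>2)"
proof -
  have "emeasure (\<mu> v) X = ennreal (Re (ip M (E X v) v))"
  proof (rule emeasure_measure_of[OF pvm_measure_def])
    have pos: "0 \<le> Re (ip M (E Y v) v)" if "Y \<in> sets borel" for Y
      using E_ip_self[OF that v] by simp
    show "countably_additive (sets (\<mu> v)) (\<lambda>X. ennreal (Re (ip M (E X v) v)))"
    proof (rule countably_additiveI)
      fix Y :: "nat \<Rightarrow> real set"
      assume Y: "range Y \<subseteq> sets (\<mu> v)" "disjoint_family Y" "(\<Union>i. Y i) \<in> sets (\<mu> v)"
      have "(\<lambda>n. ip M (\<lambda>x. \<Sum>i<n. E (Y i) v x) v) \<longlonglongrightarrow> ip M (E (\<Union>i. Y i) v) v"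
        using Y v by (intro ip_tendsto E_sums L2_sum E_L2) (auto intro: VD(1))
      moreover have "ip M (\<lambda>x. \<Sum>i<n. E (Y i) v x) v = (\<Sum>i<n. ip M (E (Y i) v) v)" for n
        using Y v by (intro ip_sum_left) (auto intro: E_L2 VD(1))
      ultimately have "(\<lambda>i. ip M (E (Y i) v) v) sums ip M (E (\<Union>i. Y i) v) v"
        unfolding sums_def by simp
      then have "(\<lambda>i. Re (ip M (E (Y i) v) v)) sums Re (ip M (E (\<Union>i. Y i) v) v)"
        by (rule sums_Re)
      then show "(\<Sum>i. ennreal (Re (ip M (E (Y i) v) v))) = ennreal (Re (ip M (E (\<Union>i. Y i) v) v))"
        using Y by (subst suminf_ennreal2) (auto simp: sums_iff intro!: pos)
    qed
    have "nrm M (E {} v) = 0" using E_empty[OF v] E_L2[of "{}", OF _ v] by (simp add: nrm_eq_0_iff)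
    then show "positive (sets (\<mu> v)) (\<lambda>X. ennreal (Re (ip M (E X v) v)))"
      using E_ip_self[of "{}", OF _ v] by (simp add: positive_def)
  qed (use X in auto)
  then show ?thesis using E_ip_self[OF X v] by simp
qed

end

lemma simple_function_sum_indicator:
  fixes s :: "real \<Rightarrow> complex"
  assumes "simple_function borel s"
  shows "s t = (\<Sum>c\<in>range s. c * indicator (s -` {c}) t)"
proof -
  have "(\<Sum>c\<in>range s. c * indicator (s -` {c}) t) = (\<Sum>c\<in>range s. if c = s t then c else 0)"
    by (intro sum.cong) (auto simp: indicator_def)
  also have "\<dots> = s t" using assms by (subst sum.delta) (auto simp: simple_function_def)
  finally show ?thesis by simp
qed

context pvm
begin

lemma finite_mu: "v \<in> V \<Longrightarrow> finite_measure (\<mu> v)"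
  by (intro finite_measureI) (simp add: emeasure_mu)

lemma measure_mu: "v \<in> V \<Longrightarrow> X \<in> sets borel \<Longrightarrow> measure (\<mu> v) X = (nrm M (E X v))\<^sup>2"
  by (simp add: measure_def emeasure_mu)

lemma indicator_L2: "v \<in> V \<Longrightarrow> X \<in> sets borel \<Longrightarrow> (\<lambda>t. indicator X t) \<in> L2 (\<mu> v)"
  by (rule L2_bounded[OF finite_mu, of _ _ 1]) (auto simp: indicator_def)

lemma ip_indicator:
  assumes "v \<in> V" "X \<in> sets borel" "Y \<in> sets borel"
  shows "ip (\<mu> v) (\<lambda>t. indicator X t) (\<lambda>t. indicator Y t) = of_real (measure (\<mu> v) (X \<inter> Y))"
proof -
  have "ip (\<mu> v) (\<lambda>t. indicator X t) (\<lambda>t. indicator Y t) = (LINT t|\<mu> v. indicator (X \<inter> Y) t)"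
    unfolding ip_def by (intro Bochner_Integration.integral_cong) (auto simp: indicator_def)
  also have "\<dots> = (LINT t|\<mu> v. complex_of_real (indicator (X \<inter> Y) t))"
    by (intro Bochner_Integration.integral_cong) (auto simp: indicator_def)
  also have "\<dots> = of_real (measure (\<mu> v) (X \<inter> Y))"
    by (subst integral_complex_of_real) simp
  finally show ?thesis .
qed

lemma ip_E_E:
  assumes "v \<in> V" "X \<in> sets borel" "Y \<in> sets borel"
  shows "ip M (E X v) (E Y v) = ip (\<mu> v) (\<lambda>t. indicator X t) (\<lambda>t. indicator Y t)"
  using assms by (simp only: ip_indicator E_ip_Int E_ip_self measure_mu sets.Int)

lemma simple_sets: "simple_function borel s \<Longrightarrow> s -` {c} \<in> sets borel"
  using simple_functionD(2)[of borel s "{c}"] by simp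

lemma simple_L2:
  assumes v: "v \<in> V" and s: "simple_function borel (s :: real \<Rightarrow> complex)"
  shows "s \<in> L2 (\<mu> v)"
proof (rule L2_bounded[OF finite_mu[OF v]])
  have "finite (range s)" using s by (simp add: simple_function_def)
  then show "AE t in \<mu> v. cmod (s t) \<le> Max (cmod ` range s)"
    by (intro AE_I2 Max_ge) auto
  show "s \<in> borel_measurable (\<mu> v)" using borel_measurable_simple_function[OF s] by simp
qed

lemma simple_in:
  assumes v: "v \<in> V" and s: "simple_function borel s"
  shows "pvm_simple_integral E s v \<in> V"
  unfolding pvm_simple_integral_def
  by (intro lin_sub_sum[OF V] VD(4) E_in v simple_sets[OF s])

lemma ip_simple_right:
  assumes v: "v \<in> V" and y: "y \<in> V" and f: "f \<in> L2 (\<mu> v)" and s: "simple_function borel s"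
    and char: "\<And>X. X \<in> sets borel \<Longrightarrow> ip M y (E X v) = ip (\<mu> v) f (\<lambda>t. indicator X t)"
  shows "ip M y (pvm_simple_integral E s v) = ip (\<mu> v) f s"
proof -
  have "ip M y (pvm_simple_integral E s v) = (\<Sum>c\<in>range s. cnj c * ip M y (E (s -` {c}) v))"
    unfolding pvm_simple_integral_def using v y simple_sets[OF s]
    by (subst ip_sum_right) (auto simp: ip_scale_right L2_scale E_L2 VD(1))
  also have "\<dots> = (\<Sum>c\<in>range s. cnj c * ip (\<mu> v) f (\<lambda>t. indicator (s -` {c}) t))"
    using char simple_sets[OF s] by simp
  also have "\<dots> = ip (\<mu> v) f (\<lambda>t. \<Sum>c\<in>range s. c * indicator (s -` {c}) t)"
    using v f simple_sets[OF s]
    by (subst ip_sum_right) (auto simp: ip_scale_right intro!: L2_scale indicator_L2)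
  also have "(\<lambda>t. \<Sum>c\<in>range s. c * indicator (s -` {c}) t) = s"
    by (rule ext) (rule simple_function_sum_indicator[OF s, symmetric])
  finally show ?thesis .
qed

lemma simple_char:
  assumes v: "v \<in> V" and s: "simple_function borel s" and X: "X \<in> sets borel"
  shows "ip M (pvm_simple_integral E s v) (E X v) = ip (\<mu> v) s (\<lambda>t. indicator X t)"
proof -
  have "ip M (E X v) (pvm_simple_integral E s v) = ip (\<mu> v) (\<lambda>t. indicator X t) s"
    by (rule ip_simple_right[OF v _ _ s]) (use v X in \<open>auto intro: E_in indicator_L2 ip_E_E\<close>)
  from arg_cong[OF this, of cnj] show ?thesis by (simp add: cnj_ip)
qed

lemma nrm_simple:
  assumes v: "v \<in> V" and s: "simple_function borel s"
  shows "nrm M (pvm_simple_integral E s v) = nrm (\<mu> v) s"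
proof -
  have "ip M (pvm_simple_integral E s v) (pvm_simple_integral E s v) = ip (\<mu> v) s s"
    using v s by (intro ip_simple_right) (auto intro: simple_in simple_L2 simple_char)
  then have "(nrm M (pvm_simple_integral E s v))\<^sup>2 = (nrm (\<mu> v) s)\<^sup>2"
    by (simp only: nrm_sq_ip)
  then show ?thesis by (simp add: power2_eq_iff_nonneg)
qed

section \<open>The functional calculus as a relation\<close>

abbreviation rel where "rel \<equiv> has_pvm_integral M V E"

lemma simple_function_mu: "simple_function (\<mu> v) s \<longleftrightarrow> simple_function borel s"
  by (simp add: simple_function_def)

text \<open>This removes the approximating sequence from \<open>has_pvm_integral\<close>. The
  pairings with all \<open>E X v\<close> determine the component of \<open>y\<close> in the cyclic
  subspace of \<open>v\<close>, and equality of norms excludes a component orthogonal to it. The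
  rules of the calculus are then checks of these two conditions.\<close>

lemma rel_iff:
  "rel f v y \<longleftrightarrow> v \<in> V \<and> y \<in> V \<and> f \<in> L2 (\<mu> v) \<and>
     (\<forall>X\<in>sets borel. ip M y (E X v) = ip (\<mu> v) f (\<lambda>t. indicator X t)) \<and> nrm M y = nrm (\<mu> v) f"
  (is "_ \<longleftrightarrow> ?R")
proof
  assume "rel f v y"
  then obtain s where *: "v \<in> V" "y \<in> V" "f \<in> L2 (\<mu> v)" "\<And>n. simple_function borel (s n)"
    and lim: "(\<lambda>n. nrm (\<mu> v) (\<lambda>t. s n t - f t)) \<longlonglongrightarrow> 0"
      "(\<lambda>n. nrm M (\<lambda>x. pvm_simple_integral E (s n) v x - y x)) \<longlonglongrightarrow> 0"
    unfolding has_pvm_integral_def by blast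
  have sL: "s n \<in> L2 (\<mu> v)" "pvm_simple_integral E (s n) v \<in> L2 M" "y \<in> L2 M" for n
    using * by (auto intro: simple_L2 simple_in VD(1))
  have "ip M y (E X v) = ip (\<mu> v) f (\<lambda>t. indicator X t)" if X: "X \<in> sets borel" for X
  proof (rule LIMSEQ_unique)
    show "(\<lambda>n. ip M (pvm_simple_integral E (s n) v) (E X v)) \<longlonglongrightarrow> ip M y (E X v)"
      by (intro ip_tendsto lim sL E_L2 X *)
    have "(\<lambda>n. ip (\<mu> v) (s n) (\<lambda>t. indicator X t)) \<longlonglongrightarrow> ip (\<mu> v) f (\<lambda>t. indicator X t)"
      by (intro ip_tendsto lim sL indicator_L2 X *)
    then show "(\<lambda>n. ip M (pvm_simple_integral E (s n) v) (E X v)) \<longlonglongrightarrow> ip (\<mu> v) f (\<lambda>t. indicator X t)"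
      using * X by (simp add: simple_char)
  qed
  moreover have "nrm M y = nrm (\<mu> v) f"
  proof (rule LIMSEQ_unique)
    show "(\<lambda>n. nrm M (pvm_simple_integral E (s n) v)) \<longlonglongrightarrow> nrm M y"
      by (intro nrm_tendsto lim sL)
    have "(\<lambda>n. nrm (\<mu> v) (s n)) \<longlonglongrightarrow> nrm (\<mu> v) f"
      by (intro nrm_tendsto lim sL *)
    then show "(\<lambda>n. nrm M (pvm_simple_integral E (s n) v)) \<longlonglongrightarrow> nrm (\<mu> v) f"
      using * by (simp add: nrm_simple)
  qed
  ultimately show ?R using * by blast
next
  assume ?R
  then have *: "v \<in> V" "y \<in> V" "f \<in> L2 (\<mu> v)" "nrm M y = nrm (\<mu> v) f"
     "\<And>X. X\<in>sets borel \<Longrightarrow> ip M y (E X v) = ip (\<mu> v) f (\<lambda>t. indicator X t)" by auto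
  obtain s where s: "\<And>n. simple_function borel (s n)" "\<And>n. s n \<in> L2 (\<mu> v)"
    and lim: "(\<lambda>n. nrm (\<mu> v) (\<lambda>t. s n t - f t)) \<longlonglongrightarrow> 0"
    using L2_simple_approx[OF *(3)] by (auto simp: simple_function_mu)
  have "nrm M (\<lambda>x. pvm_simple_integral E (s n) v x - y x) = nrm (\<mu> v) (\<lambda>t. s n t - f t)" for n
  proof -
    have "(nrm M (\<lambda>x. y x - pvm_simple_integral E (s n) v x))\<^sup>2 = (nrm (\<mu> v) (\<lambda>t. f t - s n t))\<^sup>2"
      using * s by (simp add: nrm_diff_sq VD(1) simple_in nrm_simple ip_simple_right)
    then show ?thesis
      by (simp add: power2_eq_iff_nonneg nrm_minus_commute[of M y] nrm_minus_commute[of "\<mu> v" f])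
  qed
  then show "rel f v y" unfolding has_pvm_integral_def using * s lim by (auto intro!: exI[of _ s])
qed

lemma relD:
  assumes "rel f v y"
  shows "v \<in> V" "y \<in> V" "f \<in> L2 (\<mu> v)" "nrm M y = nrm (\<mu> v) f" "y \<in> L2 M" "f \<in> borel_measurable borel"
    "X \<in> sets borel \<Longrightarrow> ip M y (E X v) = ip (\<mu> v) f (\<lambda>t. indicator X t)"
  using assms L2_measurable[of f "\<mu> v"] unfolding rel_iff by (auto intro: VD(1))

lemma rel_approx:
  assumes "rel f v y"
  obtains s where "\<And>n. simple_function borel (s n)" "(\<lambda>n. nrm (\<mu> v) (\<lambda>t. s n t - f t)) \<longlonglongrightarrow> 0"
      "(\<lambda>n. nrm M (\<lambda>x. pvm_simple_integral E (s n) v x - y x)) \<longlonglongrightarrow> 0"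
  using assms unfolding has_pvm_integral_def by blast

text \<open>The pairings with the vectors \<open>E X v\<close> extend to limits of their
  combinations. Nothing is assumed about the norm of \<open>z\<close>, so this applies before
  \<open>z\<close> is recognised as an integral itself.\<close>

lemma ip_char:
  assumes r: "rel f v y" and z: "z \<in> V" and g: "g \<in> L2 (\<mu> v)"
    and char: "\<And>X. X \<in> sets borel \<Longrightarrow> ip M z (E X v) = ip (\<mu> v) g (\<lambda>t. indicator X t)"
  shows "ip M z y = ip (\<mu> v) g f"
proof -
  note R = relD[OF r]
  obtain s where s: "\<And>n. simple_function borel (s n)" and lim: "(\<lambda>n. nrm (\<mu> v) (\<lambda>t. s n t - f t)) \<longlonglongrightarrow> 0"
      "(\<lambda>n. nrm M (\<lambda>x. pvm_simple_integral E (s n) v x - y x)) \<longlonglongrightarrow> 0"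
    using rel_approx[OF r] by blast
  have sL: "s n \<in> L2 (\<mu> v)" "pvm_simple_integral E (s n) v \<in> L2 M" for n
    using R s by (auto intro: simple_L2 simple_in VD(1))
  have eq: "ip M (pvm_simple_integral E (s n) v) z = ip (\<mu> v) (s n) g" for n
    using arg_cong[OF ip_simple_right[OF R(1) z g s char], of cnj] by (simp add: cnj_ip)
  have "ip M y z = ip (\<mu> v) f g"
  proof (rule LIMSEQ_unique)
    show "(\<lambda>n. ip M (pvm_simple_integral E (s n) v) z) \<longlonglongrightarrow> ip M y z"
      by (intro ip_tendsto lim sL R VD(1)[OF z])
    show "(\<lambda>n. ip M (pvm_simple_integral E (s n) v) z) \<longlonglongrightarrow> ip (\<mu> v) f g"
      unfolding eq by (intro ip_tendsto lim sL R g)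
  qed
  from arg_cong[OF this, of cnj] show ?thesis by (simp add: cnj_ip)
qed

lemma rel_ip: "rel f v y \<Longrightarrow> rel g v z \<Longrightarrow> ip M y z = ip (\<mu> v) f g"
  by (rule ip_char) (auto dest: relD)

lemma rel_nrm_diff:
  assumes "rel f v y" "rel g v z"
  shows "nrm M (\<lambda>x. y x - z x) = nrm (\<mu> v) (\<lambda>t. f t - g t)"
proof -
  have "(nrm M (\<lambda>x. y x - z x))\<^sup>2 = (nrm (\<mu> v) (\<lambda>t. f t - g t))\<^sup>2"
    using relD[OF assms(1)] relD[OF assms(2)] rel_ip[OF assms] by (simp add: nrm_diff_sq)
  then show ?thesis by (simp add: power2_eq_iff_nonneg)
qed

lemma rel_unique:
  assumes "rel f v y" "rel f v z"
  shows "AE x in M. y x = z x"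
proof -
  have "nrm M (\<lambda>x. y x - z x) = 0" using rel_nrm_diff[OF assms] by simp
  then show ?thesis using relD[OF assms(1)] relD[OF assms(2)] by (simp add: nrm_eq_0_iff L2_diff)
qed

lemma rel_cong:
  assumes r: "rel f v y" and "AE t in \<mu> v. f t = g t" "g \<in> borel_measurable borel"
    "AE x in M. y x = z x" "z \<in> V"
  shows "rel g v z"
proof -
  note R = relD[OF r]
  have g: "g \<in> L2 (\<mu> v)"
    by (rule L2_dominated[OF _ L2_integrable_sq[OF R(3)]]) (use assms in auto)
  have zL: "z \<in> L2 M" using assms(5) VD(1) by blast
  have "nrm M z = nrm M y"
    by (rule nrm_cong_AE[symmetric]) (use assms R zL in \<open>auto intro: L2_measurable\<close>)
  moreover have "nrm (\<mu> v) g = nrm (\<mu> v) f"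
    by (rule nrm_cong_AE[symmetric]) (use assms R in auto)
  moreover have "ip M z (E X v) = ip M y (E X v)" if "X \<in> sets borel" for X
    using assms R that VD(1) by (intro ip_cong_AE) (auto intro: E_L2)
  moreover have "ip (\<mu> v) g (\<lambda>t. indicator X t) = ip (\<mu> v) f (\<lambda>t. indicator X t)" if "X \<in> sets borel" for X
    using assms R that g by (intro ip_cong_AE) (auto intro: indicator_L2)
  ultimately show ?thesis unfolding rel_iff using R g assms by auto
qed

lemma rel_add:
  assumes "rel f v y" "rel g v z"
  shows "rel (\<lambda>t. f t + g t) v (\<lambda>x. y x + z x)"
proof -
  note R = relD[OF assms(1)] and S = relD[OF assms(2)]
  have "(nrm M (\<lambda>x. y x + z x))\<^sup>2 = (nrm (\<mu> v) (\<lambda>t. f t + g t))\<^sup>2"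
    using R S rel_ip[OF assms] by (simp add: nrm_add_sq)
  then have "nrm M (\<lambda>x. y x + z x) = nrm (\<mu> v) (\<lambda>t. f t + g t)" by (simp add: power2_eq_iff_nonneg)
  then show ?thesis
    unfolding rel_iff using R S by (auto simp: ip_add_left E_L2 indicator_L2 L2_add VD(3))
qed

lemma rel_scale:
  assumes "rel f v y"
  shows "rel (\<lambda>t. c * f t) v (\<lambda>x. c * y x)"
  using relD[OF assms] unfolding rel_iff by (auto simp: ip_scale_left L2_scale VD(4) nrm_scale)

lemma rel_diff:
  assumes "rel f v y" "rel g v z"
  shows "rel (\<lambda>t. f t - g t) v (\<lambda>x. y x - z x)"
  using rel_add[OF assms(1) rel_scale[OF assms(2), of "-1"]] by simp

lemma rel_sum:
  assumes "finite I" "I \<noteq> {}" "\<And>i. i \<in> I \<Longrightarrow> rel (f i) v (y i)"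
  shows "rel (\<lambda>t. \<Sum>i\<in>I. f i t) v (\<lambda>x. \<Sum>i\<in>I. y i x)"
  using assms by (induction I rule: finite_ne_induct) (auto intro: rel_add)

lemma rel_E:
  assumes r: "rel f v y" and X: "X \<in> sets borel"
  shows "rel (\<lambda>t. indicator X t * f t) v (E X y)"
proof -
  note R = relD[OF r]
  have f': "(\<lambda>t. indicator X t * f t) \<in> L2 (\<mu> v)"
    by (rule L2_bounded_mult[OF R(3), of _ 1]) (use X in \<open>auto simp: indicator_def\<close>)
  have char: "ip M (E X y) (E Y v) = ip (\<mu> v) (\<lambda>t. indicator X t * f t) (\<lambda>t. indicator Y t)"
    if Y: "Y \<in> sets borel" for Y
  proof -
    have "ip M (E X y) (E Y v) = ip M y (E X (E Y v))"
      using R X Y by (intro E_ip) (auto intro: E_in)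
    also have "\<dots> = ip M y (E (X \<inter> Y) v)"
      using R X Y E_Int[OF X Y R(1)] by (intro ip_cong_AE) (auto intro: E_L2 E_in)
    also have "\<dots> = ip (\<mu> v) f (\<lambda>t. indicator (X \<inter> Y) t)" using R(7) X Y by auto
    also have "\<dots> = ip (\<mu> v) (\<lambda>t. indicator X t * f t) (\<lambda>t. indicator Y t)"
      unfolding ip_def by (intro Bochner_Integration.integral_cong) (auto simp: indicator_def)
    finally show ?thesis .
  qed
  \<comment> \<open>The norm is reduced to a pairing with \<open>y\<close> and evaluated by
    \<open>ip_char\<close>; \<open>rel_ip\<close> would presuppose the relation being
    proved.\<close>
  have "(nrm M (E X y))\<^sup>2 = Re (ip M (E X y) y)" using R X by (intro E_nrm_sq) auto
  also have "ip M (E X y) y = ip (\<mu> v) (\<lambda>t. indicator X t * f t) f"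
    using R X by (intro ip_char[OF r _ f' char]) (auto intro: E_in)
  also have "\<dots> = ip (\<mu> v) (\<lambda>t. indicator X t * f t) (\<lambda>t. indicator X t * f t)"
    unfolding ip_def by (intro Bochner_Integration.integral_cong) (auto simp: indicator_def)
  finally have "(nrm M (E X y))\<^sup>2 = (nrm (\<mu> v) (\<lambda>t. indicator X t * f t))\<^sup>2"
    by (simp add: nrm_sq_ip)
  then have "nrm M (E X y) = nrm (\<mu> v) (\<lambda>t. indicator X t * f t)" by (simp add: power2_eq_iff_nonneg)
  then show ?thesis unfolding rel_iff using R X f' char by (auto intro: E_in)
qed

lemma rel_one:
  assumes v: "v \<in> V"
  shows "rel (\<lambda>_. 1) v v"
proof -
  have U: "AE x in M. E UNIV v x = v x" using E v by (auto simp: is_pvm_def)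
  have char: "ip M v (E X v) = ip (\<mu> v) (\<lambda>_. 1) (\<lambda>t. indicator X t)" if X: "X \<in> sets borel" for X
  proof -
    have "ip M v (E X v) = ip M (E UNIV v) (E X v)"
      using U v X by (intro ip_cong_AE) (auto intro: E_L2 VD(1))
    also have "\<dots> = ip (\<mu> v) (\<lambda>t. indicator UNIV t) (\<lambda>t. indicator X t)" using v X by (intro ip_E_E) auto
    finally show ?thesis by simp
  qed
  have "nrm M v = nrm M (E UNIV v)"
    by (rule nrm_cong_AE[symmetric])
      (use U L2_measurable[OF E_L2[OF _ v, of UNIV]] L2_measurable[OF VD(1)[OF v]] in auto)
  also have "(nrm M (E UNIV v))\<^sup>2 = Re (ip (\<mu> v) (\<lambda>t. indicator UNIV t) (\<lambda>t. indicator UNIV t))"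
    using ip_E_E[OF v, of UNIV UNIV] by (simp add: nrm_sq_ip)
  finally have "(nrm M v)\<^sup>2 = (nrm (\<mu> v) (\<lambda>_. 1))\<^sup>2" by (simp add: nrm_sq_ip)
  then have "nrm M v = nrm (\<mu> v) (\<lambda>_. 1)" by (simp add: power2_eq_iff_nonneg)
  then show ?thesis
    unfolding rel_iff using v char by (auto intro!: L2_bounded[OF finite_mu, of _ _ 1])
qed

lemma mu_rel:
  assumes r: "rel f v y"
  shows "\<mu> y = density (\<mu> v) (\<lambda>t. ennreal ((cmod (f t))\<^sup>2))"
proof (rule measure_eqI)
  note R = relD[OF r]
  have [measurable]: "f \<in> borel_measurable (\<mu> v)" using R by simp
  fix X assume "X \<in> sets (\<mu> y)"
  then have X[measurable]: "X \<in> sets borel" by simp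
  have L: "(\<lambda>t. indicator X t * f t) \<in> L2 (\<mu> v)" using relD(3)[OF rel_E[OF r X]] .
  have "emeasure (\<mu> y) X = ennreal ((nrm M (E X y))\<^sup>2)" using R X by (intro emeasure_mu)
  also have "nrm M (E X y) = nrm (\<mu> v) (\<lambda>t. indicator X t * f t)" using relD(4)[OF rel_E[OF r X]] .
  also have "ennreal (\<dots>\<^sup>2) = (\<integral>\<^sup>+ t. ennreal ((cmod (indicator X t * f t))\<^sup>2) \<partial>\<mu> v)"
    unfolding nrm_sq using L by (intro nn_integral_eq_integral[symmetric]) (auto simp: L2_integrable_sq)
  also have "\<dots> = (\<integral>\<^sup>+ t. ennreal ((cmod (f t))\<^sup>2) * indicator X t \<partial>\<mu> v)"
    by (intro nn_integral_cong) (auto simp: indicator_def)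
  also have "\<dots> = emeasure (density (\<mu> v) (\<lambda>t. ennreal ((cmod (f t))\<^sup>2))) X"
    by (subst emeasure_density) auto
  finally show "emeasure (\<mu> y) X = emeasure (density (\<mu> v) (\<lambda>t. ennreal ((cmod (f t))\<^sup>2))) X" .
qed simp

lemma nrm_mu_rel:
  assumes r: "rel f v y" and g: "g \<in> borel_measurable borel"
  shows "nrm (\<mu> y) g = nrm (\<mu> v) (\<lambda>t. g t * f t)" "g \<in> L2 (\<mu> y) \<longleftrightarrow> (\<lambda>t. g t * f t) \<in> L2 (\<mu> v)"
proof -
  have [measurable]: "f \<in> borel_measurable (\<mu> v)" "g \<in> borel_measurable (\<mu> v)"
    using relD[OF r] g by auto
  have eq: "(cmod (f t))\<^sup>2 *\<^sub>R (cmod (g t))\<^sup>2 = (cmod (g t * f t))\<^sup>2" for t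
    by (simp add: norm_mult power_mult_distrib)
  have "(LINT t|\<mu> y. (cmod (g t))\<^sup>2) = (LINT t|\<mu> v. (cmod (f t))\<^sup>2 *\<^sub>R (cmod (g t))\<^sup>2)"
    unfolding mu_rel[OF r] by (rule integral_density) auto
  then show "nrm (\<mu> y) g = nrm (\<mu> v) (\<lambda>t. g t * f t)"
    unfolding nrm_def eq by simp
  have "integrable (\<mu> y) (\<lambda>t. (cmod (g t))\<^sup>2) \<longleftrightarrow> integrable (\<mu> v) (\<lambda>t. (cmod (f t))\<^sup>2 *\<^sub>R (cmod (g t))\<^sup>2)"
    unfolding mu_rel[OF r] by (rule integrable_density) auto
  moreover have "g \<in> borel_measurable (\<mu> y)" using g by simp
  moreover have "(\<lambda>t. g t * f t) \<in> borel_measurable (\<mu> v)" by measurable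
  ultimately show "g \<in> L2 (\<mu> y) \<longleftrightarrow> (\<lambda>t. g t * f t) \<in> L2 (\<mu> v)"
    unfolding L2_def eq by simp
qed

text \<open>For a simple \<open>g\<close> this is \<open>rel_E\<close> and linearity. Since
  \<open>\<mu> y\<close> has density \<open>|f|^2\<close> with respect to \<open>\<mu> v\<close>,
  multiplication by \<open>f\<close> preserves norms from \<open>L2 (\<mu> y)\<close> to
  \<open>L2 (\<mu> v)\<close> and carries the approximation of \<open>g\<close> along.\<close>

lemma rel_comp:
  assumes r: "rel f v y" and q: "rel g y z"
  shows "rel (\<lambda>t. g t * f t) v z"
proof -
  note R = relD[OF r] and Q = relD[OF q]
  obtain s where s: "\<And>n. simple_function borel (s n)" and lim: "(\<lambda>n. nrm (\<mu> y) (\<lambda>t. s n t - g t)) \<longlonglongrightarrow> 0"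
      "(\<lambda>n. nrm M (\<lambda>x. pvm_simple_integral E (s n) y x - z x)) \<longlonglongrightarrow> 0"
    using rel_approx[OF q] by blast
  have sm[measurable]: "s n \<in> borel_measurable borel" for n using s by (rule borel_measurable_simple_function)
  have gf: "(\<lambda>t. g t * f t) \<in> L2 (\<mu> v)" by (rule iffD1[OF nrm_mu_rel(2)[OF r Q(6)] Q(3)])
  have sf: "(\<lambda>t. s n t * f t) \<in> L2 (\<mu> v)" for n
    by (rule iffD1[OF nrm_mu_rel(2)[OF r sm] simple_L2[OF R(2) s]])
  have lim': "(\<lambda>n. nrm (\<mu> v) (\<lambda>t. s n t * f t - g t * f t)) \<longlonglongrightarrow> 0"
  proof -
    have "nrm (\<mu> v) (\<lambda>t. s n t * f t - g t * f t) = nrm (\<mu> y) (\<lambda>t. s n t - g t)" for n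
      using nrm_mu_rel(1)[OF r, of "\<lambda>t. s n t - g t"] Q(6) by (simp add: left_diff_distrib)
    then show ?thesis using lim(1) by simp
  qed
  have char: "ip M z (E X v) = ip (\<mu> v) (\<lambda>t. g t * f t) (\<lambda>t. indicator X t)" if X[measurable]: "X \<in> sets borel" for X
  proof (rule LIMSEQ_unique)
    show "(\<lambda>n. ip M (pvm_simple_integral E (s n) y) (E X v)) \<longlonglongrightarrow> ip M z (E X v)"
      by (intro ip_tendsto lim E_L2 X R(1) Q(5) VD(1)[OF simple_in[OF R(2) s]])
    have "ip M (pvm_simple_integral E (s n) y) (E X v) = ip (\<mu> v) (\<lambda>t. s n t * f t) (\<lambda>t. indicator X t)" for n
    proof -
      have ss[measurable]: "s n -` {c} \<in> sets borel" for c by (rule simple_sets[OF s])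
      have "ip M (pvm_simple_integral E (s n) y) (E X v) =
          (\<Sum>c\<in>range (s n). c * ip M (E (s n -` {c}) y) (E X v))"
        unfolding pvm_simple_integral_def using R X
        by (subst ip_sum_left) (auto simp: ip_scale_left L2_scale E_L2 VD(1))
      also have "\<dots> = (\<Sum>c\<in>range (s n). c * ip (\<mu> v) (\<lambda>t. indicator (s n -` {c}) t * f t) (\<lambda>t. indicator X t))"
        using relD(7)[OF rel_E[OF r ss] X] by simp
      also have "\<dots> = ip (\<mu> v) (\<lambda>t. \<Sum>c\<in>range (s n). c * (indicator (s n -` {c}) t * f t)) (\<lambda>t. indicator X t)"
        using R X relD(3)[OF rel_E[OF r ss]]
        by (subst ip_sum_left) (auto simp: ip_scale_left intro!: L2_scale indicator_L2)
      also have "(\<lambda>t. \<Sum>c\<in>range (s n). c * (indicator (s n -` {c}) t * f t)) = (\<lambda>t. s n t * f t)"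
      proof (rule ext)
        fix t show "(\<Sum>c\<in>range (s n). c * (indicator (s n -` {c}) t * f t)) = s n t * f t"
          using arg_cong[OF simple_function_sum_indicator[OF s, of n t], of "\<lambda>w. w * f t"]
          by (simp only: sum_distrib_right mult.assoc)
      qed
      finally show ?thesis .
    qed
    moreover have "(\<lambda>n. ip (\<mu> v) (\<lambda>t. s n t * f t) (\<lambda>t. indicator X t)) \<longlonglongrightarrow>
        ip (\<mu> v) (\<lambda>t. g t * f t) (\<lambda>t. indicator X t)"
      using R X by (intro ip_tendsto lim' sf gf) (auto intro: indicator_L2)
    ultimately show "(\<lambda>n. ip M (pvm_simple_integral E (s n) y) (E X v)) \<longlonglongrightarrow>
        ip (\<mu> v) (\<lambda>t. g t * f t) (\<lambda>t. indicator X t)" by simp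
  qed
  have "nrm M z = nrm (\<mu> v) (\<lambda>t. g t * f t)" using Q(4) nrm_mu_rel(1)[OF r Q(6)] by simp
  then show ?thesis unfolding rel_iff using R Q gf char by auto
qed

end

section \<open>Hankel operators\<close>

lemma fourier_coeff_add: "f \<in> L2 circ \<Longrightarrow> g \<in> L2 circ \<Longrightarrow>
    fourier_coeff (\<lambda>z. f z + g z) n = fourier_coeff f n + fourier_coeff g n"
  by (simp add: fourier_coeff_ip L2_add ip_add_left powi_L2)

lemma fourier_coeff_diff: "f \<in> L2 circ \<Longrightarrow> g \<in> L2 circ \<Longrightarrow>
    fourier_coeff (\<lambda>z. f z - g z) n = fourier_coeff f n - fourier_coeff g n"
  by (simp add: fourier_coeff_ip L2_diff ip_diff_left powi_L2)

lemma fourier_coeff_scale: "fourier_coeff (\<lambda>z. c * f z) n = c * fourier_coeff f n"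
  unfolding fourier_coeff_def by (simp add: mult.assoc)

lemma fourier_coeff_zero: "fourier_coeff (\<lambda>z. 0) n = 0"
  by (simp add: fourier_coeff_def)

lemma fourier_coeff_const: "fourier_coeff (\<lambda>z. c) n = (if n = 0 then c else 0)"
  using fourier_coeff_scale[of c "\<lambda>_. 1" n] integral_powi[of "- n"] by (simp add: fourier_coeff_def)

lemma fourier_coeff_cong_AE:
  assumes "AE z in circ. f z = g z" "f \<in> L2 circ" "g \<in> L2 circ"
  shows "fourier_coeff f n = fourier_coeff g n"
  using assms by (auto simp: fourier_coeff_ip powi_L2 intro: ip_cong_AE)

lemma H2_L2: "f \<in> H2 \<Longrightarrow> f \<in> L2 circ"
  by (simp add: H2_def)

lemma H2_coeff_neg: "f \<in> H2 \<Longrightarrow> n < 0 \<Longrightarrow> fourier_coeff f n = 0"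
  by (simp add: H2_def)

lemma lin_sub_H2: "lin_sub circ H2"
  by (auto simp: lin_sub_def H2_def L2_zero L2_add L2_scale fourier_coeff_add fourier_coeff_scale fourier_coeff_zero)

lemmas H2_add = lin_subD(3)[OF lin_sub_H2]
lemmas H2_scale = lin_subD(4)[OF lin_sub_H2]

lemma shift_L2: "f \<in> L2 circ \<Longrightarrow> shift f \<in> L2 circ"
  unfolding shift_def
  by (rule L2_bounded_mult[of _ _ _ 1]) (use AE_circ in \<open>auto elim!: eventually_mono\<close>)

lemma fourier_coeff_shift:
  assumes f: "f \<in> L2 circ"
  shows "fourier_coeff (shift f) n = fourier_coeff f (n - 1)"
  unfolding fourier_coeff_def
proof (rule integral_cong_AE)
  have [measurable]: "f \<in> borel_measurable circ" "shift f \<in> borel_measurable circ"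
    using f shift_L2[OF f] by (auto intro: L2_measurable)
  show "(\<lambda>z. shift f z * z powi - n) \<in> borel_measurable circ"
    "(\<lambda>z. f z * z powi - (n - 1)) \<in> borel_measurable circ" by measurable
  show "AE z in circ. shift f z * z powi - n = f z * z powi - (n - 1)"
    using AE_circ
  proof eventually_elim
    case (elim z)
    then have "z powi (1 + - n) = z powi 1 * z powi (- n)" by (intro power_int_add) auto
    then show ?case by (simp add: shift_def)
  qed
qed

lemma shift_H2: "f \<in> H2 \<Longrightarrow> shift f \<in> H2"
  by (auto simp: H2_def shift_L2 fourier_coeff_shift)

lemma const_H2: "(\<lambda>_. c) \<in> H2"
  by (auto simp: H2_def fourier_coeff_const intro!: L2_bounded[OF finite_measure_circ, of _ "cmod c"])

text \<open>Existence of the projection of \<open>u * cnj f\<close>. In this case, and only then,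
  the choice in \<open>szego_proj\<close> has a witness, so that \<open>hankel u f\<close> is
  determined almost everywhere.\<close>

definition hankel_ok :: "(complex \<Rightarrow> complex) \<Rightarrow> (complex \<Rightarrow> complex) \<Rightarrow> bool" where
  "hankel_ok u f \<longleftrightarrow>
     (\<exists>g\<in>H2. \<forall>n\<ge>0. fourier_coeff g n = fourier_coeff (\<lambda>z. u z * cnj (f z)) n)"

text \<open>Moving the character onto \<open>u\<close> turns a Fourier coefficient of
  \<open>u * cnj f\<close>, a product that is merely integrable, into an inner product of two
  square-integrable functions.\<close>

definition twist :: "(complex \<Rightarrow> complex) \<Rightarrow> nat \<Rightarrow> complex \<Rightarrow> complex" where
  "twist u n = (\<lambda>z. u z * z powi (- int n))"

lemma twist_L2: "u \<in> L2 circ \<Longrightarrow> twist u n \<in> L2 circ"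
proof -
  assume u: "u \<in> L2 circ"
  have "AE z in circ. cmod (z powi (- int n)) \<le> 1"
    using AE_circ by eventually_elim (simp add: norm_powi)
  then have "(\<lambda>z. z powi (- int n) * u z) \<in> L2 circ"
    by (intro L2_bounded_mult[OF u]) auto
  then show ?thesis by (simp add: twist_def mult.commute)
qed

lemma fourier_coeff_mult_cnj: "fourier_coeff (\<lambda>z. u z * cnj (f z)) (int n) = ip circ (twist u n) f"
  unfolding fourier_coeff_def ip_def twist_def
  by (intro Bochner_Integration.integral_cong) (auto simp: mult_ac)

lemma hankel_ok_iff:
  "hankel_ok u f \<longleftrightarrow> (\<exists>g\<in>H2. \<forall>n::nat. fourier_coeff g (int n) = ip circ (twist u n) f)"
  unfolding hankel_ok_def fourier_coeff_mult_cnj[symmetric] by (metis nonneg_int_cases of_nat_0_le_iff)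

lemma hankel_okD:
  assumes "hankel_ok u f"
  shows "hankel u f \<in> H2" "fourier_coeff (hankel u f) (int n) = ip circ (twist u n) f"
proof -
  have "hankel u f \<in> H2 \<and> (\<forall>n\<ge>0. fourier_coeff (hankel u f) n = fourier_coeff (\<lambda>z. u z * cnj (f z)) n)"
  proof -
    have "\<exists>g. g \<in> H2 \<and> (\<forall>n\<ge>0. fourier_coeff g n = fourier_coeff (\<lambda>z. u z * cnj (f z)) n)"
      using assms unfolding hankel_ok_def by blast
    from someI_ex[OF this] show ?thesis unfolding hankel_def szego_proj_def .
  qed
  then show "hankel u f \<in> H2" "fourier_coeff (hankel u f) (int n) = ip circ (twist u n) f"
    using fourier_coeff_mult_cnj by auto
qed

lemma hankel_ok_scale:
  assumes "hankel_ok u f"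
  shows "hankel_ok u (\<lambda>z. c * f z)"
proof -
  obtain g where "g \<in> H2" "\<And>n::nat. fourier_coeff g (int n) = ip circ (twist u n) f"
    using assms by (auto simp: hankel_ok_iff)
  then show ?thesis unfolding hankel_ok_iff
    by (intro bexI[of _ "\<lambda>z. cnj c * g z"] H2_scale) (auto simp: fourier_coeff_scale ip_scale_right)
qed

lemma hankel_ok_add:
  assumes "u \<in> L2 circ" "hankel_ok u f" "hankel_ok u g" "f \<in> L2 circ" "g \<in> L2 circ"
  shows "hankel_ok u (\<lambda>z. f z + g z)"
proof -
  obtain f' g' where *: "f' \<in> H2" "\<And>n::nat. fourier_coeff f' (int n) = ip circ (twist u n) f"
      "g' \<in> H2" "\<And>n::nat. fourier_coeff g' (int n) = ip circ (twist u n) g"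
    using assms(2,3) by (auto simp: hankel_ok_iff)
  have "fourier_coeff (\<lambda>z. f' z + g' z) (int n) = ip circ (twist u n) (\<lambda>z. f z + g z)" for n
    unfolding fourier_coeff_add[OF H2_L2[OF *(1)] H2_L2[OF *(3)]]
      ip_add_right[OF assms(4,5) twist_L2[OF assms(1)]] *(2,4) ..
  then show ?thesis unfolding hankel_ok_iff using H2_add[OF *(1,3)] by blast
qed

text \<open>Where no projection exists, \<open>hankel u\<close> takes one and the same unspecified value. As
  \<open>B\<^sup>2 = H\<^sub>u\<^sup>2\<close> is homogeneous, it vanishes at such points, and they would span \<open>H2\<close>.\<close>

lemma hankel_not_ok:
  assumes "\<not> hankel_ok u f" "\<not> hankel_ok u g"
  shows "hankel u f = hankel u g"
proof -
  have "(h \<in> H2 \<and> (\<forall>n\<ge>0. fourier_coeff h n = fourier_coeff (\<lambda>z. u z * cnj (f z)) n)) = False"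
    "(h \<in> H2 \<and> (\<forall>n\<ge>0. fourier_coeff h n = fourier_coeff (\<lambda>z. u z * cnj (g z)) n)) = False" for h
    using assms unfolding hankel_ok_def by meson+
  then show ?thesis unfolding hankel_def szego_proj_def by (simp only:)
qed

lemma modulus_zero_if_not_ok:
  assumes u: "u \<in> L2 circ" and B: "is_modulus circ H2 (hankel u) B"
    and f0: "f0 \<in> H2" "\<not> hankel_ok u f0" and f: "f \<in> H2"
  shows "nrm circ (B f) = 0"
proof -
  note sa = is_modulusD(1)[OF B]
  note bo = selfadjoint_opD(1)[OF sa]
  have Bin: "B g \<in> H2" if "g \<in> H2" for g using bounded_opD(1)[OF bo that] .
  have BL: "B g \<in> L2 circ" if "g \<in> H2" for g using Bin[OF that] by (rule H2_L2)
  have BB_add: "AE z in circ. B (B (\<lambda>z. g z + h z)) z = B (B g) z + B (B h) z" if "g \<in> H2" "h \<in> H2" for g h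
  proof -
    have "AE z in circ. B (\<lambda>z. g z + h z) z = B g z + B h z" by (rule bounded_opD(2)[OF bo that])
    then have "AE z in circ. B (B (\<lambda>z. g z + h z)) z = B (\<lambda>z. B g z + B h z) z"
      using that by (intro bounded_op_cong[OF lin_sub_H2 bo] Bin lin_subD(3)[OF lin_sub_H2])
    moreover have "AE z in circ. B (\<lambda>z. B g z + B h z) z = B (B g) z + B (B h) z"
      using that by (intro bounded_opD(2)[OF bo] Bin)
    ultimately show ?thesis by eventually_elim simp
  qed
  have bad: "AE z in circ. B (B g) z = 0" if g: "g \<in> H2" "\<not> hankel_ok u g" for g
  proof -
    \<comment> \<open>Both \<open>g\<close> and \<open>2 g\<close> are bad, so \<open>H\<close> and
      hence \<open>B^2\<close> take the same value at them; additivity of \<open>B^2\<close> leaves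
      only 0.\<close>
    have nok: "\<not> hankel_ok u (\<lambda>z. g z + g z)"
    proof
      assume "hankel_ok u (\<lambda>z. g z + g z)"
      from hankel_ok_scale[OF this, of "1/2"] have "hankel_ok u (\<lambda>z. (g z + g z) / 2)" by simp
      then show False using g(2) by simp
    qed
    have gg: "(\<lambda>z. g z + g z) \<in> H2" by (rule lin_subD(3)[OF lin_sub_H2 g(1) g(1)])
    have "AE z in circ. B (B (\<lambda>z. g z + g z)) z = hankel u (hankel u (\<lambda>z. g z + g z)) z"
      by (rule is_modulusD(3)[OF B gg])
    then have 1: "AE z in circ. B (B (\<lambda>z. g z + g z)) z = hankel u (hankel u g) z"
      by (simp only: hankel_not_ok[OF nok g(2)])
    show ?thesis using 1 is_modulusD(3)[OF B g(1)] BB_add[OF g(1) g(1)]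
      by eventually_elim simp
  qed
  have BB0: "AE z in circ. B (B f) z = 0"
  proof (cases "hankel_ok u f")
    case False then show ?thesis using bad f by blast
  next
    case True
    \<comment> \<open>A good \<open>f\<close> plus the bad \<open>f0\<close> is bad, so
      \<open>f\<close> is a difference of two points where \<open>B^2\<close> vanishes.\<close>
    have nok: "\<not> hankel_ok u (\<lambda>z. f z + f0 z)"
    proof
      assume *: "hankel_ok u (\<lambda>z. f z + f0 z)"
      have "hankel_ok u (\<lambda>z. (f z + f0 z) + (-1) * f z)"
        by (rule hankel_ok_add[OF u * hankel_ok_scale[OF True]]) (intro L2_add L2_scale H2_L2 f f0)+
      then show False using f0(2) by simp
    qed
    show ?thesis
      using bad[OF lin_subD(3)[OF lin_sub_H2 f f0(1)] nok] bad[OF f0] BB_add[OF f f0(1)]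
      by eventually_elim simp
  qed
  have "(nrm circ (B f))\<^sup>2 = Re (ip circ (B f) (B f))" by (rule nrm_sq_ip)
  also have "ip circ (B f) (B f) = ip circ (B (B f)) f"
    using f Bin by (intro selfadjoint_opD(2)[OF sa, symmetric]) auto
  also have "\<dots> = ip circ (\<lambda>_. 0) f"
    using BB0 f Bin by (intro ip_cong_AE) (auto intro: H2_L2 L2_zero)
  finally show ?thesis by simp
qed

section \<open>Algebra of everywhere defined Hankel operators\<close>

locale hankel_setup =
  fixes u assumes u: "u \<in> H2" and ok: "\<And>f. f \<in> H2 \<Longrightarrow> hankel_ok u f"
begin

lemma uL: "u \<in> L2 circ" using u by (rule H2_L2)

abbreviation "H \<equiv> hankel u"
abbreviation "Ht \<equiv> hankel_tilde u"
abbreviation "K \<equiv> hankel_ran u"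

lemma H_H2: "f \<in> H2 \<Longrightarrow> H f \<in> H2" by (rule hankel_okD(1)[OF ok])
lemma H_coeff: "f \<in> H2 \<Longrightarrow> fourier_coeff (H f) (int n) = ip circ (twist u n) f"
  by (rule hankel_okD(2)[OF ok])
lemma Ht_H2: "f \<in> H2 \<Longrightarrow> Ht f \<in> H2" unfolding hankel_tilde_def by (intro H_H2 shift_H2)

lemma ip_twist_shift:
  assumes "f \<in> L2 circ"
  shows "ip circ (twist u n) (shift f) = ip circ (twist u (Suc n)) f"
  unfolding ip_def
proof (rule integral_cong_AE)
  have [measurable]: "f \<in> borel_measurable circ" "shift f \<in> borel_measurable circ"
      "twist u m \<in> borel_measurable circ" for m
    using assms shift_L2[OF assms] twist_L2[OF uL] by (auto intro: L2_measurable)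
  show "(\<lambda>z. twist u n z * cnj (shift f z)) \<in> borel_measurable circ"
    "(\<lambda>z. twist u (Suc n) z * cnj (f z)) \<in> borel_measurable circ" by measurable
  show "AE z in circ. twist u n z * cnj (shift f z) = twist u (Suc n) z * cnj (f z)"
    using AE_circ
  proof eventually_elim
    case (elim z)
    then have "z powi (- int n + - 1) = z powi (- int n) * z powi (- 1)" by (intro power_int_add) auto
    moreover have "- int n + - 1 = - int (Suc n)" by simp
    moreover have "z powi (- 1) = cnj z" using cnj_powi[OF elim, of 1] by simp
    ultimately have e: "z powi (- int (Suc n)) = z powi (- int n) * cnj z" by (simp only:)
    show ?case unfolding shift_def twist_def e by simp
  qed
qed

lemma Ht_coeff: "f \<in> H2 \<Longrightarrow> fourier_coeff (Ht f) (int n) = ip circ (twist u (Suc n)) f"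
  unfolding hankel_tilde_def by (simp add: H_coeff shift_H2 ip_twist_shift H2_L2)

text \<open>In coefficients, this is the identity of \<open>H S\<close> with the backward shift of
  \<open>H\<close>.\<close>

lemma H_coeff_Suc: "f \<in> H2 \<Longrightarrow> fourier_coeff (H f) (int (Suc n)) = fourier_coeff (Ht f) (int n)"
  by (simp only: H_coeff Ht_coeff)

text \<open>The forward shift applied to \<open>Ht f\<close>, the backward shift of
  \<open>H f\<close>, returns \<open>H f\<close> without its constant term
  \<open>c = ip circ u f\<close>. Hence \<open>Ht (Ht f) = H (H f - c)\<close>, and \<open>H\<close>
  sends the constant \<open>c\<close> to \<open>cnj c * u\<close>.\<close>

lemma H_sq_eq:
  assumes f: "f \<in> H2"
  shows "AE z in circ. H (H f) z = Ht (Ht f) z + ip circ f u * u z"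
proof (rule H2_unique)
  show "H (H f) \<in> H2" using f by (intro H_H2)
  have T: "Ht (Ht f) \<in> H2" "(\<lambda>z. ip circ f u * u z) \<in> H2"
    using f u by (auto intro: Ht_H2 lin_subD(4)[OF lin_sub_H2])
  then show "(\<lambda>z. Ht (Ht f) z + ip circ f u * u z) \<in> H2"
    by (rule lin_subD(3)[OF lin_sub_H2])
  define c where "c = ip circ u f"
  have Hf: "H f \<in> H2" "Ht f \<in> H2" using f by (auto intro: H_H2 Ht_H2)
  have tw0: "twist u 0 = u" by (simp add: twist_def)
  have eq: "AE z in circ. shift (Ht f) z = H f z - c"
  proof (rule H2_unique)
    show "shift (Ht f) \<in> H2" using Hf by (intro shift_H2)
    show "(\<lambda>z. H f z - c) \<in> H2" using Hf const_H2 by (intro lin_sub_diff[OF lin_sub_H2])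
    show "fourier_coeff (shift (Ht f)) (int n) = fourier_coeff (\<lambda>z. H f z - c) (int n)" for n
    proof (cases n)
      case 0
      then show ?thesis using Hf H_coeff[OF f, of 0] const_H2[of c]
        by (simp add: fourier_coeff_shift fourier_coeff_diff fourier_coeff_const H2_L2 H2_coeff_neg c_def tw0)
    next
      case (Suc m)
      then show ?thesis using Hf H_coeff_Suc[OF f, of m] const_H2[of c]
        by (simp add: fourier_coeff_shift fourier_coeff_diff fourier_coeff_const H2_L2)
    qed
  qed
  fix n :: nat
  have "fourier_coeff (Ht (Ht f)) (int n) = ip circ (twist u n) (shift (Ht f))"
    using Hf by (simp add: Ht_coeff ip_twist_shift H2_L2)
  also have "\<dots> = ip circ (twist u n) (\<lambda>z. H f z - c)"
    by (rule ip_cong_AE[OF _ eq])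
      (auto intro: L2_diff[OF H2_L2[OF Hf(1)] H2_L2[OF const_H2]] H2_L2[OF shift_H2[OF Hf(2)]] twist_L2[OF uL])
  also have "\<dots> = fourier_coeff (H (H f)) (int n) - ip circ (twist u n) (\<lambda>z. c)"
    unfolding ip_diff_right[OF H2_L2[OF Hf(1)] H2_L2[OF const_H2] twist_L2[OF uL]] H_coeff[OF Hf(1)] ..
  also have "ip circ (twist u n) (\<lambda>z. c) = cnj c * fourier_coeff u (int n)"
    using ip_scale_right[of circ "twist u n" c "\<lambda>_. 1"] by (simp add: ip_def twist_def fourier_coeff_def)
  also have "cnj c = ip circ f u" unfolding c_def by (rule cnj_ip)
  finally show "fourier_coeff (H (H f)) (int n) = fourier_coeff (\<lambda>z. Ht (Ht f) z + ip circ f u * u z) (int n)"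
    using T by (simp add: fourier_coeff_add fourier_coeff_scale H2_L2)
qed

lemma H_add: "f \<in> H2 \<Longrightarrow> g \<in> H2 \<Longrightarrow> AE z in circ. H (\<lambda>z. f z + g z) z = H f z + H g z"
proof (rule H2_unique)
  assume *: "f \<in> H2" "g \<in> H2"
  show "H (\<lambda>z. f z + g z) \<in> H2" "(\<lambda>z. H f z + H g z) \<in> H2"
    using * by (auto intro: H_H2 H2_add)
  show "fourier_coeff (H (\<lambda>z. f z + g z)) (int n) = fourier_coeff (\<lambda>z. H f z + H g z) (int n)" for n
    unfolding fourier_coeff_add[OF H2_L2[OF H_H2[OF *(1)]] H2_L2[OF H_H2[OF *(2)]]]
      H_coeff[OF H2_add[OF *]] H_coeff[OF *(1)] H_coeff[OF *(2)]
      ip_add_right[OF H2_L2[OF *(1)] H2_L2[OF *(2)] twist_L2[OF uL]] ..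
qed

lemma H_scale: "f \<in> H2 \<Longrightarrow> AE z in circ. H (\<lambda>z. cnj c * f z) z = c * H f z"
  by (rule H2_unique)
    (auto simp: H_coeff fourier_coeff_scale ip_scale_right H_H2 H2_scale)

lemma K_H2: "K \<subseteq> H2" by (auto simp: hankel_ran_def)

lemma lin_sub_K: "lin_sub circ K"
proof -
  \<comment> \<open>The range has to be saturated under a.e. equality to be a subspace:
    \<open>H f + H g\<close> is only almost everywhere a value of \<open>H\<close>.\<close>
  define R where "R = {g \<in> H2. \<exists>f\<in>H2. AE z in circ. g z = H f z}"
  have R: "lin_sub circ R"
    unfolding lin_sub_def
  proof (intro conjI ballI allI)
    show "R \<subseteq> L2 circ" unfolding R_def using H2_L2 by auto
    have "AE z in circ. H (\<lambda>_. 0) z = 0" using H_scale[OF lin_subD(2)[OF lin_sub_H2], of 0] by simp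
    then have "AE z in circ. 0 = H (\<lambda>_. 0) z" by eventually_elim simp
    then show "(\<lambda>_. 0) \<in> R"
      unfolding R_def by (intro CollectI conjI bexI[of _ "\<lambda>_. 0"] lin_subD(2)[OF lin_sub_H2])
    fix g h assume "g \<in> R" "h \<in> R"
    then obtain g' h' where *: "g \<in> H2" "h \<in> H2" "g' \<in> H2" "h' \<in> H2"
       "AE z in circ. g z = H g' z" "AE z in circ. h z = H h' z" unfolding R_def by blast
    have "AE z in circ. g z + h z = H (\<lambda>z. g' z + h' z) z"
      using *(5,6) H_add[OF *(3,4)] by eventually_elim simp
    then show "(\<lambda>x. g x + h x) \<in> R"
      unfolding R_def by (intro CollectI conjI bexI[of _ "\<lambda>z. g' z + h' z"] lin_subD(3)[OF lin_sub_H2] *)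
  next
    fix g c assume "g \<in> R"
    then obtain g' where *: "g \<in> H2" "g' \<in> H2" "AE z in circ. g z = H g' z" unfolding R_def by blast
    have "AE z in circ. c * g z = H (\<lambda>z. cnj c * g' z) z"
      using *(3) H_scale[OF *(2), of c] by eventually_elim simp
    then show "(\<lambda>x. c * g x) \<in> R"
      unfolding R_def by (intro CollectI conjI bexI[of _ "\<lambda>z. cnj c * g' z"] lin_subD(4)[OF lin_sub_H2] *)
  qed
  have eq: "K = H2 \<inter> L2_closure circ R"
  proof (intro set_eqI iffI)
    fix g assume g: "g \<in> K"
    show "g \<in> H2 \<inter> L2_closure circ R"
      unfolding L2_closure_def
    proof (intro IntI CollectI conjI allI impI)
      fix e :: real assume "e > 0"
      then obtain f where "f \<in> H2" "nrm circ (\<lambda>z. g z - H f z) < e"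
        using g by (auto simp: hankel_ran_def)
      then show "\<exists>h\<in>R. nrm circ (\<lambda>x. g x - h x) < e"
        by (intro bexI[of _ "H f"]) (auto simp: R_def H_H2)
    qed (use g H2_L2 in \<open>auto simp: hankel_ran_def\<close>)
  next
    fix g assume g: "g \<in> H2 \<inter> L2_closure circ R"
    show "g \<in> K" unfolding hankel_ran_def
    proof (intro CollectI conjI allI impI)
      fix e :: real assume "e > 0"
      then obtain h where h: "h \<in> R" "nrm circ (\<lambda>z. g z - h z) < e"
        using g by (auto simp: L2_closure_def)
      then obtain f where f: "f \<in> H2" "AE z in circ. h z = H f z" "h \<in> H2" by (auto simp: R_def)
      have "nrm circ (\<lambda>z. g z - H f z) = nrm circ (\<lambda>z. g z - h z)"
      proof (rule nrm_cong_AE)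
        show "AE z in circ. g z - H f z = g z - h z" using f(2) by eventually_elim simp
        have "g \<in> H2" using g by simp
        then show "(\<lambda>z. g z - H f z) \<in> borel_measurable circ" "(\<lambda>z. g z - h z) \<in> borel_measurable circ"
          using f by (auto intro: L2_measurable[OF L2_diff[OF H2_L2 H2_L2]] H_H2)
      qed
      then show "\<exists>f\<in>H2. nrm circ (\<lambda>z. g z - H f z) < e" using f h by (intro bexI[of _ f]) simp_all
    qed (use g in auto)
  qed
  show ?thesis
    unfolding eq by (rule lin_sub_Int[OF lin_sub_H2 L2_closure_lin_sub[OF R]])
qed

lemma H_cong:
  assumes "f \<in> H2" "g \<in> H2" "AE z in circ. f z = g z"
  shows "AE z in circ. H f z = H g z"
proof (rule H2_unique)
  show "fourier_coeff (H f) (int n) = fourier_coeff (H g) (int n)" for n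
    using assms ip_cong_AE[of "twist u n" "twist u n" circ f g] by (simp add: H_coeff twist_L2[OF uL] H2_L2)
qed (use assms in \<open>auto intro: H_H2\<close>)

end

section \<open>Measures on the line\<close>

lemma measure_eqI_continuous:
  fixes M N :: "'a::metric_space measure"
  assumes [measurable_cong]: "sets M = sets borel" "sets N = sets borel" and fin: "finite_measure M" "finite_measure N"
    and eq: "\<And>h :: 'a \<Rightarrow> real. continuous_on UNIV h \<Longrightarrow> (\<And>x. 0 \<le> h x \<and> h x \<le> 1) \<Longrightarrow>
      integral\<^sup>L M h = integral\<^sup>L N h"
  shows "M = N"
proof -
  have cl: "emeasure M F = emeasure N F" if "closed F" for F
  proof -
    have [measurable]: "F \<in> sets borel" using that by simp
    obtain h :: "nat \<Rightarrow> 'a \<Rightarrow> real" where h: "\<And>n. continuous_on UNIV (h n)" "\<And>n x. 0 \<le> h n x \<and> h n x \<le> 1"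
      "\<And>x. (\<lambda>n. h n x) \<longlonglongrightarrow> indicator F x" using closed_indicator_approx[OF \<open>closed F\<close>] by metis
    have [measurable]: "h n \<in> borel_measurable borel" for n
      using h(1) by (rule borel_measurable_continuous_onI)
    have lim: "(\<lambda>n. integral\<^sup>L Q (h n)) \<longlonglongrightarrow> measure Q F"
      if [measurable_cong]: "sets Q = sets borel" and "finite_measure Q" for Q
    proof -
      have "(\<lambda>n. integral\<^sup>L Q (h n)) \<longlonglongrightarrow> (LINT x|Q. indicator F x)"
        by (rule integral_dominated_convergence[where w = "\<lambda>_. 1"])
          (use that h in \<open>auto simp: finite_measure.integrable_const\<close>)
      also have "(LINT x|Q. indicator F x) = measure Q F"
        using sets_eq_imp_space_eq[OF that(1)] by simp
      finally show ?thesis .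
    qed
    have "measure M F = measure N F"
      by (rule LIMSEQ_unique[OF lim[OF assms(1) fin(1)]]) (use lim[OF assms(2) fin(2)] eq[OF h(1,2)] in simp)
    then show ?thesis using fin by (simp add: finite_measure.emeasure_eq_measure)
  qed
  show ?thesis
  proof (rule measure_eqI_generator_eq[where E = "Collect closed" and \<Omega> = UNIV and A = "\<lambda>_. UNIV"])
    show "Int_stable (Collect closed :: 'a set set)" by (auto simp: Int_stable_def)
    show "emeasure M UNIV \<noteq> \<infinity>" using fin(1) by (simp add: finite_measure.emeasure_finite)
  qed (use assms cl in \<open>auto simp: borel_eq_closed\<close>)
qed

section \<open>Even polynomials and even moments\<close>

text \<open>Stone-Weierstrass on \<open>{0..c}\<close>, where \<open>t^2\<close> already separates
  points. Nonnegativity of the spectrum is thus what makes knowledge of \<open>B^2\<close>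
  sufficient.\<close>

lemma even_poly_uniform:
  fixes h :: "real \<Rightarrow> real"
  assumes h: "continuous_on UNIV h" and e: "e > 0"
  shows "\<exists>p. \<forall>t\<in>{0..c}. \<bar>h t - poly p (t\<^sup>2)\<bar> < e"
proof -
  define R :: "(real \<Rightarrow> real) set" where "R = range (\<lambda>p t. poly p (t\<^sup>2))"
  interpret function_ring_on R "{0..c}"
  proof
    fix f g assume "f \<in> R" "g \<in> R"
    then obtain p q where "f = (\<lambda>t. poly p (t\<^sup>2))" "g = (\<lambda>t. poly q (t\<^sup>2))" by (auto simp: R_def)
    then show "(\<lambda>t. f t + g t) \<in> R" "(\<lambda>t. f t * g t) \<in> R"
      by (auto simp: R_def intro: range_eqI[of _ _ "p + q"] range_eqI[of _ _ "p * q"])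
  next
    show "(\<lambda>_. k) \<in> R" for k unfolding R_def by (rule range_eqI[of _ _ "[:k:]"]) auto
    fix x y :: real assume "x \<in> {0..c}" "y \<in> {0..c}" "x \<noteq> y"
    then have "poly [:0, 1:] (x\<^sup>2) \<noteq> poly [:0, 1:] (y\<^sup>2)" by (simp add: power2_eq_iff_nonneg)
    moreover have "(\<lambda>t. poly [:0, 1:] (t\<^sup>2)) \<in> R" unfolding R_def by (rule rangeI)
    ultimately show "\<exists>f\<in>R. f x \<noteq> f y" by (rule bexI)
  qed (auto simp: R_def intro!: continuous_intros)
  obtain F where F: "\<And>n. F n \<in> R" "uniform_limit {0..c} F h sequentially"
    using Stone_Weierstrass[OF continuous_on_subset[OF h]] by auto
  from uniform_limitD[OF F(2) e] obtain n where n: "\<forall>t\<in>{0..c}. dist (F n t) (h t) < e"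
    by (auto simp: eventually_sequentially)
  obtain p where "F n = (\<lambda>t. poly p (t\<^sup>2))" using F(1)[of n] unfolding R_def by blast
  then show ?thesis using n by (auto simp: dist_real_def abs_minus_commute intro!: exI[of _ p])
qed

lemma poly_of_real_map:
  "poly (map_poly complex_of_real p) (complex_of_real x) = complex_of_real (poly p x)"
  by (induction p) (auto simp: map_poly_pCons)

lemma even_poly_lin_sub:
  fixes \<mu> :: "real measure"
  assumes sets[measurable_cong]: "sets \<mu> = sets borel" and fin: "finite_measure \<mu>" and supp: "AE t in \<mu>. t \<in> {0..c}"
  shows "lin_sub \<mu> (range (\<lambda>p t. poly p (complex_of_real (t\<^sup>2))))"
  unfolding lin_sub_def
proof (intro conjI ballI allI subsetI)
  fix f assume "f \<in> range (\<lambda>p t. poly p (complex_of_real (t\<^sup>2)))"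
  then obtain p where f: "f = (\<lambda>t. poly p (complex_of_real (t\<^sup>2)))" by blast
  have cont: "continuous_on A f" for A unfolding f by (intro continuous_intros)
  have "bounded (f ` {0..c})" by (intro compact_imp_bounded compact_continuous_image cont) auto
  then obtain C where C: "\<forall>y\<in>f ` {0..c}. cmod y \<le> C" by (auto simp: bounded_iff)
  have "AE t in \<mu>. cmod (f t) \<le> C" using supp by eventually_elim (use C in auto)
  then show "f \<in> L2 \<mu>"
    by (intro L2_bounded[OF fin]) (use borel_measurable_continuous_onI[OF cont] in auto)
next
  show "(\<lambda>_. 0) \<in> range (\<lambda>p t. poly p (complex_of_real (t\<^sup>2)))"
    by (rule range_eqI[of _ _ 0]) auto
next
  fix f g assume "f \<in> range (\<lambda>p t. poly p (complex_of_real (t\<^sup>2)))" "g \<in> range (\<lambda>p t. poly p (complex_of_real (t\<^sup>2)))"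
  then obtain p q where "f = (\<lambda>t. poly p (complex_of_real (t\<^sup>2)))" "g = (\<lambda>t. poly q (complex_of_real (t\<^sup>2)))" by blast
  then show "(\<lambda>x. f x + g x) \<in> range (\<lambda>p t. poly p (complex_of_real (t\<^sup>2)))"
    by (intro range_eqI[of _ _ "p + q"]) auto
next
  fix f k assume "f \<in> range (\<lambda>p t. poly p (complex_of_real (t\<^sup>2)))"
  then obtain p where "f = (\<lambda>t. poly p (complex_of_real (t\<^sup>2)))" by blast
  then show "(\<lambda>x. k * f x) \<in> range (\<lambda>p t. poly p (complex_of_real (t\<^sup>2)))"
    by (intro range_eqI[of _ _ "smult k p"]) auto
qed

lemma even_poly_dense:
  fixes \<mu> :: "real measure"
  assumes sets[measurable_cong]: "sets \<mu> = sets borel" and fin: "finite_measure \<mu>" and supp: "AE t in \<mu>. t \<in> {0..c}"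
  shows "L2_closure \<mu> (range (\<lambda>p t. poly p (complex_of_real (t\<^sup>2)))) = L2 \<mu>"
proof (rule L2_dense_if_continuous[OF sets fin even_poly_lin_sub[OF assms]])
  fix h :: "real \<Rightarrow> real" assume h: "continuous_on UNIV h" and h01: "\<And>x. 0 \<le> h x \<and> h x \<le> 1"
  have [measurable]: "h \<in> borel_measurable \<mu>" using borel_measurable_continuous_onI[OF h] by simp
  have hL: "(\<lambda>x. complex_of_real (h x)) \<in> L2 \<mu>"
    by (rule L2_bounded[OF fin, of _ 1]) (use h01 in auto)
  show "(\<lambda>x. complex_of_real (h x)) \<in> L2_closure \<mu> (range (\<lambda>p t. poly p (complex_of_real (t\<^sup>2))))"
    unfolding L2_closure_def
  proof (intro CollectI conjI allI impI hL)
    fix e :: real assume e: "e > 0"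
    \<comment> \<open>With this \<open>d\<close> the squared error is at most
      \<open>measure \<mu> UNIV * d^2\<close>, which lies strictly below
      \<open>(measure \<mu> UNIV + 1)^2 * d^2 = e^2\<close>.\<close>
    define d where "d = e / (measure \<mu> UNIV + 1)"
    have d: "d > 0" unfolding d_def using e by (intro divide_pos_pos) (auto simp: add_nonneg_pos)
    have spU: "space \<mu> = UNIV" using sets_eq_imp_space_eq[OF sets] by simp
    obtain p where p: "\<forall>t\<in>{0..c}. \<bar>h t - poly p (t\<^sup>2)\<bar> < d"
      using even_poly_uniform[OF h d] by blast
    define g where "g t = poly (map_poly complex_of_real p) (complex_of_real (t\<^sup>2))" for t
    have g: "g \<in> range (\<lambda>p t. poly p (complex_of_real (t\<^sup>2)))" unfolding g_def by blast
    then have gL: "g \<in> L2 \<mu>" using lin_subD(1)[OF even_poly_lin_sub[OF assms]] by blast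
    have "(nrm \<mu> (\<lambda>x. complex_of_real (h x) - g x))\<^sup>2 \<le> (LINT x|\<mu>. d\<^sup>2)"
      unfolding nrm_sq
    proof (rule integral_mono_AE)
      show "AE x in \<mu>. (cmod (complex_of_real (h x) - g x))\<^sup>2 \<le> d\<^sup>2"
        using supp
      proof eventually_elim
        case (elim t)
        have "cmod (complex_of_real (h t) - g t) = \<bar>h t - poly p (t\<^sup>2)\<bar>"
          unfolding g_def poly_of_real_map of_real_diff[symmetric] norm_of_real ..
        moreover have "\<bar>h t - poly p (t\<^sup>2)\<bar> \<le> d" using p[rule_format, OF elim] by simp
        ultimately show ?case by (simp only:) (intro power_mono abs_ge_zero)
      qed
    qed (use L2_diff[OF hL gL] fin in \<open>auto simp: L2_integrable_sq finite_measure.integrable_const\<close>)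
    also have "\<dots> = measure \<mu> UNIV * d\<^sup>2" using spU by simp
    also have "\<dots> < (measure \<mu> UNIV + 1)\<^sup>2 * d\<^sup>2"
    proof (rule mult_strict_right_mono)
      show "measure \<mu> UNIV < (measure \<mu> UNIV + 1)\<^sup>2"
      proof -
        have "(measure \<mu> UNIV + 1)\<^sup>2 = (measure \<mu> UNIV)\<^sup>2 + 2 * measure \<mu> UNIV + 1"
          by (simp add: power2_sum)
        then show ?thesis using measure_nonneg[of \<mu> UNIV] zero_le_power2[of "measure \<mu> UNIV"] by linarith
      qed
    qed (use d in auto)
    also have "\<dots> = e\<^sup>2"
    proof -
      have "measure \<mu> UNIV + 1 \<noteq> 0" using measure_nonneg[of \<mu> UNIV] by linarith
      then have "(measure \<mu> UNIV + 1) * d = e" unfolding d_def by simp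
      then show ?thesis by (simp only: power_mult_distrib[of "measure \<mu> UNIV + 1" d, symmetric])
    qed
    finally have "nrm \<mu> (\<lambda>x. complex_of_real (h x) - g x) < e"
      by (rule power2_less_imp_less) (use e in auto)
    then show "\<exists>g\<in>range (\<lambda>p t. poly p (complex_of_real (t\<^sup>2))). nrm \<mu> (\<lambda>x. complex_of_real (h x) - g x) < e"
      by (intro bexI[OF _ g])
  qed
qed

text \<open>Only \<open>\<rho>\<close> is known to have bounded support. The moments of
  \<open>\<mu>\<close> grow no faster than those of \<open>\<rho>\<close>, which bounds the support
  of \<open>\<mu>\<close> as well; after that the even polynomials determine both measures.\<close>

lemma measure_eqI_even_moments:
  fixes \<mu> \<rho> :: "real measure"
  assumes sets[measurable_cong]: "sets \<mu> = sets borel" "sets \<rho> = sets borel"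
    and fin: "finite_measure \<mu>" "finite_measure \<rho>"
    and pos: "AE t in \<mu>. 0 \<le> t" and supp: "AE t in \<rho>. t \<in> {0..c}"
    and int: "\<And>j. integrable \<mu> (\<lambda>t. t ^ (2 * j))"
    and eq: "\<And>j. (LINT t|\<mu>. t ^ (2 * j)) = (LINT t|\<rho>. t ^ (2 * j))"
  shows "\<mu> = \<rho>"
proof -
  have spU: "space \<mu> = UNIV" "space \<rho> = UNIV" using sets_eq_imp_space_eq[OF sets(1)] sets_eq_imp_space_eq[OF sets(2)] by auto
  have intr: "integrable \<rho> (\<lambda>t. t ^ (2 * j))" for j
  proof (rule Bochner_Integration.integrable_bound[where f = "\<lambda>_. c ^ (2 * j)"])
    show "AE t in \<rho>. norm (t ^ (2 * j)) \<le> norm (c ^ (2 * j))"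
      using supp by eventually_elim (auto intro: power_mono)
  qed (use fin in \<open>auto simp: finite_measure.integrable_const\<close>)
  \<comment> \<open>Chebyshev's inequality with the power \<open>2 * j\<close> bounds this mass by a
    multiple of \<open>(|c| / d)^(2 j)\<close>; then \<open>j\<close> tends to infinity.\<close>
  have tail: "measure \<mu> {d..} = 0" if d: "d > \<bar>c\<bar>" for d
  proof -
    define C where "C = measure \<rho> UNIV"
    have "measure \<mu> {d..} * d ^ (2 * j) \<le> \<bar>c\<bar> ^ (2 * j) * C" for j
    proof -
      have "measure \<mu> {d..} * d ^ (2 * j) = (LINT t|\<mu>. d ^ (2 * j) * indicator {d..} t)"
        using spU by simp
      also have "\<dots> \<le> (LINT t|\<mu>. t ^ (2 * j))"
      proof (rule integral_mono[OF _ int])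
        show "integrable \<mu> (\<lambda>t. d ^ (2 * j) * indicator {d..} t)"
          using fin(1) by (intro integrable_mult_right integrable_real_indicator)
            (auto simp: finite_measure.emeasure_finite less_top[symmetric])
        show "d ^ (2 * j) * indicator {d..} t \<le> t ^ (2 * j)" for t
          using d by (cases "d \<le> t") (auto intro!: power_mono)
      qed
      also have "\<dots> = (LINT t|\<rho>. t ^ (2 * j))" by (rule eq)
      also have "\<dots> \<le> (LINT t|\<rho>. \<bar>c\<bar> ^ (2 * j))"
      proof (rule integral_mono_AE)
        show "AE t in \<rho>. t ^ (2 * j) \<le> \<bar>c\<bar> ^ (2 * j)"
          using supp by eventually_elim (auto intro!: power_mono)
      qed (use intr fin in \<open>auto simp: finite_measure.integrable_const\<close>)
      also have "\<dots> = \<bar>c\<bar> ^ (2 * j) * C" using spU by (simp add: C_def)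
      finally show ?thesis .
    qed
    then have bd: "measure \<mu> {d..} \<le> ((\<bar>c\<bar> / d)\<^sup>2) ^ j * C" for j
    proof -
      have "measure \<mu> {d..} \<le> (\<bar>c\<bar> ^ (2 * j) * C) / d ^ (2 * j)"
        using \<open>measure \<mu> {d..} * d ^ (2 * j) \<le> \<bar>c\<bar> ^ (2 * j) * C\<close> d by (subst pos_le_divide_eq) auto
      then show ?thesis by (simp only: power_divide power_mult[symmetric] times_divide_eq_left)
    qed
    have "(\<lambda>j. ((\<bar>c\<bar> / d)\<^sup>2) ^ j * C) \<longlonglongrightarrow> 0 * C"
      using d by (intro tendsto_mult LIMSEQ_power_zero tendsto_const) (auto simp: power_less_one_iff abs_square_less_1)
    then have "measure \<mu> {d..} \<le> 0"
      by (intro LIMSEQ_le_const[of _ 0]) (use bd in auto)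
    then show ?thesis using measure_nonneg[of \<mu> "{d..}"] by linarith
  qed
  define c' where "c' = \<bar>c\<bar> + 1"
  have "AE t in \<mu>. t \<notin> {c'..}"
    using tail[of c'] fin(1) by (intro AE_not_in) (auto simp: null_sets_def c'_def finite_measure.emeasure_eq_measure)
  then have supp1: "AE t in \<mu>. t \<in> {0..c'}" using pos by eventually_elim auto
  have supp2: "AE t in \<rho>. t \<in> {0..c'}" using supp by eventually_elim (auto simp: c'_def)
  have polyeq: "(LINT t|\<mu>. poly p (t\<^sup>2)) = (LINT t|\<rho>. poly p (t\<^sup>2))"
    "integrable \<mu> (\<lambda>t. poly p (t\<^sup>2))" "integrable \<rho> (\<lambda>t. poly p (t\<^sup>2))" for p
  proof -
    have e: "poly p (t\<^sup>2) = (\<Sum>i\<le>degree p. coeff p i * t ^ (2 * i))" for t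
      by (simp only: poly_altdef power_mult)
    show "integrable \<mu> (\<lambda>t. poly p (t\<^sup>2))" "integrable \<rho> (\<lambda>t. poly p (t\<^sup>2))"
      unfolding e by (intro Bochner_Integration.integrable_sum integrable_mult_right int intr)+
    show "(LINT t|\<mu>. poly p (t\<^sup>2)) = (LINT t|\<rho>. poly p (t\<^sup>2))"
      unfolding e using int intr eq by (subst (1 2) Bochner_Integration.integral_sum) auto
  qed
  show ?thesis
  proof (rule measure_eqI_continuous[OF sets fin])
    fix h :: "real \<Rightarrow> real" assume h: "continuous_on UNIV h" and h01: "\<And>x. 0 \<le> h x \<and> h x \<le> 1"
    have [measurable]: "h \<in> borel_measurable borel" using borel_measurable_continuous_onI[OF h] .
    have ih: "integrable \<mu> h" "integrable \<rho> h"
      by (rule finite_measure.integrable_const_bound[of _ _ 1]; use fin h01 in auto)+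
    have near: "\<bar>(LINT t|Q. h t) - (LINT t|Q. poly p (t\<^sup>2))\<bar> \<le> e * measure Q UNIV"
      if p: "\<forall>t\<in>{0..c'}. \<bar>h t - poly p (t\<^sup>2)\<bar> < e" and Q: "integrable Q h" "integrable Q (\<lambda>t. poly p (t\<^sup>2))"
        "AE t in Q. t \<in> {0..c'}" "finite_measure Q" "space Q = UNIV" for e p Q
    proof -
      have "\<bar>(LINT t|Q. h t) - (LINT t|Q. poly p (t\<^sup>2))\<bar> = \<bar>LINT t|Q. h t - poly p (t\<^sup>2)\<bar>"
        using Q by simp
      also have "\<dots> \<le> (LINT t|Q. \<bar>h t - poly p (t\<^sup>2)\<bar>)" by (rule integral_abs_bound)
      also have "\<dots> \<le> (LINT t|Q. e)"
      proof (rule integral_mono_AE)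
        show "AE t in Q. \<bar>h t - poly p (t\<^sup>2)\<bar> \<le> e"
          using Q(3) by eventually_elim (use p in \<open>auto intro: less_imp_le simp del: abs_le_iff\<close>)
      qed (use Q in \<open>auto simp: finite_measure.integrable_const\<close>)
      finally show ?thesis using Q(5) by (simp add: mult.commute)
    qed
    \<comment> \<open>Total mass of both measures, since the uniform error enters both integrals;
      the summand 1 makes it positive.\<close>
    define C where "C = measure \<mu> UNIV + measure \<rho> UNIV + 1"
    have C: "C > 0" unfolding C_def by (auto simp: add_nonneg_pos)
    have "\<bar>integral\<^sup>L \<mu> h - integral\<^sup>L \<rho> h\<bar> \<le> 0 + e" if e: "e > 0" for e
    proof -
      obtain p where p: "\<forall>t\<in>{0..c'}. \<bar>h t - poly p (t\<^sup>2)\<bar> < e / C"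
        using even_poly_uniform[OF h, of "e / C"] e C by auto
      have "\<bar>integral\<^sup>L \<mu> h - integral\<^sup>L \<rho> h\<bar> \<le> e / C * measure \<mu> UNIV + e / C * measure \<rho> UNIV"
        using near[OF p ih(1) polyeq(2) supp1 fin(1) spU(1)] near[OF p ih(2) polyeq(3) supp2 fin(2) spU(2)] polyeq(1)[of p]
        by linarith
      also have "\<dots> \<le> e / C * C" unfolding C_def distrib_left[symmetric]
        using e C unfolding C_def by (intro mult_left_mono) auto
      finally show ?thesis using C by simp
    qed
    then have "\<bar>integral\<^sup>L \<mu> h - integral\<^sup>L \<rho> h\<bar> \<le> 0" by (rule field_le_epsilon)
    then show "integral\<^sup>L \<mu> h = integral\<^sup>L \<rho> h" by simp
  qed
qed

section \<open>Positive operators and their spectral measures\<close>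

locale spectral =
  fixes M :: "'a measure" and V A E
  assumes linV: "lin_sub M V" and res: "is_spectral_resolution M V A E"
    and pos: "\<And>f. f \<in> V \<Longrightarrow> 0 \<le> Re (ip M (A f) f)"
begin

sublocale pvm M V E
  by unfold_locales (use linV res in \<open>auto simp: is_spectral_resolution_def\<close>)

lemma A_sa: "selfadjoint_op M V A" using res by (simp add: is_spectral_resolution_def)
lemmas A_bop = selfadjoint_opD(1)[OF A_sa]
lemmas A_in = bounded_opD(1)[OF A_bop]

lemma rel_id: "v \<in> V \<Longrightarrow> rel complex_of_real v (A v)"
  using res by (simp add: is_spectral_resolution_def)

lemma rel_A: "rel f v y \<Longrightarrow> rel (\<lambda>t. complex_of_real t * f t) v (A y)"
  by (rule rel_comp[OF _ rel_id]) (auto dest: relD)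

lemma funpow_in: "v \<in> V \<Longrightarrow> (A ^^ k) v \<in> V"
  by (induction k) (auto intro: A_in)

lemma rel_pow:
  assumes "v \<in> V"
  shows "rel (\<lambda>t. complex_of_real (t ^ k)) v ((A ^^ k) v)"
proof (induction k)
  case 0 then show ?case using rel_one[OF assms] by simp
next
  case (Suc k) then show ?case using rel_A[OF Suc] by simp
qed

lemma moment_mu:
  assumes "v \<in> V"
  shows "integrable (\<mu> v) (\<lambda>t. t ^ k)" "ip M ((A ^^ k) v) v = of_real (LINT t|\<mu> v. t ^ k)"
proof -
  note R = rel_pow[OF assms, of k] and O = rel_one[OF assms]
  have i: "integrable (\<mu> v) (\<lambda>t. complex_of_real (t ^ k) * cnj 1)"
    by (rule integrable_ip) (use relD[OF R] relD[OF O] in auto)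
  then show "integrable (\<mu> v) (\<lambda>t. t ^ k)" using integrable_Re[OF i] by simp
  have "ip M ((A ^^ k) v) v = ip (\<mu> v) (\<lambda>t. complex_of_real (t ^ k)) (\<lambda>_. 1)" by (rule rel_ip[OF R O])
  then show "ip M ((A ^^ k) v) v = of_real (LINT t|\<mu> v. t ^ k)"
    unfolding ip_def by (simp only: complex_cnj_one mult_1_right integral_complex_of_real)
qed

text \<open>\<open><A y, y>\<close> is the integral of \<open>t\<close> over the measure of
  \<open>y\<close>. It is nonnegative by positivity of \<open>A\<close> and nonpositive by the
  hypothesis on the measure, so the measure sits at 0 and \<open>A y\<close> vanishes.\<close>

lemma nonpos_part_zero:
  assumes y: "y \<in> V" and "AE t in \<mu> y. t \<le> 0"
  shows "AE t in \<mu> y. t = 0" "nrm M (A y) = 0"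
proof -
  have m: "integrable (\<mu> y) (\<lambda>t. t)" "ip M (A y) y = of_real (LINT t|\<mu> y. t)"
    using moment_mu[OF y, of 1] by simp_all
  have "(LINT t|\<mu> y. - t) = 0"
  proof (rule antisym)
    show "(LINT t|\<mu> y. - t) \<le> 0" using pos[OF y] m by simp
    show "0 \<le> (LINT t|\<mu> y. - t)"
      by (rule integral_nonneg_AE) (use assms(2) in auto)
  qed
  moreover have "AE t in \<mu> y. 0 \<le> - t" using assms(2) by eventually_elim simp
  ultimately have "AE t in \<mu> y. - t = 0"
    using m(1) by (subst (asm) integral_nonneg_eq_0_iff_AE) auto
  then show z: "AE t in \<mu> y. t = 0" by eventually_elim simp
  have R: "rel complex_of_real y (A y)" by (rule rel_id[OF y])
  have "nrm M (A y) = nrm (\<mu> y) complex_of_real" using relD(4)[OF R] .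
  also have "\<dots> = 0"
    by (subst nrm_eq_0_iff[OF relD(3)[OF R]]) (use z in \<open>auto elim!: eventually_mono\<close>)
  finally show "nrm M (A y) = 0" .
qed

lemma AE_mu_nonneg:
  assumes v: "v \<in> V"
  shows "AE t in \<mu> v. 0 \<le> t"
proof -
  have R: "rel (\<lambda>t. indicator {..<0} t * 1) v (E {..<0} v)" by (rule rel_E[OF rel_one[OF v]]) auto
  let ?y = "E {..<0} v"
  have AE_iff: "(AE t in \<mu> ?y. P t) \<longleftrightarrow> (AE t in \<mu> v. t < 0 \<longrightarrow> P t)" for P
    unfolding mu_rel[OF R] by (subst AE_density) (auto simp: indicator_def)
  have "AE t in \<mu> ?y. t \<le> 0" unfolding AE_iff by auto
  then have "AE t in \<mu> ?y. t = 0" using v by (intro nonpos_part_zero(1)) (auto intro: E_in)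
  then show ?thesis unfolding AE_iff by eventually_elim auto
qed

text \<open>Used to discard the values of a symbol on the nonpositive axis, a possible atom at 0
  included: \<open>A\<close> annihilates whatever they contribute.\<close>

lemma nonpos_function_zero:
  assumes r: "rel f v y" and "\<And>t. t > 0 \<Longrightarrow> f t = 0"
  shows "nrm M (A y) = 0"
proof (rule nonpos_part_zero(2)[OF relD(2)[OF r]])
  have [measurable]: "f \<in> borel_measurable borel" using relD(6)[OF r] .
  show "AE t in \<mu> y. t \<le> 0"
    unfolding mu_rel[OF r] by (subst AE_density) (use assms(2) in \<open>auto simp: not_le[symmetric]\<close>)
qed

text \<open>The operator inequality \<open>A^2 \<le> C A\<close> for
  \<open>0 \<le> A \<le> C\<close>, obtained from positivity at \<open>y = x - A x / C\<close>:
  expanding \<open><A y, y>\<close> and bounding the cubic term by \<open>C |A x|^2\<close> leaves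
  \<open>|A x|^2 / C \<le> <A x, x>\<close>.\<close>

lemma nrm_A_sq_le:
  assumes C: "C > 0" "\<And>f. f \<in> V \<Longrightarrow> nrm M (A f) \<le> C * nrm M f" and x: "x \<in> V"
  shows "(nrm M (A x))\<^sup>2 \<le> C * Re (ip M (A x) x)"
proof -
  define s where "s = complex_of_real (1 / C)"
  have L: "x \<in> L2 M" "A x \<in> L2 M" "A (A x) \<in> L2 M" using x by (auto intro: VD(1) A_in)
  have sAx: "(\<lambda>z. s * A x z) \<in> V" using x by (intro VD(4) A_in)
  define y where "y = (\<lambda>z. x z - s * A x z)"
  have y: "y \<in> V" unfolding y_def using x sAx by (rule lin_sub_diff[OF V])
  have 1: "AE z in M. A y z = A x z - A (\<lambda>z. s * A x z) z"
    unfolding y_def by (rule bounded_op_diff[OF V A_bop x sAx])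
  have 2: "AE z in M. A (\<lambda>z. s * A x z) z = s * A (A x) z"
    by (rule bounded_opD(3)[OF A_bop A_in[OF x]])
  have 3: "AE z in M. A y z = A x z - s * A (A x) z" using 1 2 by eventually_elim simp
  have "0 \<le> Re (ip M (A y) y)" by (rule pos[OF y])
  also have "ip M (A y) y = ip M (\<lambda>z. A x z - s * A (A x) z) y"
    using 3 y L by (intro ip_cong_AE) (auto intro: VD(1) A_in L2_diff L2_scale)
  also have "\<dots> = ip M (A x) x - cnj s * ip M (A x) (A x) - s * (ip M (A (A x)) x - cnj s * ip M (A (A x)) (A x))"
    unfolding y_def using L
    by (simp add: ip_diff_left ip_diff_right L2_diff L2_scale ip_scale_left ip_scale_right)
  also have "ip M (A (A x)) x = ip M (A x) (A x)"
    using x by (intro selfadjoint_opD(2)[OF A_sa]) (auto intro: A_in)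
  also have "Re (ip M (A x) x - cnj s * ip M (A x) (A x) - s * (ip M (A x) (A x) - cnj s * ip M (A (A x)) (A x))) =
    Re (ip M (A x) x) - 2 / C * (nrm M (A x))\<^sup>2 + (1 / C)\<^sup>2 * Re (ip M (A (A x)) (A x))"
    unfolding s_def ip_self by (simp add: algebra_simps power2_eq_square)
  also have "(1 / C)\<^sup>2 * Re (ip M (A (A x)) (A x)) \<le> (1 / C)\<^sup>2 * (C * (nrm M (A x))\<^sup>2)"
  proof (rule mult_left_mono)
    have "Re (ip M (A (A x)) (A x)) \<le> nrm M (A (A x)) * nrm M (A x)"
      using ip_Cauchy_Schwarz[OF L(3,2)] complex_Re_le_cmod order_trans by blast
    also have "\<dots> \<le> C * nrm M (A x) * nrm M (A x)"
      using C(2)[OF A_in[OF x]] by (intro mult_right_mono) auto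
    finally show "Re (ip M (A (A x)) (A x)) \<le> C * (nrm M (A x))\<^sup>2"
      by (simp add: power2_eq_square mult.assoc)
  qed simp
  also have "(1 / C)\<^sup>2 * (C * (nrm M (A x))\<^sup>2) = 1 / C * (nrm M (A x))\<^sup>2"
    using C(1) by (simp add: power2_eq_square)
  finally have "1 / C * (nrm M (A x))\<^sup>2 \<le> Re (ip M (A x) x)" by simp
  then show ?thesis using C(1) by (simp add: field_simps)
qed

text \<open>The spectrum of \<open>A\<close> lies in \<open>[0, C]\<close>, so that of
  \<open>1 - 2 A / C\<close> lies in \<open>[-1, 1]\<close>. Concretely,
  \<open>A^2 \<le> C A\<close> bounds the quadratic term of the expanded square by the amount that
  the cross term subtracts. No lower bound on \<open>A\<close> other than positivity enters.\<close>

lemma nrm_reflect_le: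
  assumes C: "C > 0" "\<And>f. f \<in> V \<Longrightarrow> nrm M (A f) \<le> C * nrm M f" and x: "x \<in> V"
  shows "nrm M (\<lambda>z. x z - of_real (2 / C) * A x z) \<le> nrm M x"
proof (rule power2_le_imp_le)
  have L: "x \<in> L2 M" "A x \<in> L2 M" using x by (auto intro: VD(1) A_in)
  have "(nrm M (\<lambda>z. x z - of_real (2 / C) * A x z))\<^sup>2 =
      (nrm M x)\<^sup>2 - 2 * Re (ip M x (\<lambda>z. of_real (2 / C) * A x z)) + (nrm M (\<lambda>z. of_real (2 / C) * A x z))\<^sup>2"
    by (rule nrm_diff_sq[OF L(1) L2_scale[OF L(2)]])
  also have "ip M x (\<lambda>z. of_real (2 / C) * A x z) = of_real (2 / C) * ip M (A x) x"
    unfolding ip_scale_right using selfadjoint_opD(2)[OF A_sa x x] by simp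
  also have "(nrm M (\<lambda>z. of_real (2 / C) * A x z))\<^sup>2 = (2 / C)\<^sup>2 * (nrm M (A x))\<^sup>2"
    unfolding nrm_scale norm_of_real power_mult_distrib using C(1) by simp
  also have "Re (of_real (2 / C) * ip M (A x) x) = 2 / C * Re (ip M (A x) x)" by simp
  also have "(2 / C)\<^sup>2 * (nrm M (A x))\<^sup>2 \<le> (2 / C)\<^sup>2 * (C * Re (ip M (A x) x))"
    by (intro mult_left_mono nrm_A_sq_le[OF C x]) auto
  also have "(2 / C)\<^sup>2 * (C * Re (ip M (A x) x)) = 2 * (2 / C * Re (ip M (A x) x))"
    using C(1) by (simp add: power2_eq_square)
  finally show "(nrm M (\<lambda>z. x z - of_real (2 / C) * A x z))\<^sup>2 \<le> (nrm M x)\<^sup>2" by simp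
qed simp

end

section \<open>Transport and averaging estimates\<close>

lemma sum_mult_le_sqrt:
  fixes f g :: "'k \<Rightarrow> complex"
  assumes "finite F"
  shows "(\<Sum>k\<in>F. cmod (f k * g k)) \<le> sqrt (\<Sum>k\<in>F. (cmod (f k))\<^sup>2) * sqrt (\<Sum>k\<in>F. (cmod (g k))\<^sup>2)"
proof -
  have "(\<Sum>k\<in>F. cmod (f k) * cmod (g k))\<^sup>2 \<le> (\<Sum>k\<in>F. (cmod (f k))\<^sup>2) * (\<Sum>k\<in>F. (cmod (g k))\<^sup>2)"
    by (rule Cauchy_Schwarz_ineq_sum)
  then have "sqrt ((\<Sum>k\<in>F. cmod (f k) * cmod (g k))\<^sup>2) \<le> sqrt ((\<Sum>k\<in>F. (cmod (f k))\<^sup>2) * (\<Sum>k\<in>F. (cmod (g k))\<^sup>2))"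
    by (rule real_sqrt_le_mono)
  then show ?thesis by (simp add: real_sqrt_mult norm_mult sum_nonneg)
qed

text \<open>An abstract solution of the Sylvester equation in the form
  \<open>D = (R D + D R') / 2 + <., u> u / \<kappa>\<close>. The index \<open>l\<close> runs through
  test families stable under \<open>R\<close>, and \<open>j\<close> counts the factors
  \<open>R'\<close> to the right of \<open>D\<close>. A supremum over \<open>l\<close> swallows
  \<open>R\<close>; what remains is a telescoping recursion in \<open>j\<close> whose remainder
  decays like \<open>r^J\<close>.\<close>

lemma averaging_bound:
  fixes w :: "'l \<Rightarrow> nat \<Rightarrow> nat \<Rightarrow> complex"
  assumes F: "finite F" and \<kappa>: "\<kappa> > 0" and L0: "l0 \<in> L" and R: "\<And>l. l \<in> L \<Longrightarrow> R l \<in> L"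
    and rec: "\<And>l j k. l \<in> L \<Longrightarrow> k \<in> F \<Longrightarrow>
      of_real \<kappa> * w l j k = of_real (\<kappa> / 2) * w (R l) j k + of_real (\<kappa> / 2) * w l (Suc j) k + \<beta> j k * g l k"
    and g: "\<And>l. l \<in> L \<Longrightarrow> (\<Sum>k\<in>F. (cmod (g l k))\<^sup>2) \<le> G\<^sup>2" and G: "G \<ge> 0"
    and Q: "\<And>l j. l \<in> L \<Longrightarrow> (\<Sum>k\<in>F. cmod (w l j k)) \<le> Q * r ^ j" and r: "0 \<le> r" "r < 1"
    and b: "\<And>j. sqrt (\<Sum>k\<in>F. (cmod (\<beta> j k))\<^sup>2) \<le> b j"
  shows "(\<Sum>k\<in>F. cmod (w l0 0 k)) \<le> 2 * G / \<kappa> * (\<Sum>j<J. b j) + Q * r ^ J"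
proof -
  define s where "s l j = (\<Sum>k\<in>F. cmod (w l j k))" for l j
  define \<tau> where "\<tau> j = (SUP l\<in>L. s l j)" for j
  have bdd: "bdd_above ((\<lambda>l. s l j) ` L)" for j
    by (rule bdd_aboveI[of _ "Q * r ^ j"]) (use Q in \<open>auto simp: s_def\<close>)
  have up: "s l j \<le> \<tau> j" if "l \<in> L" for l j
    unfolding \<tau>_def by (rule cSUP_upper[OF that bdd])
  have step: "s l j \<le> \<tau> j / 2 + \<tau> (Suc j) / 2 + G / \<kappa> * b j" if l: "l \<in> L" for l j
  proof -
    have "cmod (w l j k) \<le> cmod (w (R l) j k) / 2 + cmod (w l (Suc j) k) / 2 + cmod (\<beta> j k * g l k) / \<kappa>"
      if k: "k \<in> F" for k
    proof -
      have "\<kappa> * cmod (w l j k) = cmod (of_real \<kappa> * w l j k)" using \<kappa> by (simp add: norm_mult)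
      also have "\<dots> \<le> cmod (of_real (\<kappa> / 2) * w (R l) j k) + cmod (of_real (\<kappa> / 2) * w l (Suc j) k) + cmod (\<beta> j k * g l k)"
        unfolding rec[OF l k]
        by (rule order_trans[OF norm_triangle_ineq]) (rule add_right_mono[OF norm_triangle_ineq])
      also have "\<dots> = \<kappa> * (cmod (w (R l) j k) / 2 + cmod (w l (Suc j) k) / 2 + cmod (\<beta> j k * g l k) / \<kappa>)"
        using \<kappa> by (simp only: norm_mult norm_of_real) (simp add: field_simps)
      finally show ?thesis using \<kappa> by (rule mult_left_le_imp_le)
    qed
    then have "s l j \<le> (\<Sum>k\<in>F. cmod (w (R l) j k) / 2 + cmod (w l (Suc j) k) / 2 + cmod (\<beta> j k * g l k) / \<kappa>)"
      unfolding s_def by (rule sum_mono)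
    also have "\<dots> = s (R l) j / 2 + s l (Suc j) / 2 + (\<Sum>k\<in>F. cmod (\<beta> j k * g l k)) / \<kappa>"
      unfolding s_def sum.distrib sum_divide_distrib ..
    also have "(\<Sum>k\<in>F. cmod (\<beta> j k * g l k)) \<le> b j * G"
    proof -
      have "(\<Sum>k\<in>F. cmod (\<beta> j k * g l k)) \<le> sqrt (\<Sum>k\<in>F. (cmod (\<beta> j k))\<^sup>2) * sqrt (\<Sum>k\<in>F. (cmod (g l k))\<^sup>2)"
        by (rule sum_mult_le_sqrt[OF F])
      also have "\<dots> \<le> b j * G"
      proof (rule mult_mono[OF b])
        show "sqrt (\<Sum>k\<in>F. (cmod (g l k))\<^sup>2) \<le> G" using g[OF l] G by (intro real_le_lsqrt)
        show "0 \<le> b j" by (rule order_trans[OF _ b]) (simp add: sum_nonneg)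
      qed (simp add: sum_nonneg)
      finally show ?thesis .
    qed
    finally have "s l j \<le> s (R l) j / 2 + s l (Suc j) / 2 + b j * G / \<kappa>"
      using \<kappa> by (simp add: divide_right_mono)
    moreover have "b j * G / \<kappa> = G / \<kappa> * b j" by simp
    ultimately show ?thesis using up[OF R[OF l], of j] up[OF l, of "Suc j"] by linarith
  qed
  have "\<tau> j \<le> \<tau> j / 2 + \<tau> (Suc j) / 2 + G / \<kappa> * b j" for j
    unfolding \<tau>_def[of j] by (rule cSUP_least) (use L0 step in \<open>auto simp: \<tau>_def\<close>)
  moreover have "2 * G / \<kappa> * b j = 2 * (G / \<kappa> * b j)" for j by simp
  \<comment> \<open>The term with \<open>R l\<close> costs one half of \<open>\<tau> j\<close>,
    which moves to the left side; this is possible because \<open>bdd\<close> makes the supremum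
    finite.\<close>
  ultimately have "\<tau> j \<le> \<tau> (Suc j) + 2 * G / \<kappa> * b j" for j by (smt (verit) field_sum_of_halves)
  then have "\<tau> 0 \<le> \<tau> J + 2 * G / \<kappa> * (\<Sum>j<J. b j)"
  proof (induction J)
    case (Suc J)
    have "\<tau> 0 \<le> \<tau> J + 2 * G / \<kappa> * (\<Sum>j<J. b j)" using Suc by blast
    also have "\<tau> J \<le> \<tau> (Suc J) + 2 * G / \<kappa> * b J" by (rule Suc.prems)
    finally show ?case by (simp add: distrib_left)
  qed simp
  also have "\<tau> J \<le> Q * r ^ J"
    unfolding \<tau>_def by (rule cSUP_least) (use L0 Q in \<open>auto simp: s_def\<close>)
  finally show ?thesis using up[OF L0, of 0] by (simp add: s_def)
qed

text \<open>Mass leaves the first coefficients of the vectors \<open>a k\<close> only through the coefficient \<open>0\<close> and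
  the perturbation \<open>\<delta>\<close>.\<close>

lemma transport_bound:
  fixes a \<delta> :: "nat \<Rightarrow> nat \<Rightarrow> complex"
  assumes step: "\<And>k n. a k (Suc n) = a (Suc k) n - \<delta> (Suc k) n" and mm: "m \<le> m'"
  shows "(\<Sum>n<N. (cmod (a m n))\<^sup>2) \<le> (\<Sum>n<N. (cmod (a m' n))\<^sup>2) + (\<Sum>k=m..<m'. (cmod (a k 0))\<^sup>2)
    + 2 * (\<Sum>k=m..<m'. cmod (\<Sum>n<N. cnj (a k (Suc n)) * \<delta> (Suc k) n))"
  using mm
proof (induction m' rule: dec_induct)
  case base then show ?case by simp
next
  case (step m')
  define P where "P k = (\<Sum>n<N. (cmod (a k n))\<^sup>2)" for k
  \<comment> \<open>The square of the defect has the favourable sign and is dropped. The cross term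
    left over is linear in \<open>\<delta>\<close>, as the estimate by linear functionals
    requires.\<close>
  have pt: "(cmod (a k (Suc n)))\<^sup>2 \<le> (cmod (a (Suc k) n))\<^sup>2 - 2 * Re (cnj (a k (Suc n)) * \<delta> (Suc k) n)" for k n
  proof -
    have "(cmod (a (Suc k) n))\<^sup>2 = (cmod (a k (Suc n) + \<delta> (Suc k) n))\<^sup>2" using assms(1)[of k n] by simp
    also have "\<dots> = (cmod (a k (Suc n)))\<^sup>2 + 2 * Re (cnj (a k (Suc n)) * \<delta> (Suc k) n) + (cmod (\<delta> (Suc k) n))\<^sup>2"
      unfolding cmod_power2 by (simp add: power2_eq_square algebra_simps)
    finally show ?thesis by simp
  qed
  have "P m' \<le> (\<Sum>n<Suc N. (cmod (a m' n))\<^sup>2)" unfolding P_def by simp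
  also have "\<dots> = (cmod (a m' 0))\<^sup>2 + (\<Sum>n<N. (cmod (a m' (Suc n)))\<^sup>2)"
    by (rule sum.lessThan_Suc_shift)
  also have "(\<Sum>n<N. (cmod (a m' (Suc n)))\<^sup>2) \<le> (\<Sum>n<N. (cmod (a (Suc m') n))\<^sup>2 - 2 * Re (cnj (a m' (Suc n)) * \<delta> (Suc m') n))"
    by (intro sum_mono pt)
  also have "\<dots> = P (Suc m') - 2 * Re (\<Sum>n<N. cnj (a m' (Suc n)) * \<delta> (Suc m') n)"
    unfolding P_def sum_subtractf sum_distrib_left[symmetric] Re_sum ..
  also have "\<dots> \<le> P (Suc m') + 2 * cmod (\<Sum>n<N. cnj (a m' (Suc n)) * \<delta> (Suc m') n)"
    using abs_Re_le_cmod[of "\<Sum>n<N. cnj (a m' (Suc n)) * \<delta> (Suc m') n"] by linarith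
  finally show ?case using step.IH step.hyps unfolding P_def by (simp add: distrib_left)
qed

text \<open>Dominated convergence for series, uniform in \<open>J\<close>: the geometric majorant
  controls the terms beyond \<open>J0\<close>, and the finitely many others tend to 0 with
  \<open>m\<close>.\<close>

lemma geometric_tail_small:
  fixes t :: "nat \<Rightarrow> nat \<Rightarrow> real"
  assumes t: "\<And>j. t j \<longlonglongrightarrow> 0" and t_le: "\<And>j m. t j m \<le> c * r ^ j" and r: "0 \<le> r" "r < 1" and c: "c \<ge> 0"
    and e: "e > 0"
  shows "\<exists>m0. \<forall>m\<ge>m0. \<forall>J. (\<Sum>j<J. t j m) \<le> (e::real)"
proof -
  have "(\<lambda>J. c * r ^ J / (1 - r)) \<longlonglongrightarrow> c * 0 / (1 - r)"
    using r by (intro tendsto_intros LIMSEQ_power_zero) auto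
  then have "\<forall>\<^sub>F J in sequentially. c * r ^ J / (1 - r) < e / 2"
    using e by (intro order_tendstoD(2)) auto
  then obtain J0 where J0: "c * r ^ J0 / (1 - r) < e / 2" by (auto simp: eventually_sequentially)
  have "(\<lambda>m. \<Sum>j<J0. \<bar>t j m\<bar>) \<longlonglongrightarrow> (\<Sum>j<J0. 0)"
    by (intro tendsto_sum tendsto_rabs_zero t)
  then have "\<forall>\<^sub>F m in sequentially. (\<Sum>j<J0. \<bar>t j m\<bar>) < e / 2"
    using e by (intro order_tendstoD(2)) auto
  then obtain m0 where m0: "\<And>m. m \<ge> m0 \<Longrightarrow> (\<Sum>j<J0. \<bar>t j m\<bar>) < e / 2" by (auto simp: eventually_sequentially)
  have "(\<Sum>j<J. t j m) \<le> e" if m: "m \<ge> m0" for m J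
  proof -
    have pos: "c * r ^ j \<ge> 0" for j using c r by simp
    have "(\<Sum>j<J. t j m) \<le> (\<Sum>j<J. if j < J0 then \<bar>t j m\<bar> else c * r ^ j)"
      using t_le by (intro sum_mono) auto
    also have "\<dots> \<le> (\<Sum>j<J0 + J. if j < J0 then \<bar>t j m\<bar> else c * r ^ j)"
      using pos by (intro sum_mono2) auto
    also have "\<dots> = (\<Sum>j<J0. \<bar>t j m\<bar>) + (\<Sum>i<J. c * r ^ (J0 + i))"
      by (induction J) simp_all
    also have "(\<Sum>i<J. c * r ^ (J0 + i)) = c * r ^ J0 * (\<Sum>i<J. r ^ i)"
      by (simp add: sum_distrib_left power_add mult.assoc)
    also have "c * r ^ J0 * (\<Sum>i<J. r ^ i) \<le> c * r ^ J0 * (1 / (1 - r))"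
    proof (rule mult_left_mono[OF _ pos])
      have "(\<Sum>i<J. r ^ i) = (1 - r ^ J) / (1 - r)" using r by (simp add: sum_gp_strict)
      also have "\<dots> \<le> 1 / (1 - r)" using r by (intro divide_right_mono) auto
      finally show "(\<Sum>i<J. r ^ i) \<le> 1 / (1 - r)" .
    qed
    finally have "(\<Sum>j<J. t j m) \<le> (\<Sum>j<J0. \<bar>t j m\<bar>) + c * r ^ J0 / (1 - r)" by simp
    then show ?thesis using J0 m0[OF m] by linarith
  qed
  then show ?thesis by blast
qed

section \<open>The compressed shift in spectral coordinates\<close>

text \<open>What the datum supplies, on the single space \<open>K\<close>: \<open>\<Psi>\<close>
  enters through the factor \<open>cis (- t)\<close> in \<open>H_act\<close>, and
  \<open>\<Psi>t = 1\<close> through \<open>Ht_even\<close>.\<close>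

locale hankel_spectral = hankel_setup u + S1: spectral circ "hankel_ran u" B E + S2: spectral circ "hankel_ran u" A E2
  for u B E A E2 +
  fixes c :: real
  assumes uK: "u \<in> K"
    and BB: "\<And>x. x \<in> K \<Longrightarrow> AE z in circ. B (B x) z = H (H x) z"
    and AA: "\<And>x. x \<in> K \<Longrightarrow> AE z in circ. A (A x) z = Ht (Ht x) z"
    and Ht_even: "\<And>i. AE z in circ. Ht ((A ^^ (2 * i)) u) z = A ((A ^^ (2 * i)) u) z"
    and H_act: "\<And>f. f \<in> L2 (pvm_measure circ E u) \<Longrightarrow> \<exists>x y z. S1.rel f u x \<and> S1.rel (\<lambda>t. cnj (f t)) u y \<and>
      S1.rel (\<lambda>t. cis (- t)) y z \<and> (AE w in circ. H x w = B z w)"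
    and supp: "AE t in pvm_measure circ E u. t \<in> {0<..c}"
begin

abbreviation \<rho> where "\<rho> \<equiv> pvm_measure circ E u"

lemma K_in_H2: "x \<in> K \<Longrightarrow> x \<in> H2" using K_H2 by blast
lemma K_L2: "x \<in> K \<Longrightarrow> x \<in> L2 circ" using K_in_H2 H2_L2 by blast
lemmas K_add = lin_subD(3)[OF lin_sub_K]
lemmas K_scale = lin_subD(4)[OF lin_sub_K]
lemmas K_diff = lin_sub_diff[OF lin_sub_K]

lemma BB_AA:
  assumes "x \<in> K"
  shows "AE z in circ. B (B x) z = A (A x) z + ip circ x u * u z"
  using BB[OF assms] AA[OF assms] H_sq_eq[OF K_in_H2[OF assms]] by eventually_elim simp

section \<open>From the coordinates of \<open>A\<close> to those of \<open>B\<close>\<close>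

text \<open>The real span of the \<open>A^(2 i) u\<close>, saturated under a.e. equality because
  operator identities hold only almost everywhere. Scalars are real since \<open>Ht\<close>, being
  anti-linear, is to agree with the linear \<open>A\<close> on these vectors.\<close>

inductive even_vec :: "(complex \<Rightarrow> complex) \<Rightarrow> bool" where
  even_pow: "even_vec ((A ^^ (2 * i)) u)"
| even_add: "even_vec x \<Longrightarrow> even_vec y \<Longrightarrow> even_vec (\<lambda>z. x z + y z)"
| even_scale: "even_vec x \<Longrightarrow> even_vec (\<lambda>z. complex_of_real r * x z)"
| even_AE: "even_vec x \<Longrightarrow> y \<in> K \<Longrightarrow> AE z in circ. x z = y z \<Longrightarrow> even_vec y"

lemma even_vec_in: "even_vec x \<Longrightarrow> x \<in> K"
  by (induction rule: even_vec.induct) (auto intro: S2.funpow_in uK K_add K_scale)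

lemma coeff_A_cong:
  assumes "x \<in> K" "y \<in> K" "AE z in circ. x z = y z"
  shows "fourier_coeff (A x) n = fourier_coeff (A y) n"
  by (rule fourier_coeff_cong_AE[OF bounded_op_cong[OF lin_sub_K S2.A_bop assms]])
    (use assms in \<open>auto intro: K_L2 S2.A_in\<close>)

lemma coeff_A_add:
  assumes "x \<in> K" "y \<in> K"
  shows "fourier_coeff (A (\<lambda>z. x z + y z)) n = fourier_coeff (A x) n + fourier_coeff (A y) n"
proof -
  have "fourier_coeff (A (\<lambda>z. x z + y z)) n = fourier_coeff (\<lambda>z. A x z + A y z) n"
    by (rule fourier_coeff_cong_AE[OF bounded_opD(2)[OF S2.A_bop assms]])
      (use assms in \<open>auto intro: K_L2 S2.A_in K_add L2_add\<close>)
  then show ?thesis using assms by (simp add: fourier_coeff_add K_L2 S2.A_in)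
qed

lemma coeff_A_scale:
  assumes "x \<in> K"
  shows "fourier_coeff (A (\<lambda>z. k * x z)) n = k * fourier_coeff (A x) n"
proof -
  have "fourier_coeff (A (\<lambda>z. k * x z)) n = fourier_coeff (\<lambda>z. k * A x z) n"
    by (rule fourier_coeff_cong_AE[OF bounded_opD(3)[OF S2.A_bop assms]])
      (use assms in \<open>auto intro: K_L2 S2.A_in K_scale L2_scale\<close>)
  then show ?thesis by (simp add: fourier_coeff_scale)
qed

text \<open>\<open>ip circ (twist u (Suc n)) x\<close> is the \<open>n\<close>-th coefficient of
  \<open>Ht x\<close>, so this is \<open>Ht x = A x\<close> in coefficients.\<close>

lemma even_vec_coeff: "even_vec x \<Longrightarrow> ip circ (twist u (Suc n)) x = fourier_coeff (A x) (int n)"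
proof (induction rule: even_vec.induct)
  case (even_pow i)
  have i: "(A ^^ (2 * i)) u \<in> K" by (rule S2.funpow_in[OF uK])
  have "ip circ (twist u (Suc n)) ((A ^^ (2 * i)) u) = fourier_coeff (Ht ((A ^^ (2 * i)) u)) (int n)"
    by (rule Ht_coeff[OF K_in_H2[OF i], symmetric])
  also have "\<dots> = fourier_coeff (A ((A ^^ (2 * i)) u)) (int n)"
    by (rule fourier_coeff_cong_AE[OF Ht_even]) (use i in \<open>auto intro: K_L2 S2.A_in H2_L2[OF Ht_H2] K_in_H2\<close>)
  finally show ?case .
next
  case (even_add x y)
  then show ?case using even_vec_in[OF even_add(1)] even_vec_in[OF even_add(2)]
    by (simp add: coeff_A_add ip_add_right twist_L2[OF uL] K_L2)
next
  case (even_scale x r)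
  then show ?case using even_vec_in[OF even_scale(1)] by (simp add: coeff_A_scale ip_scale_right)
next
  case (even_AE x y)
  have x: "x \<in> K" by (rule even_vec_in[OF even_AE(1)])
  have "ip circ (twist u (Suc n)) y = ip circ (twist u (Suc n)) x"
    using even_AE(3) by (intro ip_cong_AE) (auto intro: twist_L2[OF uL] K_L2 x even_AE(2))
  then show ?case using even_AE(4) coeff_A_cong[OF x even_AE(2,3)] by simp
qed

lemma even_vec_real: "even_vec x \<Longrightarrow> Im (ip circ x u) = 0"
proof (induction rule: even_vec.induct)
  case (even_pow i)
  show ?case using S2.moment_mu(2)[OF uK] by simp
next
  case (even_add x y)
  then show ?case using even_vec_in[OF even_add(1)] even_vec_in[OF even_add(2)]
    by (simp add: ip_add_left uL K_L2)
next
  case (even_scale x r)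
  then show ?case by (simp add: ip_scale_left)
next
  case (even_AE x y)
  have x: "x \<in> K" by (rule even_vec_in[OF even_AE(1)])
  have "ip circ y u = ip circ x u"
    using even_AE(3) by (intro ip_cong_AE) (auto intro: uL K_L2 x even_AE(2))
  then show ?case using even_AE(4) by simp
qed

lemma even_vec_AA: "even_vec x \<Longrightarrow> even_vec (A (A x))"
proof (induction rule: even_vec.induct)
  case (even_pow i)
  show ?case using even_vec.even_pow[of "Suc i"] by simp
next
  case (even_add x y)
  have xy: "x \<in> K" "y \<in> K" using even_vec_in even_add by auto
  note in' = S2.A_in[OF xy(1)] S2.A_in[OF xy(2)] S2.A_in[OF K_add[OF xy]]
  have 1: "AE z in circ. A (A (\<lambda>z. x z + y z)) z = A (\<lambda>z. A x z + A y z) z"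
    by (rule bounded_op_cong[OF lin_sub_K S2.A_bop in'(3) K_add[OF in'(1,2)] bounded_opD(2)[OF S2.A_bop xy]])
  have 2: "AE z in circ. A (\<lambda>z. A x z + A y z) z = A (A x) z + A (A y) z"
    by (rule bounded_opD(2)[OF S2.A_bop in'(1,2)])
  have "AE z in circ. A (A x) z + A (A y) z = A (A (\<lambda>z. x z + y z)) z"
    using 1 2 by eventually_elim simp
  then show ?case by (rule even_AE[OF even_vec.even_add[OF even_add(3,4)] S2.A_in[OF in'(3)]])
next
  case (even_scale x r)
  have x: "x \<in> K" using even_vec_in even_scale by auto
  note in' = S2.A_in[OF x] S2.A_in[OF K_scale[OF x]]
  have 1: "AE z in circ. A (A (\<lambda>z. of_real r * x z)) z = A (\<lambda>z. of_real r * A x z) z"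
    by (rule bounded_op_cong[OF lin_sub_K S2.A_bop in'(2) K_scale[OF in'(1)] bounded_opD(3)[OF S2.A_bop x]])
  have 2: "AE z in circ. A (\<lambda>z. of_real r * A x z) z = of_real r * A (A x) z"
    by (rule bounded_opD(3)[OF S2.A_bop in'(1)])
  have "AE z in circ. of_real r * A (A x) z = A (A (\<lambda>z. of_real r * x z)) z"
    using 1 2 by eventually_elim simp
  then show ?case by (rule even_AE[OF even_vec.even_scale[OF even_scale(2)] S2.A_in[OF in'(2)]])
next
  case (even_AE x y)
  have x: "x \<in> K" using even_vec_in even_AE by auto
  have "AE z in circ. A x z = A y z"
    by (rule bounded_op_cong[OF lin_sub_K S2.A_bop x even_AE(2,3)])
  then have "AE z in circ. A (A x) z = A (A y) z"
    by (rule bounded_op_cong[OF lin_sub_K S2.A_bop S2.A_in[OF x] S2.A_in[OF even_AE(2)]])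
  then show ?case by (intro even_vec.even_AE[OF even_AE(4)] S2.A_in even_AE(2))
qed

text \<open>\<open>B^2 x = A^2 x + <x, u> u\<close>, and both summands stay in the real span. The
  powers of \<open>B^2\<close> therefore never leave the vectors on which \<open>Ht\<close> acts as
  \<open>A\<close>.\<close>

lemma even_vec_BB:
  assumes "even_vec x"
  shows "even_vec (B (B x))"
proof (rule even_AE)
  have x: "x \<in> K" by (rule even_vec_in[OF assms])
  have r: "ip circ x u = of_real (Re (ip circ x u))"
    using even_vec_real[OF assms] by (simp add: complex_eq_iff)
  have "even_vec u" using even_pow[of 0] by simp
  then show "even_vec (\<lambda>z. A (A x) z + of_real (Re (ip circ x u)) * u z)"
    by (intro even_add even_scale even_vec_AA assms)
  show "AE z in circ. A (A x) z + complex_of_real (Re (ip circ x u)) * u z = B (B x) z"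
    using BB_AA[OF x] unfolding r[symmetric] by eventually_elim simp
  show "B (B x) \<in> K" using x by (intro S1.A_in)
qed

lemma even_vec_B_pow: "even_vec ((B ^^ (2 * j)) u)"
proof (induction j)
  case 0 then show ?case using even_pow[of 0] by simp
next
  case (Suc j) then show ?case using even_vec_BB by simp
qed

lemma finite_rho: "finite_measure \<rho>" by (rule S1.finite_mu[OF uK])

lemma rel_poly:
  fixes p :: "complex poly"
  shows "S1.rel (\<lambda>t. poly p (complex_of_real (t\<^sup>2))) u (\<lambda>z. \<Sum>j\<le>degree p. coeff p j * (B ^^ (2 * j)) u z)"
proof -
  have "S1.rel (\<lambda>t. \<Sum>j\<le>degree p. coeff p j * complex_of_real (t ^ (2 * j))) u
      (\<lambda>z. \<Sum>j\<le>degree p. coeff p j * (B ^^ (2 * j)) u z)"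
    by (intro S1.rel_sum S1.rel_scale S1.rel_pow uK) auto
  moreover have "poly p (complex_of_real (t\<^sup>2)) = (\<Sum>j\<le>degree p. coeff p j * complex_of_real (t ^ (2 * j)))" for t
    by (simp only: poly_altdef power_mult of_real_power)
  ultimately show ?thesis by simp
qed

text \<open>Anti-linear extension from real to complex coefficients: the left side conjugates the
  scalars, hence \<open>cnj (q j)\<close> under the linear \<open>A\<close>.\<close>

lemma even_poly_coeff:
  fixes q :: "nat \<Rightarrow> complex"
  shows "ip circ (twist u (Suc n)) (\<lambda>z. \<Sum>j\<le>N. q j * (B ^^ (2 * j)) u z) =
    fourier_coeff (A (\<lambda>z. \<Sum>j\<le>N. cnj (q j) * (B ^^ (2 * j)) u z)) (int n)"
proof (induction N)
  case 0
  then show ?case using even_vec_coeff[OF even_vec_B_pow[of 0]] uK by (simp add: coeff_A_scale ip_scale_right)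
next
  case (Suc N)
  have b: "(B ^^ (2 * j)) u \<in> K" for j by (rule S1.funpow_in[OF uK])
  have s: "(\<lambda>z. \<Sum>j\<le>N. r j * (B ^^ (2 * j)) u z) \<in> K" for r :: "nat \<Rightarrow> complex"
    by (intro lin_sub_sum[OF lin_sub_K] K_scale b)
  have sb: "(\<lambda>z. r * (B ^^ (2 * Suc N)) u z) \<in> K" for r by (intro K_scale b)
  show ?case
    unfolding sum.atMost_Suc coeff_A_add[OF s sb] coeff_A_scale[OF b] Suc
      ip_add_right[OF K_L2[OF s] K_L2[OF sb] twist_L2[OF uL]] ip_scale_right even_vec_coeff[OF even_vec_B_pow]
    ..
qed

text \<open>In spectral coordinates \<open>H\<^sub>u S\<close> is the conjugation \<open>g \<mapsto> cnj g\<close> followed by \<open>A\<close>; since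
  \<open>B\<^sup>2 - A\<^sup>2\<close> has rank one and real moments, this passes from \<open>A\<close> to \<open>B\<close> on even polynomials.\<close>

lemma twist_coeff:
  assumes g: "S1.rel g u x" and y: "S1.rel (\<lambda>t. cnj (g t)) u y"
  shows "ip circ (twist u (Suc n)) x = fourier_coeff (A y) (int n)"
proof -
  obtain C where C: "C > 0" "\<And>f. f \<in> K \<Longrightarrow> nrm circ (A f) \<le> C * nrm circ f"
    using bounded_op_bound[OF S2.A_bop] by metis
  define T where "T = nrm circ (twist u (Suc n))"
  have bound: "cmod (ip circ (twist u (Suc n)) x - fourier_coeff (A y) (int n)) \<le> 0 + e" if e: "e > 0" for e
  proof -
    \<comment> \<open>\<open>T\<close> and \<open>C\<close> are Lipschitz constants of the two sides
      in \<open>x\<close> and in \<open>y\<close>.\<close>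
    define d where "d = e / (T + C)"
    have TC: "T + C > 0" unfolding T_def using C(1) by (intro add_nonneg_pos) auto
    then have d: "d > 0" unfolding d_def using e by simp
    have supp': "AE t in \<rho>. t \<in> {0..c}" using supp by eventually_elim auto
    have "g \<in> L2_closure \<rho> (range (\<lambda>p t. poly p (complex_of_real (t\<^sup>2))))"
      using S1.relD(3)[OF g] even_poly_dense[OF S1.sets_mu finite_rho supp'] by simp
    then obtain p where p: "nrm \<rho> (\<lambda>t. g t - poly p (complex_of_real (t\<^sup>2))) < d"
      using d unfolding L2_closure_def by blast
    define N where "N = degree p"
    define xp where "xp = (\<lambda>z. \<Sum>j\<le>N. coeff p j * (B ^^ (2 * j)) u z)"
    define yp where "yp = (\<lambda>z. \<Sum>j\<le>N. cnj (coeff p j) * (B ^^ (2 * j)) u z)"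
    have rx: "S1.rel (\<lambda>t. poly p (complex_of_real (t\<^sup>2))) u xp" unfolding xp_def N_def by (rule rel_poly)
    have "S1.rel (\<lambda>t. \<Sum>j\<le>N. cnj (coeff p j) * complex_of_real (t ^ (2 * j))) u yp"
      unfolding yp_def by (intro S1.rel_sum S1.rel_scale S1.rel_pow uK) auto
    moreover have "(\<Sum>j\<le>N. cnj (coeff p j) * complex_of_real (t ^ (2 * j))) = cnj (poly p (complex_of_real (t\<^sup>2)))" for t
      unfolding N_def by (simp add: poly_altdef power_mult)
    ultimately have ry: "S1.rel (\<lambda>t. cnj (poly p (complex_of_real (t\<^sup>2)))) u yp" by simp
    have dx: "nrm circ (\<lambda>z. x z - xp z) < d" using S1.rel_nrm_diff[OF g rx] p by simp
    have dy: "nrm circ (\<lambda>z. y z - yp z) < d"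
    proof -
      have "nrm circ (\<lambda>z. y z - yp z) = nrm \<rho> (\<lambda>t. cnj (g t - poly p (complex_of_real (t\<^sup>2))))"
        using S1.rel_nrm_diff[OF y ry] by simp
      then show ?thesis using p by (simp only: nrm_cnj)
    qed
    have in': "x \<in> K" "xp \<in> K" "y \<in> K" "yp \<in> K"
      using S1.relD(2)[OF g] S1.relD(2)[OF rx] S1.relD(2)[OF y] S1.relD(2)[OF ry] by auto
    have eq: "ip circ (twist u (Suc n)) xp = fourier_coeff (A yp) (int n)"
      unfolding xp_def yp_def by (rule even_poly_coeff)
    have 1: "cmod (ip circ (twist u (Suc n)) x - ip circ (twist u (Suc n)) xp) \<le> T * d"
    proof -
      have "cmod (ip circ (twist u (Suc n)) x - ip circ (twist u (Suc n)) xp) =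
          cmod (ip circ (twist u (Suc n)) (\<lambda>z. x z - xp z))"
        using in' by (simp add: ip_diff_right twist_L2[OF uL] K_L2)
      also have "\<dots> \<le> T * nrm circ (\<lambda>z. x z - xp z)"
        unfolding T_def using in' by (intro ip_Cauchy_Schwarz twist_L2 uL L2_diff K_L2)
      also have "\<dots> \<le> T * d" using dx unfolding T_def by (intro mult_left_mono) auto
      finally show ?thesis .
    qed
    have 2: "cmod (fourier_coeff (A yp) (int n) - fourier_coeff (A y) (int n)) \<le> C * d"
    proof -
      have L: "A yp \<in> L2 circ" "A y \<in> L2 circ" using in' by (auto intro: K_L2 S2.A_in)
      have "cmod (fourier_coeff (A yp) (int n) - fourier_coeff (A y) (int n)) =
          cmod (fourier_coeff (\<lambda>z. A yp z - A y z) (int n))"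
        using L by (simp add: fourier_coeff_diff)
      also have "\<dots> \<le> nrm circ (\<lambda>z. A yp z - A y z)"
      proof -
        have "(cmod (fourier_coeff (\<lambda>z. A yp z - A y z) (int n)))\<^sup>2 \<le> (nrm circ (\<lambda>z. A yp z - A y z))\<^sup>2"
          using fourier_Bessel[OF L2_diff[OF L], of "{int n}"] by simp
        then show ?thesis by (rule power2_le_imp_le) simp
      qed
      also have "\<dots> = nrm circ (A (\<lambda>z. yp z - y z))"
        by (rule nrm_bounded_op_diff[OF lin_sub_K S2.A_bop in'(4,3)])
      also have "\<dots> \<le> C * nrm circ (\<lambda>z. yp z - y z)" by (intro C(2) K_diff in')
      also have "\<dots> \<le> C * d" using dy C(1) nrm_minus_commute[of circ yp y] by (intro mult_left_mono) auto
      finally show ?thesis .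
    qed
    have "cmod (ip circ (twist u (Suc n)) x - fourier_coeff (A y) (int n)) \<le> T * d + C * d"
      using norm_triangle_mono[OF 1 2] eq by simp
    also have "\<dots> = e" using TC unfolding d_def distrib_right[symmetric] by simp
    finally show ?thesis by simp
  qed
  have "cmod (ip circ (twist u (Suc n)) x - fourier_coeff (A y) (int n)) \<le> 0"
    by (rule field_le_epsilon) (rule bound)
  then show ?thesis by simp
qed

end

section \<open>The wave packets\<close>

lemma tail_bound:
  fixes f :: "nat \<Rightarrow> real"
  assumes f: "\<And>k. f k \<ge> 0" and bd: "\<And>n. (\<Sum>k<n. f k) \<le> C"
  defines "T \<equiv> \<lambda>m. \<Sum>i. f (i + m)"
  shows "f \<longlonglongrightarrow> 0" "T \<longlonglongrightarrow> 0" "(\<Sum>k=m..<m'. f k) \<le> T m" "0 \<le> T m" "T m \<le> C"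
proof -
  have s: "summable f" by (rule summableI_nonneg_bounded[OF f bd])
  have sm: "summable (\<lambda>i. f (i + m))" for m using s by (rule summable_ignore_initial_segment)
  show "f \<longlonglongrightarrow> 0" by (rule summable_LIMSEQ_zero[OF s])
  have T: "T m = suminf f - (\<Sum>k<m. f k)" for m
    unfolding T_def by (rule suminf_minus_initial_segment[OF s])
  have "(\<lambda>m. suminf f - (\<Sum>k<m. f k)) \<longlonglongrightarrow> suminf f - suminf f"
    by (intro tendsto_diff tendsto_const summable_LIMSEQ s)
  then show "T \<longlonglongrightarrow> 0" unfolding T[abs_def] by simp
  show "0 \<le> T m" unfolding T_def by (rule suminf_nonneg[OF sm f])
  have "suminf f \<le> C" by (rule suminf_le_const[OF s bd])
  then show "T m \<le> C" unfolding T using sum_nonneg[of "{..<m}" f] f by simp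
  have "(\<Sum>k=m..<m'. f k) \<le> (\<Sum>k<m + m'. f k) - (\<Sum>k<m. f k)"
  proof -
    have "(\<Sum>k=m..<m'. f k) \<le> (\<Sum>k=m..<m+m'. f k)" using f by (intro sum_mono2) auto
    also have "\<dots> = (\<Sum>k<m + m'. f k) - (\<Sum>k<m. f k)"
      using sum.atLeastLessThan_concat[of 0 m "m + m'" f] by (simp add: lessThan_atLeast0)
    finally show ?thesis .
  qed
  also have "\<dots> \<le> T m" unfolding T using sum_le_suminf[OF s, of "{..<m + m'}"] f by simp
  finally show "(\<Sum>k=m..<m'. f k) \<le> T m" .
qed

text \<open>\<open>window\<close> is the Bessel bound for the exponentials cut to
  \<open>\<Delta>\<close>. The two conditions on \<open>\<kappa>\<close> serve the two operators:
  \<open>2 * b \<le> \<kappa>\<close> keeps \<open>1 - 2 t / \<kappa>\<close> nonnegative for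
  \<open>t\<close> in \<open>\<Delta>\<close>, and the norm bound makes
  \<open>1 - 2 A / \<kappa>\<close> a contraction.\<close>

locale hankel_window = hankel_spectral u B E A E2 c for u B E A E2 c +
  fixes \<Delta> :: "real set" and a b C \<kappa> :: real
  assumes \<Delta>[measurable]: "\<Delta> \<in> sets borel" and sub: "\<Delta> \<subseteq> {a..b}" and ab: "0 < a" "a \<le> b"
    and C: "C \<ge> 0" and window: "\<And>F (q :: nat \<Rightarrow> complex). finite F \<Longrightarrow>
      (nrm (pvm_measure circ E u) (\<lambda>t. \<Sum>k\<in>F. q k * (indicator \<Delta> t * cis (real k * t))))\<^sup>2 \<le> C * (\<Sum>k\<in>F. (cmod (q k))\<^sup>2)"
    and \<kappa>: "2 * b \<le> \<kappa>" "\<And>f. f \<in> hankel_ran u \<Longrightarrow> nrm circ (A f) \<le> \<kappa> * nrm circ f"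
begin

text \<open>The value of \<open>1 - 2 t / \<kappa>\<close> at the left end \<open>t = a\<close>, its
  maximum on \<open>{a..b}\<close>.\<close>

definition r where "r = 1 - 2 * a / \<kappa>"

lemma \<kappa>_pos: "\<kappa> > 0" using \<kappa>(1) ab by linarith

lemma r_bounds: "0 \<le> r" "r < 1"
  using \<kappa>_pos \<kappa>(1) ab unfolding r_def by (auto simp: field_simps)

definition chr where "chr k t = (indicator \<Delta> t * cis (real k * t) :: complex)"
text \<open>The symbol of the inverse of \<open>B\<close> times the \<open>j\<close>-th power of
  \<open>R' = 1 - 2 B / \<kappa>\<close>, cut to the window, where \<open>t \<ge> a\<close> keeps
  \<open>1 / t\<close> bounded.\<close>

definition wt where "wt j t = (indicator \<Delta> t * complex_of_real (1 / t * (1 - 2 * t / \<kappa>) ^ j) :: complex)"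

lemma measurable_chr [measurable]: "chr k \<in> borel_measurable borel"
  unfolding chr_def[abs_def] by measurable

lemma measurable_wt [measurable]: "wt j \<in> borel_measurable borel"
  unfolding wt_def[abs_def] by measurable

lemma cmod_chr_le: "cmod (chr k t) \<le> 1"
  by (simp add: chr_def norm_mult indicator_def)

lemma cmod_wt_le: "cmod (wt j t) \<le> 1 / a * r ^ j"
proof (cases "t \<in> \<Delta>")
  case True
  then have t: "a \<le> t" "t \<le> b" using sub by auto
  have "2 * t / \<kappa> \<le> 1" using t \<kappa>(1) \<kappa>_pos by (simp add: field_simps)
  moreover have "2 * a / \<kappa> \<le> 2 * t / \<kappa>" using t \<kappa>_pos by (simp add: divide_right_mono)
  ultimately have "\<bar>1 - 2 * t / \<kappa>\<bar> \<le> r" unfolding r_def by auto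
  then have "\<bar>1 - 2 * t / \<kappa>\<bar> ^ j \<le> r ^ j" by (intro power_mono) auto
  moreover have "\<bar>1 / t\<bar> \<le> 1 / a" using t ab by (simp add: frac_le)
  ultimately have "\<bar>1 / t\<bar> * \<bar>1 - 2 * t / \<kappa>\<bar> ^ j \<le> 1 / a * r ^ j"
    using ab by (intro mult_mono) auto
  moreover have "cmod (wt j t) = \<bar>1 / t\<bar> * \<bar>1 - 2 * t / \<kappa>\<bar> ^ j"
    unfolding wt_def using True by (simp only: norm_mult norm_of_real abs_mult power_abs) simp
  ultimately show ?thesis by simp
next
  case False
  then show ?thesis using ab r_bounds by (simp add: wt_def)
qed

lemma cnj_wt: "cnj (wt j t) = wt j t"
  by (cases "t \<in> \<Delta>") (simp_all add: wt_def)

lemma chr_L2: "chr k \<in> L2 \<rho>"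
  by (rule L2_bounded[OF finite_rho, of _ 1]) (auto simp: cmod_chr_le)

lemma wt_L2: "wt j \<in> L2 \<rho>"
  by (rule L2_bounded[OF finite_rho, of _ "1 / a * r ^ j"]) (simp, intro AE_I2 cmod_wt_le)

definition hh where "hh j k t = wt j t * chr k t"

lemma hh_L2: "hh j k \<in> L2 \<rho>"
  unfolding hh_def[abs_def]
  by (rule L2_bounded_mult[OF chr_L2, of _ "1 / a * r ^ j"]) (simp, intro AE_I2 cmod_wt_le)

text \<open>The vector obtained from \<open>e k\<close> by inverting \<open>B\<close> on the window
  and applying \<open>R' = 1 - 2 B / \<kappa>\<close> \<open>j\<close> times.\<close>

definition X where "X j k = (SOME x. S1.rel (hh j k) u x)"

lemma X_rel: "S1.rel (hh j k) u (X j k)"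
proof -
  \<comment> \<open>\<open>H_act\<close> asserts in particular that every square-integrable symbol
    can be integrated against \<open>u\<close>.\<close>
  have "\<exists>x. S1.rel (hh j k) u x" using H_act[OF hh_L2] by blast
  then show ?thesis unfolding X_def by (rule someI_ex)
qed

lemma X_in: "X j k \<in> K" by (rule S1.relD(2)[OF X_rel])

text \<open>The vector with symbol \<open>chr k\<close>, written through \<open>X 0 k\<close> so
  that \<open>d 0 k\<close> is literally \<open>e k - A (X 0 k)\<close>.\<close>

definition e where "e k = B (X 0 k)"

lemma e_rel: "S1.rel (chr k) u (e k)"
proof -
  have eq: "complex_of_real t * hh 0 k t = chr k t" for t
  proof (cases "t \<in> \<Delta>")
    case True
    then have "t \<noteq> 0" using sub ab by auto
    then show ?thesis by (simp add: hh_def wt_def chr_def indicator_def field_simps)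
  qed (simp add: hh_def chr_def)
  show ?thesis using S1.rel_A[OF X_rel[of 0 k]] unfolding e_def eq .
qed

lemma e_in: "e k \<in> K" by (rule S1.relD(2)[OF e_rel])

text \<open>The operator \<open>D = B - A\<close> at \<open>X j k\<close>; raising \<open>j\<close>
  composes \<open>D\<close> with \<open>R'\<close> on the right.\<close>

definition d where "d j k = (\<lambda>z. B (X j k) z - A (X j k) z)"

lemma d_in: "d j k \<in> K"
  unfolding d_def by (intro K_diff S1.A_in S2.A_in X_in)

text \<open>This is \<open>B = \<kappa> / 2 * (1 - R')\<close> at \<open>X j k\<close>, as
  \<open>R'\<close> takes \<open>X j k\<close> to \<open>X (Suc j) k\<close>. It expresses
  \<open>D B\<close> at \<open>X j k\<close> by consecutive terms of the sequence
  \<open>d\<close>.\<close>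

lemma B_X: "AE z in circ. B (X j k) z = of_real (\<kappa> / 2) * (X j k z - X (Suc j) k z)"
proof -
  have eq: "of_real (\<kappa> / 2) * (hh j k t - hh (Suc j) k t) = complex_of_real t * hh j k t" for t
  proof -
    have w: "\<kappa> / 2 * (1 / t * (1 - 2 * t / \<kappa>) ^ j - 1 / t * (1 - 2 * t / \<kappa>) ^ Suc j) = t * (1 / t * (1 - 2 * t / \<kappa>) ^ j)"
      using \<kappa>_pos by (cases "t = 0") (auto simp: field_simps)
    have "of_real (\<kappa> / 2) * (wt j t - wt (Suc j) t) = indicator \<Delta> t *
        complex_of_real (\<kappa> / 2 * (1 / t * (1 - 2 * t / \<kappa>) ^ j - 1 / t * (1 - 2 * t / \<kappa>) ^ Suc j))"
      unfolding wt_def of_real_mult[of "\<kappa> / 2"] of_real_diff by (simp only: right_diff_distrib mult.left_commute)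
    also have "\<dots> = complex_of_real t * wt j t" unfolding w wt_def of_real_mult[of t] by (simp only: mult.left_commute)
    finally show ?thesis unfolding hh_def by (simp only: left_diff_distrib[symmetric] mult.assoc[symmetric])
  qed
  have "S1.rel (\<lambda>t. of_real (\<kappa> / 2) * (hh j k t - hh (Suc j) k t)) u (\<lambda>z. of_real (\<kappa> / 2) * (X j k z - X (Suc j) k z))"
    by (intro S1.rel_scale S1.rel_diff X_rel)
  then have "S1.rel (\<lambda>t. complex_of_real t * hh j k t) u (\<lambda>z. of_real (\<kappa> / 2) * (X j k z - X (Suc j) k z))"
    unfolding eq .
  with S1.rel_A[OF X_rel] show ?thesis by (rule S1.rel_unique)
qed

text \<open>The Sylvester equation \<open>A D + D B = \<langle>\<cdot>, u\<rangle> u\<close> for \<open>D = B - A\<close>, evaluated at \<open>X j k\<close>.\<close>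

lemma Sylvester:
  "AE z in circ. A (d j k) z + of_real (\<kappa> / 2) * (d j k z - d (Suc j) k z) = ip circ (X j k) u * u z"
proof -
  let ?x = "X j k" and ?y = "X (Suc j) k"
  let ?w = "\<lambda>z. of_real (\<kappa> / 2) * (?x z - ?y z)"
  note xy = X_in[of j k] X_in[of "Suc j" k]
  have w: "(\<lambda>z. ?x z - ?y z) \<in> K" "?w \<in> K" by (intro K_diff K_scale X_in)+
  have lin: "AE z in circ. P (B ?x) z = of_real (\<kappa> / 2) * (P ?x z - P ?y z)"
    if P: "bounded_op circ K P" for P
  proof -
    have 1: "AE z in circ. P (B ?x) z = P ?w z"
      by (rule bounded_op_cong[OF lin_sub_K P S1.A_in[OF xy(1)] w(2) B_X])
    have 2: "AE z in circ. P ?w z = of_real (\<kappa> / 2) * P (\<lambda>z. ?x z - ?y z) z"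
      by (rule bounded_opD(3)[OF P w(1)])
    have 3: "AE z in circ. P (\<lambda>z. ?x z - ?y z) z = P ?x z - P ?y z"
      by (rule bounded_op_diff[OF lin_sub_K P xy])
    show ?thesis using 1 2 3 by eventually_elim simp
  qed
  have "AE z in circ. A (d j k) z = A (B ?x) z - A (A ?x) z"
    unfolding d_def by (rule bounded_op_diff[OF lin_sub_K S2.A_bop S1.A_in[OF xy(1)] S2.A_in[OF xy(1)]])
  then show ?thesis
    using lin[OF S1.A_bop] lin[OF S2.A_bop] BB_AA[OF xy(1)]
  proof eventually_elim
    case (elim z)
    \<comment> \<open>The left side is \<open>D B\<close> at \<open>X j k\<close>. Together with
      \<open>A D\<close> the mixed terms \<open>A (B x)\<close> cancel and \<open>B^2 - A^2\<close>
      remains.\<close>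
    have h: "of_real (\<kappa> / 2) * (d j k z - d (Suc j) k z) = B (B ?x) z - A (B ?x) z"
      unfolding elim(2,3) d_def right_diff_distrib by simp
    show ?case unfolding h elim(1) using elim(4) by simp
  qed
qed

definition \<beta> where "\<beta> j k = ip circ (X j k) u"

text \<open>Up to conjugation, \<open>\<beta> j k\<close> is the coefficient of the fixed function
  \<open>wt j\<close> against the Bessel sequence \<open>chr k\<close>. This makes it
  square-summable in \<open>k\<close>.\<close>

lemma cmod_\<beta>: "cmod (\<beta> j k) = cmod (ip \<rho> (wt j) (chr k))"
proof -
  have "\<beta> j k = ip \<rho> (hh j k) (\<lambda>_. 1)"
    unfolding \<beta>_def by (rule S1.rel_ip[OF X_rel S1.rel_one[OF uK]])
  also have "\<dots> = ip \<rho> (chr k) (wt j)"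
    unfolding ip_def hh_def cnj_wt by (simp add: mult.commute)
  finally show ?thesis by (simp add: ip_commute[of \<rho> "chr k"])
qed

definition M1 where "M1 = 1 / a * nrm \<rho> (\<lambda>_. 1)"

lemma nrm_bounded_le:
  assumes "f \<in> L2 \<rho>" "\<And>t. cmod (f t) \<le> Q" "Q \<ge> 0"
  shows "nrm \<rho> f \<le> Q * nrm \<rho> (\<lambda>_. 1)"
proof -
  have "(\<integral>t. (cmod (f t))\<^sup>2 \<partial>\<rho>) \<le> (\<integral>t. Q\<^sup>2 * (cmod 1)\<^sup>2 \<partial>\<rho>)"
    by (rule integral_mono) (use assms finite_rho in \<open>auto simp: L2_integrable_sq finite_measure.integrable_const intro: power_mono\<close>)
  then have "(nrm \<rho> f)\<^sup>2 \<le> (Q * nrm \<rho> (\<lambda>_. 1))\<^sup>2"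
    unfolding power_mult_distrib nrm_sq by (simp add: mult.commute)
  then show ?thesis by (rule power2_le_imp_le) (use assms in auto)
qed

lemma nrm_wt: "nrm \<rho> (wt j) \<le> M1 * r ^ j"
  using nrm_bounded_le[OF wt_L2 cmod_wt_le] ab r_bounds by (simp add: M1_def mult_ac)

lemma nrm_X: "nrm circ (X j k) \<le> M1 * r ^ j"
proof -
  have "nrm circ (X j k) = nrm \<rho> (hh j k)" by (rule S1.relD(4)[OF X_rel])
  also have "\<dots> \<le> (1 / a * r ^ j) * nrm \<rho> (\<lambda>_. 1)"
  proof (rule nrm_bounded_le[OF hh_L2])
    show "cmod (hh j k t) \<le> 1 / a * r ^ j" for t
    proof -
      have "cmod (wt j t) * cmod (chr k t) \<le> (1 / a * r ^ j) * 1"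
        using ab r_bounds by (intro mult_mono cmod_wt_le cmod_chr_le) auto
      then show ?thesis by (simp add: hh_def norm_mult)
    qed
  qed (use ab r_bounds in auto)
  finally show ?thesis by (simp add: M1_def mult_ac)
qed

lemma M1_nonneg: "0 \<le> M1" unfolding M1_def using ab by simp

text \<open>Summability in \<open>k\<close> comes from the window and decay in \<open>j\<close> from
  the norm of \<open>wt j\<close>; the estimate of the defect needs both at once.\<close>

lemma Bessel_\<beta>:
  assumes "finite F"
  shows "(\<Sum>k\<in>F. (cmod (\<beta> j k))\<^sup>2) \<le> C * (M1 * r ^ j)\<^sup>2"
proof -
  have "(\<Sum>k\<in>F. (cmod (ip \<rho> (wt j) (chr k)))\<^sup>2) \<le> C * (nrm \<rho> (wt j))\<^sup>2"
    by (rule Bessel_dual[OF assms chr_L2 wt_L2 C]) (use window[OF assms] in \<open>simp add: chr_def\<close>)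
  also have "\<dots> \<le> C * (M1 * r ^ j)\<^sup>2"
    by (intro mult_left_mono power_mono nrm_wt C) auto
  finally show ?thesis by (simp add: cmod_\<beta>)
qed

lemma Bessel_e:
  assumes F: "finite F" and x: "x \<in> L2 circ"
  shows "(\<Sum>k\<in>F. (cmod (ip circ x (e k)))\<^sup>2) \<le> C * (nrm circ x)\<^sup>2"
proof (rule Bessel_dual[OF F _ x C])
  show "e k \<in> L2 circ" for k by (rule K_L2[OF e_in])
  fix q :: "nat \<Rightarrow> complex"
  show "(nrm circ (\<lambda>t. \<Sum>k\<in>F. q k * e k t))\<^sup>2 \<le> C * (\<Sum>k\<in>F. (cmod (q k))\<^sup>2)"
  proof (cases "F = {}")
    case False
    have "S1.rel (\<lambda>t. \<Sum>k\<in>F. q k * chr k t) u (\<lambda>z. \<Sum>k\<in>F. q k * e k z)"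
      by (intro S1.rel_sum F False S1.rel_scale e_rel)
    from S1.relD(4)[OF this] show ?thesis using window[OF F] by (simp add: chr_def)
  qed simp
qed

section \<open>One step of the backward shift\<close>

definition ec where "ec k n = fourier_coeff (e k) (int n)"
definition dc where "dc k n = fourier_coeff (d 0 k) (int n)"

text \<open>With \<open>x\<close> of symbol \<open>cnj (hh 0 (Suc k))\<close>, the factor
  \<open>cis (- t)\<close> from \<open>\<Psi>\<close> lowers the exponent and gives
  \<open>H x = e k\<close>. The backward shift of \<open>H x\<close> is \<open>Ht x\<close>, which
  equals \<open>A (X 0 (Suc k))\<close>, that is, \<open>e (Suc k) - d 0 (Suc k)\<close>.\<close>

lemma ec_step: "ec k (Suc n) = ec (Suc k) n - dc (Suc k) n"
proof -
  \<comment> \<open>Conjugated in advance, since both \<open>H\<close> and \<open>Ht\<close>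
    conjugate the symbol before acting.\<close>
  define g where "g t = cnj (hh 0 (Suc k) t)" for t
  have gL: "g \<in> L2 \<rho>" unfolding g_def[abs_def] by (intro L2_cnj hh_L2)
  obtain x y z where R: "S1.rel g u x" "S1.rel (\<lambda>t. cnj (g t)) u y" "S1.rel (\<lambda>t. cis (- t)) y z"
     and Hx: "AE w in circ. H x w = B z w" using H_act[OF gL] by blast
  have in': "x \<in> K" "y \<in> K" "z \<in> K" using S1.relD(2)[OF R(1)] S1.relD(2)[OF R(2)] S1.relD(2)[OF R(3)] .
  have y: "AE w in circ. y w = X 0 (Suc k) w"
    using R(2) X_rel[of 0 "Suc k"] unfolding g_def complex_cnj_cnj by (rule S1.rel_unique)
  have "complex_of_real t * (cis (- t) * cnj (g t)) = chr k t" for t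
  proof (cases "t \<in> \<Delta>")
    case True
    then have t: "t \<noteq> 0" using sub ab by auto
    have "cis (- t) * cis (real (Suc k) * t) = cis (real k * t)"
      unfolding cis_mult by (rule arg_cong[of _ _ cis]) (simp add: algebra_simps)
    then show ?thesis using True t
      by (simp add: g_def hh_def wt_def chr_def indicator_def mult.left_commute)
  qed (simp add: g_def hh_def chr_def)
  then have "S1.rel (chr k) u (B z)" using S1.rel_A[OF S1.rel_comp[OF R(2,3)]] by simp
  then have Bz: "AE w in circ. B z w = e k w" using e_rel by (rule S1.rel_unique)
  have He: "AE w in circ. e k w = H x w" using Hx Bz by eventually_elim simp
  have "ec k (Suc n) = fourier_coeff (H x) (int (Suc n))"
    unfolding ec_def by (rule fourier_coeff_cong_AE[OF He K_L2[OF e_in] H2_L2[OF H_H2[OF K_in_H2[OF in'(1)]]]])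
  also have "\<dots> = ip circ (twist u (Suc n)) x" by (rule H_coeff[OF K_in_H2[OF in'(1)]])
  also have "\<dots> = fourier_coeff (A y) (int n)" by (rule twist_coeff[OF R(1,2)])
  also have "\<dots> = fourier_coeff (A (X 0 (Suc k))) (int n)" by (rule coeff_A_cong[OF in'(2) X_in y])
  also have "\<dots> = ec (Suc k) n - dc (Suc k) n"
    unfolding ec_def dc_def d_def e_def
      fourier_coeff_diff[OF K_L2[OF S1.A_in[OF X_in]] K_L2[OF S2.A_in[OF X_in]]] by simp
  finally show ?thesis .
qed

section \<open>Testing the defect against Bessel families\<close>

text \<open>These families play the role of the pairings with a Bessel sequence with bound
  \<open>C\<close>. Bounding the sum of \<open>|l k (d 0 k)|\<close> uniformly over them is a dual
  form of a trace-norm estimate. Invariance under a.e. equality is demanded because the vectors are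
  functions.\<close>

definition functionals where
  "functionals F = {l :: nat \<Rightarrow> (complex \<Rightarrow> complex) \<Rightarrow> complex.
     (\<forall>k. \<forall>x\<in>K. \<forall>y\<in>K. (AE z in circ. x z = y z) \<longrightarrow> l k x = l k y) \<and>
     (\<forall>k. \<forall>x\<in>K. \<forall>y\<in>K. l k (\<lambda>z. x z + y z) = l k x + l k y) \<and>
     (\<forall>k. \<forall>x\<in>K. \<forall>q. l k (\<lambda>z. q * x z) = q * l k x) \<and>
     (\<forall>x\<in>K. (\<Sum>k\<in>F. (cmod (l k x))\<^sup>2) \<le> C * (nrm circ x)\<^sup>2)}"

lemma functionalsD:
  assumes "l \<in> functionals F"
  shows "x \<in> K \<Longrightarrow> y \<in> K \<Longrightarrow> AE z in circ. x z = y z \<Longrightarrow> l k x = l k y"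
    "x \<in> K \<Longrightarrow> y \<in> K \<Longrightarrow> l k (\<lambda>z. x z + y z) = l k x + l k y"
    "x \<in> K \<Longrightarrow> l k (\<lambda>z. q * x z) = q * l k x"
    "x \<in> K \<Longrightarrow> (\<Sum>k\<in>F. (cmod (l k x))\<^sup>2) \<le> C * (nrm circ x)\<^sup>2"
  using assms unfolding functionals_def by blast+

lemma functionals_diff:
  assumes "l \<in> functionals F" "x \<in> K" "y \<in> K"
  shows "l k (\<lambda>z. x z - y z) = l k x - l k y"
  using functionalsD(2)[OF assms(1,2) K_scale[OF assms(3), of "-1"]] functionalsD(3)[OF assms(1,3), of k "-1"] by simp

text \<open>The contraction \<open>R = 1 - 2 A / \<kappa>\<close>, a reflection if
  \<open>A / \<kappa>\<close> were a projection.\<close>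

definition reflect where "reflect x = (\<lambda>z. x z - of_real (2 / \<kappa>) * A x z)"

lemma reflect_in: "x \<in> K \<Longrightarrow> reflect x \<in> K"
  unfolding reflect_def by (intro K_diff K_scale S2.A_in)

lemma nrm_reflect: "x \<in> K \<Longrightarrow> nrm circ (reflect x) \<le> nrm circ x"
  unfolding reflect_def by (rule S2.nrm_reflect_le[OF \<kappa>_pos \<kappa>(2)])

text \<open>Composition with a contraction preserves the Bessel bound with the same
  \<open>C\<close>; without this stability the supremum in \<open>averaging_bound\<close> could not
  absorb \<open>R\<close>.\<close>

lemma functionals_reflect:
  assumes l: "l \<in> functionals F"
  shows "(\<lambda>k x. l k (reflect x)) \<in> functionals F"
proof -
  have 1: "l k (reflect x) = l k (reflect y)" if "x \<in> K" "y \<in> K" "AE z in circ. x z = y z" for k x y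
  proof (rule functionalsD(1)[OF l reflect_in[OF that(1)] reflect_in[OF that(2)]])
    show "AE z in circ. reflect x z = reflect y z"
      using that(3) bounded_op_cong[OF lin_sub_K S2.A_bop that] by eventually_elim (simp add: reflect_def)
  qed
  have 2: "l k (reflect (\<lambda>z. x z + y z)) = l k (reflect x) + l k (reflect y)" if "x \<in> K" "y \<in> K" for k x y
  proof -
    have "l k (reflect (\<lambda>z. x z + y z)) = l k (\<lambda>z. reflect x z + reflect y z)"
    proof (rule functionalsD(1)[OF l reflect_in[OF K_add[OF that]] K_add[OF reflect_in[OF that(1)] reflect_in[OF that(2)]]])
      show "AE z in circ. reflect (\<lambda>z. x z + y z) z = reflect x z + reflect y z"
        using bounded_opD(2)[OF S2.A_bop that] by eventually_elim (simp add: reflect_def algebra_simps add_divide_distrib)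
    qed
    also have "\<dots> = l k (reflect x) + l k (reflect y)" by (intro functionalsD(2)[OF l] reflect_in that)
    finally show ?thesis .
  qed
  have 3: "l k (reflect (\<lambda>z. q * x z)) = q * l k (reflect x)" if "x \<in> K" for k x q
  proof -
    have "l k (reflect (\<lambda>z. q * x z)) = l k (\<lambda>z. q * reflect x z)"
    proof (rule functionalsD(1)[OF l reflect_in[OF K_scale[OF that]] K_scale[OF reflect_in[OF that]]])
      show "AE z in circ. reflect (\<lambda>z. q * x z) z = q * reflect x z"
        using bounded_opD(3)[OF S2.A_bop that, of q] by eventually_elim (simp add: reflect_def algebra_simps)
    qed
    also have "\<dots> = q * l k (reflect x)" by (intro functionalsD(3)[OF l] reflect_in that)
    finally show ?thesis .
  qed
  have 4: "(\<Sum>k\<in>F. (cmod (l k (reflect x)))\<^sup>2) \<le> C * (nrm circ x)\<^sup>2" if "x \<in> K" for x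
  proof -
    have "(\<Sum>k\<in>F. (cmod (l k (reflect x)))\<^sup>2) \<le> C * (nrm circ (reflect x))\<^sup>2"
      by (intro functionalsD(4)[OF l] reflect_in that)
    also have "\<dots> \<le> C * (nrm circ x)\<^sup>2" by (intro mult_left_mono power_mono nrm_reflect that C) auto
    finally show ?thesis .
  qed
  show ?thesis unfolding functionals_def using 1 2 3 4 by blast
qed

text \<open>The Sylvester equation under \<open>l k\<close>, with \<open>A\<close> rewritten as
  \<open>\<kappa> / 2 * (1 - R)\<close>; this is the recursion demanded by
  \<open>averaging_bound\<close>.\<close>

lemma functional_rec:
  assumes l: "l \<in> functionals F"
  shows "of_real \<kappa> * l k (d j k) = of_real (\<kappa> / 2) * l k (reflect (d j k)) +
    of_real (\<kappa> / 2) * l k (d (Suc j) k) + \<beta> j k * l k u"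
proof -
  note dk = d_in[of j k] d_in[of "Suc j" k]
  have Ad: "A (d j k) \<in> K" by (rule S2.A_in[OF dk(1)])
  have dd: "(\<lambda>z. d j k z - d (Suc j) k z) \<in> K" by (rule K_diff[OF dk])
  have "l k (\<lambda>z. A (d j k) z + of_real (\<kappa> / 2) * (d j k z - d (Suc j) k z)) = l k (\<lambda>z. \<beta> j k * u z)"
    unfolding \<beta>_def by (rule functionalsD(1)[OF l K_add[OF Ad K_scale[OF dd]] K_scale[OF uK] Sylvester])
  then have 1: "l k (A (d j k)) + of_real (\<kappa> / 2) * (l k (d j k) - l k (d (Suc j) k)) = \<beta> j k * l k u"
    unfolding functionalsD(2)[OF l Ad K_scale[OF dd]] functionalsD(3)[OF l dd] functionalsD(3)[OF l uK]
      functionals_diff[OF l dk] .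
  have 2: "l k (reflect (d j k)) = l k (d j k) - of_real (2 / \<kappa>) * l k (A (d j k))"
    unfolding reflect_def functionals_diff[OF l dk(1) K_scale[OF Ad]] functionalsD(3)[OF l Ad] ..
  have "of_real (\<kappa> / 2) * (of_real (2 / \<kappa>) * l k (A (d j k))) = l k (A (d j k))"
    using \<kappa>_pos by (simp add: mult.assoc[symmetric] of_real_mult[symmetric] del: of_real_mult)
  then show ?thesis unfolding 2 1[symmetric] right_diff_distrib by (simp add: algebra_simps)
qed

text \<open>The pairing of \<open>x\<close> with the first \<open>N\<close> coefficients of the
  backward shift of \<open>e (k - 1)\<close>: at \<open>x = d 0 k\<close> it is the cross term in
  \<open>transport_bound\<close>. The index drops by one because the step from \<open>k\<close> to
  \<open>Suc k\<close> has defect \<open>d 0 (Suc k)\<close>; only \<open>k \<ge> 1\<close> is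
  summed, so truncated subtraction does no harm.\<close>

definition probe where
  "probe N k x = (\<Sum>n<N. cnj (ec (k - 1) (Suc n)) * fourier_coeff x (int n))"

text \<open>Moving truncation and shift to the other side gives the pairing of
  \<open>e (k - 1)\<close> with \<open>Y\<close>, the forward shift of the truncated
  \<open>x\<close>. Its norm is at most that of \<open>x\<close>, so the Bessel bound of the
  \<open>e k\<close> applies with the constant \<open>C\<close> for every \<open>N\<close>.\<close>

lemma probe_functional: "probe N \<in> functionals {Suc m..<Suc m'}"
proof -
  have 1: "probe N k x = probe N k y" if "x \<in> K" "y \<in> K" "AE z in circ. x z = y z" for k x y
    unfolding probe_def using fourier_coeff_cong_AE[OF that(3) K_L2[OF that(1)] K_L2[OF that(2)]] by simp
  have 2: "probe N k (\<lambda>z. x z + y z) = probe N k x + probe N k y" if "x \<in> K" "y \<in> K" for k x y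
    unfolding probe_def fourier_coeff_add[OF K_L2[OF that(1)] K_L2[OF that(2)]] distrib_left sum.distrib ..
  have 3: "probe N k (\<lambda>z. q * x z) = q * probe N k x" for k x q
    unfolding probe_def fourier_coeff_scale sum_distrib_left by (intro sum.cong refl) (simp only: mult.left_commute)
  have 4: "(\<Sum>k\<in>{Suc m..<Suc m'}. (cmod (probe N k x))\<^sup>2) \<le> C * (nrm circ x)\<^sup>2" if x: "x \<in> K" for x
  proof -
    define I where "I = (\<lambda>n. int (Suc n)) ` {..<N}"
    define y where "y i = fourier_coeff x (i - 1)" for i
    define Y where "Y = (\<lambda>z::complex. \<Sum>i\<in>I. y i * z powi i)"
    have I: "finite I" unfolding I_def by simp
    have re: "(\<Sum>i\<in>I. f i) = (\<Sum>n<N. f (int (Suc n)))" for f :: "int \<Rightarrow> 'b::comm_monoid_add"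
      unfolding I_def by (subst sum.reindex) (auto simp: inj_on_def)
    have Y: "Y \<in> L2 circ" unfolding Y_def by (intro L2_sum L2_scale powi_L2)
    \<comment> \<open>Written as a difference from 0 so that \<open>nrm_diff_trig\<close> yields the
      norm of a trigonometric polynomial.\<close>
    have "(nrm circ Y)\<^sup>2 = (nrm circ (\<lambda>z. 0 - Y z))\<^sup>2" using nrm_minus_commute[of circ "\<lambda>_. 0" Y] by simp
    also have "\<dots> = (\<Sum>i\<in>I. (cmod (y i))\<^sup>2)"
      unfolding Y_def nrm_diff_trig[OF L2_zero I] by (simp add: fourier_coeff_zero)
    also have "\<dots> = (\<Sum>n<N. (cmod (fourier_coeff x (int n)))\<^sup>2)" unfolding re y_def by simp
    also have "\<dots> = (\<Sum>k\<in>int ` {..<N}. (cmod (fourier_coeff x k))\<^sup>2)" by (subst sum.reindex) auto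
    also have "\<dots> \<le> (nrm circ x)\<^sup>2" by (rule fourier_Bessel[OF K_L2[OF x]]) simp
    finally have nY: "(nrm circ Y)\<^sup>2 \<le> (nrm circ x)\<^sup>2" .
    have pr: "probe N (Suc k) x = ip circ Y (e k)" for k
    proof -
      have "ip circ Y (e k) = (\<Sum>i\<in>I. y i * ip circ (\<lambda>z. z powi i) (e k))"
        unfolding Y_def using K_L2[OF e_in] by (subst ip_sum_left) (auto simp: ip_scale_left L2_scale powi_L2)
      also have "\<dots> = (\<Sum>i\<in>I. y i * cnj (fourier_coeff (e k) i))"
        unfolding fourier_coeff_ip[OF K_L2[OF e_in]] cnj_ip ..
      also have "\<dots> = probe N (Suc k) x"
        unfolding re probe_def ec_def y_def by (intro sum.cong refl) simp
      finally show ?thesis by simp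
    qed
    have "(\<Sum>k\<in>{Suc m..<Suc m'}. (cmod (probe N k x))\<^sup>2) = (\<Sum>k\<in>{m..<m'}. (cmod (ip circ Y (e k)))\<^sup>2)"
      unfolding sum.shift_bounds_Suc_ivl pr ..
    also have "\<dots> \<le> C * (nrm circ Y)\<^sup>2" by (rule Bessel_e[OF _ Y]) simp
    also have "\<dots> \<le> C * (nrm circ x)\<^sup>2" by (rule mult_left_mono[OF nY C])
    finally show ?thesis .
  qed
  show ?thesis unfolding functionals_def using 1 2 3 4 by blast
qed

lemma functional_le:
  assumes l: "l \<in> functionals F" and x: "x \<in> K" and F: "finite F" "k \<in> F"
  shows "cmod (l k x) \<le> sqrt C * nrm circ x"
proof (rule power2_le_imp_le)
  have "(cmod (l k x))\<^sup>2 \<le> (\<Sum>k\<in>F. (cmod (l k x))\<^sup>2)" by (rule member_le_sum) (use F in auto)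
  also have "\<dots> \<le> C * (nrm circ x)\<^sup>2" by (rule functionalsD(4)[OF l x])
  finally show "(cmod (l k x))\<^sup>2 \<le> (sqrt C * nrm circ x)\<^sup>2" using C by (simp add: power_mult_distrib)
qed (use C in simp)

text \<open>A crude bound; it only has to make the remainder of the iteration vanish.\<close>

lemma nrm_d_le: "\<exists>Q\<ge>0. \<forall>j k. nrm circ (d j k) \<le> Q * r ^ j"
proof -
  obtain C1 where C1: "C1 > 0" "\<And>f. f \<in> K \<Longrightarrow> nrm circ (B f) \<le> C1 * nrm circ f"
    using bounded_op_bound[OF S1.A_bop] by metis
  have "nrm circ (d j k) \<le> ((C1 + \<kappa>) * M1) * r ^ j" for j k
  proof -
    have "nrm circ (d j k) \<le> nrm circ (B (X j k)) + nrm circ (A (X j k))"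
      unfolding d_def by (intro nrm_diff_le K_L2 S1.A_in S2.A_in X_in)
    also have "\<dots> \<le> (C1 + \<kappa>) * nrm circ (X j k)"
      using C1(2)[OF X_in, of j k] \<kappa>(2)[OF X_in, of j k] by (simp add: distrib_right)
    also have "\<dots> \<le> (C1 + \<kappa>) * (M1 * r ^ j)"
      using C1(1) \<kappa>_pos by (intro mult_left_mono nrm_X) auto
    finally show ?thesis by (simp add: mult.assoc)
  qed
  moreover have "(C1 + \<kappa>) * M1 \<ge> 0" using C1(1) \<kappa>_pos M1_nonneg by simp
  ultimately show ?thesis by blast
qed

text \<open>This replaces the trace-class property of \<open>D = B - A\<close>.\<close>

lemma defect_small:
  assumes \<epsilon>: "\<epsilon> > 0"
  shows "\<exists>m0. \<forall>m\<ge>m0. \<forall>m'. \<forall>l\<in>functionals {Suc m..<Suc m'}. (\<Sum>k\<in>{Suc m..<Suc m'}. cmod (l k (d 0 k))) \<le> \<epsilon>"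
proof -
  define G where "G = sqrt C * nrm circ u"
  have G: "G \<ge> 0" unfolding G_def using C by simp
  \<comment> \<open>The tail begins at \<open>Suc m\<close>, the first index of the block of
    \<open>k\<close> to be summed.\<close>
  define T where "T j m = (\<Sum>i. (cmod (\<beta> j (i + Suc m)))\<^sup>2)" for j m
  have nn: "0 \<le> (cmod (\<beta> j k))\<^sup>2" for j k by simp
  have part: "(\<Sum>k<n. (cmod (\<beta> j k))\<^sup>2) \<le> C * (M1 * r ^ j)\<^sup>2" for j n by (rule Bessel_\<beta>) simp
  note tb = tail_bound[of "\<lambda>k. (cmod (\<beta> j k))\<^sup>2" for j, OF nn part]
  define t where "t j m = sqrt (T j m)" for j m
  have t0: "t j \<longlonglongrightarrow> 0" for j
  proof -
    have "(\<lambda>m. T j m) \<longlonglongrightarrow> 0" unfolding T_def by (rule LIMSEQ_Suc[OF tb(2)])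
    then have "(\<lambda>m. sqrt (T j m)) \<longlonglongrightarrow> sqrt 0" by (rule tendsto_real_sqrt)
    then show ?thesis by (simp add: t_def[abs_def])
  qed
  have tle: "t j m \<le> (sqrt C * M1) * r ^ j" for j m
  proof -
    have "t j m \<le> sqrt (C * (M1 * r ^ j)\<^sup>2)" unfolding t_def T_def by (intro real_sqrt_le_mono tb(5))
    also have "\<dots> = sqrt C * (M1 * r ^ j)"
      using M1_nonneg r_bounds by (simp add: real_sqrt_mult)
    finally show ?thesis by (simp add: mult.assoc)
  qed
  \<comment> \<open>\<open>2 * G / \<kappa>\<close> is the factor supplied by
    \<open>averaging_bound\<close>; the summand 1 keeps the denominator positive when
    \<open>G\<close> is 0.\<close>
  define \<epsilon>' where "\<epsilon>' = \<epsilon> / (2 * G / \<kappa> + 1)"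
  have D: "2 * G / \<kappa> + 1 > 0" using G \<kappa>_pos by (intro add_nonneg_pos) auto
  then have \<epsilon>': "\<epsilon>' > 0" unfolding \<epsilon>'_def using \<epsilon> by simp
  obtain m0 where m0: "\<And>m J. m \<ge> m0 \<Longrightarrow> (\<Sum>j<J. t j m) \<le> \<epsilon>'"
    using geometric_tail_small[OF t0 tle r_bounds _ \<epsilon>'] M1_nonneg C by auto
  have "(\<Sum>k\<in>{Suc m..<Suc m'}. cmod (l k (d 0 k))) \<le> \<epsilon>"
    if m: "m \<ge> m0" and l: "l \<in> functionals {Suc m..<Suc m'}" for m m' l
  proof -
    define F where "F = {Suc m..<Suc m'}"
    have F: "finite F" unfolding F_def by simp
    obtain Q where Q: "Q \<ge> 0" "\<And>j k. nrm circ (d j k) \<le> Q * r ^ j" using nrm_d_le by blast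
    have lF: "l \<in> functionals F" using l unfolding F_def .
    \<comment> \<open>The remainder involves \<open>card F\<close> but dies out as \<open>J\<close>
      grows with \<open>F\<close> fixed. Hence the final bound, and \<open>m0\<close> with it,
      depends neither on \<open>m'\<close> nor on \<open>l\<close>.\<close>
    have main: "(\<Sum>k\<in>F. cmod (l k (d 0 k))) \<le> 2 * G / \<kappa> * (\<Sum>j<J. t j m) + (card F * (sqrt C * Q)) * r ^ J" for J
    proof (rule averaging_bound[where L = "functionals F" and R = "\<lambda>l k x. l k (reflect x)" and
          w = "\<lambda>l j k. l k (d j k)" and \<beta> = \<beta> and g = "\<lambda>l k. l k u" and G = G, OF F \<kappa>_pos lF])
      show "(\<lambda>k x. l k (reflect x)) \<in> functionals F" if "l \<in> functionals F" for l
        by (rule functionals_reflect[OF that])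
      show "of_real \<kappa> * l k (d j k) = of_real (\<kappa> / 2) * l k (reflect (d j k)) +
          of_real (\<kappa> / 2) * l k (d (Suc j) k) + \<beta> j k * l k u" if "l \<in> functionals F" for l j k
        by (rule functional_rec[OF that])
      show "(\<Sum>k\<in>F. (cmod (l k u))\<^sup>2) \<le> G\<^sup>2" if "l \<in> functionals F" for l
        using functionalsD(4)[OF that uK] C by (simp add: G_def power_mult_distrib)
      show "(\<Sum>k\<in>F. cmod (l k (d j k))) \<le> (card F * (sqrt C * Q)) * r ^ j" if l': "l \<in> functionals F" for l j
      proof -
        have "cmod (l k (d j k)) \<le> sqrt C * (Q * r ^ j)" if "k \<in> F" for k
          by (rule order_trans[OF functional_le[OF l' d_in F that] mult_left_mono[OF Q(2)]]) (use C in simp)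
        then have "(\<Sum>k\<in>F. cmod (l k (d j k))) \<le> of_nat (card F) * (sqrt C * (Q * r ^ j))"
          by (rule sum_bounded_above)
        then show ?thesis by (simp add: mult.assoc)
      qed
      show "sqrt (\<Sum>k\<in>F. (cmod (\<beta> j k))\<^sup>2) \<le> t j m" for j
        unfolding t_def T_def F_def by (intro real_sqrt_le_mono tb(3))
    qed (use G r_bounds in auto)
    have "(\<Sum>k\<in>F. cmod (l k (d 0 k))) \<le> 2 * G / \<kappa> * \<epsilon>' + (card F * (sqrt C * Q)) * r ^ J" for J
      using main[of J] mult_left_mono[OF m0[OF m, of J], of "2 * G / \<kappa>"] G \<kappa>_pos by simp
    moreover have "(\<lambda>J. 2 * G / \<kappa> * \<epsilon>' + (card F * (sqrt C * Q)) * r ^ J) \<longlonglongrightarrow> 2 * G / \<kappa> * \<epsilon>' + (card F * (sqrt C * Q)) * 0"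
      using r_bounds by (intro tendsto_intros LIMSEQ_power_zero) auto
    ultimately have "(\<Sum>k\<in>F. cmod (l k (d 0 k))) \<le> 2 * G / \<kappa> * \<epsilon>' + (card F * (sqrt C * Q)) * 0"
      by (intro LIMSEQ_le_const) auto
    also have "\<dots> \<le> (2 * G / \<kappa> + 1) * \<epsilon>'" using \<epsilon>' by (simp add: distrib_right)
    also have "\<dots> = \<epsilon>" using D unfolding \<epsilon>'_def by simp
    finally show ?thesis unfolding F_def .
  qed
  then show ?thesis by blast
qed

lemma measure_window: "measure \<rho> \<Delta> = 0"
proof (rule ccontr)
  assume "measure \<rho> \<Delta> \<noteq> 0"
  then have v: "measure \<rho> \<Delta> > 0" using measure_nonneg[of \<rho> \<Delta>] by linarith
  \<comment> \<open>The losses are one \<open>\<epsilon>\<close> for the coefficients 0, two for the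
    cross terms and one for Parseval, together half of the mass.\<close>
  define \<epsilon> where "\<epsilon> = measure \<rho> \<Delta> / 8"
  have \<epsilon>: "\<epsilon> > 0" using v by (simp add: \<epsilon>_def)
  have nrm_e: "(nrm circ (e k))\<^sup>2 = measure \<rho> \<Delta>" for k
  proof -
    have "(nrm circ (e k))\<^sup>2 = (nrm \<rho> (chr k))\<^sup>2" using S1.relD(4)[OF e_rel] by simp
    also have "\<dots> = (LINT t|\<rho>. indicator \<Delta> t)"
      unfolding nrm_sq by (intro Bochner_Integration.integral_cong) (auto simp: chr_def norm_mult indicator_def)
    also have "\<dots> = measure \<rho> \<Delta>" by simp
    finally show ?thesis .
  qed
  have ec_part: "(\<Sum>k<M. (cmod (ec k n))\<^sup>2) \<le> C * (nrm circ (\<lambda>z. z powi int n))\<^sup>2" for n M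
  proof -
    have "(\<Sum>k<M. (cmod (ec k n))\<^sup>2) = (\<Sum>k<M. (cmod (ip circ (\<lambda>z. z powi int n) (e k)))\<^sup>2)"
      unfolding ec_def fourier_coeff_ip[OF K_L2[OF e_in]] ip_commute[of circ "\<lambda>z. z powi int n"] by simp
    also have "\<dots> \<le> C * (nrm circ (\<lambda>z. z powi int n))\<^sup>2" by (rule Bessel_e[OF _ powi_L2]) simp
    finally show ?thesis .
  qed
  have nn: "0 \<le> (cmod (ec k n))\<^sup>2" for k n by simp
  note tb = tail_bound[of "\<lambda>k. (cmod (ec k n))\<^sup>2" for n, OF nn ec_part]
  obtain m1 where m1: "\<And>m. m \<ge> m1 \<Longrightarrow> (\<Sum>i. (cmod (ec (i + m) 0))\<^sup>2) < \<epsilon>"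
    using order_tendstoD(2)[OF tb(2)[of 0] \<epsilon>] by (auto simp: eventually_sequentially)
  obtain m0 where m0: "\<And>m m' l. m \<ge> m0 \<Longrightarrow> l \<in> functionals {Suc m..<Suc m'} \<Longrightarrow>
      (\<Sum>k\<in>{Suc m..<Suc m'}. cmod (l k (d 0 k))) \<le> \<epsilon>"
    using defect_small[OF \<epsilon>] by blast
  define m where "m = max m0 m1"
  \<comment> \<open>Here \<open>m\<close> is fixed before \<open>N\<close>: the loss between
    \<open>m\<close> and any later \<open>m'\<close> is at most \<open>3 * \<epsilon>\<close> for
    every \<open>N\<close>, as the probes satisfy one Bessel bound for all \<open>N\<close>.\<close>
  have bound: "(\<Sum>n<N. (cmod (ec m n))\<^sup>2) \<le> 3 * \<epsilon>" for N
  proof -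
    have "(\<Sum>n<N. (cmod (ec m n))\<^sup>2) \<le> (\<Sum>n<N. (cmod (ec m' n))\<^sup>2) + 3 * \<epsilon>" if m': "m \<le> m'" for m'
    proof -
      have "(\<Sum>k=m..<m'. cmod (\<Sum>n<N. cnj (ec k (Suc n)) * dc (Suc k) n)) =
          (\<Sum>k=m..<m'. cmod (probe N (Suc k) (d 0 (Suc k))))"
        unfolding probe_def dc_def by simp
      also have "\<dots> = (\<Sum>k\<in>{Suc m..<Suc m'}. cmod (probe N k (d 0 k)))"
        unfolding sum.shift_bounds_Suc_ivl ..
      also have "\<dots> \<le> \<epsilon>" by (rule m0[OF _ probe_functional]) (simp add: m_def)
      finally have 1: "(\<Sum>k=m..<m'. cmod (\<Sum>n<N. cnj (ec k (Suc n)) * dc (Suc k) n)) \<le> \<epsilon>" .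
      have 2: "(\<Sum>k=m..<m'. (cmod (ec k 0))\<^sup>2) \<le> \<epsilon>"
      proof -
        have "(\<Sum>k=m..<m'. (cmod (ec k 0))\<^sup>2) \<le> (\<Sum>i. (cmod (ec (i + m) 0))\<^sup>2)" by (rule tb(3))
        also have "\<dots> < \<epsilon>" by (rule m1) (simp add: m_def)
        finally show ?thesis by simp
      qed
      show ?thesis using transport_bound[of ec dc m m' N, OF ec_step m'] 1 2 by linarith
    qed
    \<comment> \<open>For fixed \<open>N\<close>, each of the finitely many coefficients is
      square-summable in \<open>m'\<close> and so tends to 0.\<close>
    moreover have "(\<lambda>m'. (\<Sum>n<N. (cmod (ec m' n))\<^sup>2) + 3 * \<epsilon>) \<longlonglongrightarrow> (\<Sum>n<N. 0) + 3 * \<epsilon>"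
      by (intro tendsto_add tendsto_sum tendsto_const tb(1))
    ultimately have "(\<Sum>n<N. (cmod (ec m n))\<^sup>2) \<le> (\<Sum>n<N. 0) + 3 * \<epsilon>"
      by (intro LIMSEQ_le_const) auto
    then show ?thesis by simp
  qed
  obtain N where "(nrm circ (e m))\<^sup>2 < (\<Sum>n<N. (cmod (fourier_coeff (e m) (int n)))\<^sup>2) + \<epsilon>"
    using H2_Parseval[OF K_in_H2[OF e_in] \<epsilon>] by blast
  then have "measure \<rho> \<Delta> < 4 * \<epsilon>" using bound[of N] unfolding nrm_e ec_def by linarith
  then show False using v unfolding \<epsilon>_def by simp
qed

end

section \<open>The density of the spectral measure\<close>

text \<open>The complement of the support is a union of open null sets, and Lindelof reduces it to a
  countable union.\<close>

lemma AE_msupport: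
  assumes [measurable_cong, simp]: "sets \<rho> = sets borel"
  shows "AE t in \<rho>. t \<in> msupport \<rho>"
proof -
  define F where "F = {U :: real set. open U \<and> emeasure \<rho> U = 0}"
  obtain F' where F': "F' \<subseteq> F" "countable F'" "\<Union>F' = \<Union>F"
    using Lindelof[of F] unfolding F_def by blast
  have "\<Union>F' \<in> null_sets \<rho>"
    using F' by (intro null_sets_UN'[of F' "\<lambda>x. x", simplified]) (auto simp: F_def null_sets_def)
  then have "AE t in \<rho>. t \<notin> \<Union>F'" by (rule AE_not_in)
  then show ?thesis
    by eventually_elim (auto simp: F'(3) F_def msupport_def)
qed

text \<open>Orthogonality of the integer frequencies over a period beginning at an arbitrary
  \<open>x\<close>. The measure is unnormalised Lebesgue measure on that period, hence the factor
  \<open>2 * pi\<close>.\<close>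

lemma nrm_exp_sum:
  fixes q :: "nat \<Rightarrow> complex" and x :: real
  assumes F: "finite F"
  defines "M \<equiv> density lborel (\<lambda>t. ennreal (indicator {x..x + 2 * pi} t))"
  shows "(\<lambda>t. \<Sum>k\<in>F. q k * cis (real k * t)) \<in> L2 M"
    "(nrm M (\<lambda>t. \<Sum>k\<in>F. q k * cis (real k * t)))\<^sup>2 = 2 * pi * (\<Sum>k\<in>F. (cmod (q k))\<^sup>2)"
proof -
  have sM[measurable_cong, simp]: "sets M = sets borel" by (simp add: M_def)
  have fin: "finite_measure M"
  proof
    have "emeasure M (space M) = (\<integral>\<^sup>+ t. indicator {x..x + 2 * pi} t \<partial>lborel)"
      unfolding M_def by (subst emeasure_density) (auto simp: ennreal_indicator)
    then show "emeasure M (space M) \<noteq> \<infinity>" by simp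
  qed
  have cL: "(\<lambda>t. cis (real k * t)) \<in> L2 M" for k
    by (rule L2_bounded[OF fin, of _ 1]) auto
  have ipc: "ip M (\<lambda>t. cis (real k * t)) (\<lambda>t. cis (real l * t)) = (if k = l then 2 * pi else 0)" for k l
  proof -
    have e: "cis (real k * t) * cnj (cis (real l * t)) = cis (real_of_int (int k - int l) * t)" for t
      by (simp add: cis_cnj cis_mult left_diff_distrib)
    have "ip M (\<lambda>t. cis (real k * t)) (\<lambda>t. cis (real l * t)) =
        (LINT t|lborel. indicator {x..x + 2 * pi} t *\<^sub>R cis (real_of_int (int k - int l) * t))"
      unfolding ip_def e M_def by (rule integral_density) auto
    also have "\<dots> = (if k = l then 2 * pi else 0)"
      using integral_cis_interval[of "int k - int l" x] by (auto simp: scaleR_conv_of_real)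
    finally show ?thesis .
  qed
  show L: "(\<lambda>t. \<Sum>k\<in>F. q k * cis (real k * t)) \<in> L2 M" by (intro L2_sum L2_scale cL)
  have "ip M (\<lambda>t. \<Sum>k\<in>F. q k * cis (real k * t)) (\<lambda>t. \<Sum>k\<in>F. q k * cis (real k * t)) =
     (\<Sum>k\<in>F. q k * (\<Sum>l\<in>F. cnj (q l) * (if k = l then 2 * pi else 0)))"
    using L cL by (simp add: ip_sum_left ip_sum_right L2_scale ip_scale_left ip_scale_right ipc)
  also have "\<dots> = (\<Sum>k\<in>F. complex_of_real (2 * pi * (cmod (q k))\<^sup>2))"
  proof (intro sum.cong refl)
    fix k assume "k \<in> F"
    then have "(\<Sum>l\<in>F. cnj (q l) * (if k = l then 2 * pi else 0)) = cnj (q k) * complex_of_real (2 * pi)"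
      using F by (simp add: if_distrib sum.delta cong: if_cong)
    then show "q k * (\<Sum>l\<in>F. cnj (q l) * (if k = l then 2 * pi else 0)) = complex_of_real (2 * pi * (cmod (q k))\<^sup>2)"
      unfolding of_real_mult[of "2 * pi"] complex_norm_square by simp
  qed
  finally show "(nrm M (\<lambda>t. \<Sum>k\<in>F. q k * cis (real k * t)))\<^sup>2 = 2 * pi * (\<Sum>k\<in>F. (cmod (q k))\<^sup>2)"
    unfolding nrm_sq_ip by (simp add: sum_distrib_left)
qed

text \<open>\<open>\<Delta>\<close> has diameter at most \<open>2\<pi>\<close>, and the density of \<open>\<rho>\<close> is bounded on it.\<close>

lemma exists_window:
  fixes \<rho> :: "real measure"
  assumes sets[measurable_cong, simp]: "sets \<rho> = sets borel" and fin: "finite_measure \<rho>"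
    and ac: "absolutely_continuous lborel \<rho>" and "a < b" and supp: "msupport \<rho> = {a..b}"
  obtains \<Delta> C where "\<Delta> \<in> sets borel" "\<Delta> \<subseteq> {a..b}" "C \<ge> 0" "measure \<rho> \<Delta> \<noteq> 0"
    "\<And>F (q :: nat \<Rightarrow> complex). finite F \<Longrightarrow>
      (nrm \<rho> (\<lambda>t. \<Sum>k\<in>F. q k * (indicator \<Delta> t * cis (real k * t))))\<^sup>2 \<le> C * (\<Sum>k\<in>F. (cmod (q k))\<^sup>2)"
proof -
  \<comment> \<open>Cutting to one period lets Parseval control all exponential sums on the
    window.\<close>
  define b' where "b' = min b (a + 2 * pi)"
  have b': "a < b'" "b' \<le> b" "b' \<le> a + 2 * pi" unfolding b'_def using \<open>a < b\<close> by auto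
  define w where "w = RN_deriv lborel \<rho>"
  have [measurable]: "w \<in> borel_measurable borel"
    using borel_measurable_RN_deriv[of lborel \<rho>] unfolding w_def by simp
  have dens: "density lborel w = \<rho>"
    unfolding w_def by (rule sigma_finite_measure.density_RN_deriv[OF sigma_finite_lborel ac]) simp
  \<comment> \<open>The density \<open>w\<close> is finite almost everywhere, so these sets cover
    the interval up to a \<open>\<rho>\<close>-null set. If all were null, the open interval between
    \<open>a\<close> and \<open>b'\<close> would be null too, yet its midpoint lies in the
    support.\<close>
  define \<Delta> where "\<Delta> n = {t \<in> {a..b'}. w t \<le> of_nat n}" for n :: nat
  have [measurable]: "\<Delta> n \<in> sets borel" for n unfolding \<Delta>_def by measurable
  have "\<exists>n. measure \<rho> (\<Delta> n) \<noteq> 0"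
  proof (rule ccontr)
    assume "\<not> ?thesis"
    then have null: "\<Delta> n \<in> null_sets \<rho>" for n
      using fin by (simp add: null_sets_def finite_measure.emeasure_eq_measure)
    have "(\<Union>n. \<Delta> n) \<in> null_sets \<rho>" by (rule null_sets_UN[OF null])
    then have 1: "AE t in \<rho>. t \<notin> (\<Union>n. \<Delta> n)" by (rule AE_not_in)
    have sf: "sigma_finite_measure \<rho>" by (rule finite_measure.axioms(1)[OF fin])
    have w_fin: "AE t in lborel. w t \<noteq> \<infinity>"
      unfolding w_def using sigma_finite_measure.RN_deriv_finite[OF sigma_finite_lborel sf ac] by simp
    have 2: "AE t in \<rho>. w t \<noteq> \<infinity>"
      by (rule absolutely_continuous_AE[OF _ ac w_fin]) simp
    have "AE t in \<rho>. t \<notin> {a<..<b'}"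
      using 1 2
    proof eventually_elim
      case (elim t)
      show ?case
      proof
        assume t: "t \<in> {a<..<b'}"
        obtain n where "w t \<le> of_nat n"
          using ennreal_Ex_less_of_nat[of "w t"] elim(2) by (auto simp: less_top intro: less_imp_le)
        then have "t \<in> \<Delta> n" using t by (auto simp: \<Delta>_def)
        then show False using elim(1) by blast
      qed
    qed
    then have "emeasure \<rho> {a<..<b'} = 0"
      by (subst (asm) AE_iff_measurable[of "{a<..<b'}"]) (auto simp: sets_eq_imp_space_eq[OF sets])
    moreover have "(a + b') / 2 \<in> msupport \<rho>" using supp b' by auto
    ultimately show False using b' unfolding msupport_def by (auto dest!: spec[of _ "{a<..<b'}"])
  qed
  then obtain n where n: "measure \<rho> (\<Delta> n) \<noteq> 0" by blast
  define M where "M = density lborel (\<lambda>t. ennreal (indicator {a..a + 2 * pi} t))"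
  have [measurable_cong]: "sets M = sets borel" by (simp add: M_def)
  \<comment> \<open>The constant is the bound \<open>n\<close> on the density times the factor
    \<open>2 * pi\<close> from Parseval over one period.\<close>
  have win: "(nrm \<rho> (\<lambda>t. \<Sum>k\<in>F. q k * (indicator (\<Delta> n) t * cis (real k * t))))\<^sup>2 \<le> (real n * (2 * pi)) * (\<Sum>k\<in>F. (cmod (q k))\<^sup>2)"
    if F: "finite F" for F and q :: "nat \<Rightarrow> complex"
  proof -
    define g where "g t = (\<Sum>k\<in>F. q k * cis (real k * t))" for t
    have [measurable]: "g \<in> borel_measurable borel" unfolding g_def[abs_def] by measurable
    have fg: "(\<Sum>k\<in>F. q k * (indicator (\<Delta> n) t * cis (real k * t))) = indicator (\<Delta> n) t * g t" for t
      unfolding g_def by (simp add: sum_distrib_left mult.left_commute)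
    note gM = nrm_exp_sum[OF F, where q = q and x = a, folded M_def g_def[abs_def]]
    have "(\<integral>\<^sup>+ t. ennreal ((cmod (indicator (\<Delta> n) t * g t))\<^sup>2) \<partial>\<rho>) =
        (\<integral>\<^sup>+ t. w t * ennreal ((cmod (indicator (\<Delta> n) t * g t))\<^sup>2) \<partial>lborel)"
      unfolding dens[symmetric] by (rule nn_integral_density) auto
    also have "\<dots> \<le> (\<integral>\<^sup>+ t. of_nat n * (ennreal (indicator {a..a + 2 * pi} t) * ennreal ((cmod (g t))\<^sup>2)) \<partial>lborel)"
    proof (rule nn_integral_mono)
      fix t
      show "w t * ennreal ((cmod (indicator (\<Delta> n) t * g t))\<^sup>2) \<le>
          of_nat n * (ennreal (indicator {a..a + 2 * pi} t) * ennreal ((cmod (g t))\<^sup>2))"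
      proof (cases "t \<in> \<Delta> n")
        case True
        then have "w t \<le> of_nat n" "t \<in> {a..a + 2 * pi}" using b' by (auto simp: \<Delta>_def)
        then show ?thesis using True by (auto intro!: mult_right_mono)
      qed simp
    qed
    also have "\<dots> = of_nat n * (\<integral>\<^sup>+ t. ennreal ((cmod (g t))\<^sup>2) \<partial>M)"
      unfolding M_def by (subst nn_integral_density) (auto intro!: nn_integral_cmult)
    also have "(\<integral>\<^sup>+ t. ennreal ((cmod (g t))\<^sup>2) \<partial>M) = ennreal ((nrm M g)\<^sup>2)"
      unfolding nrm_sq by (rule nn_integral_eq_integral) (use L2_integrable_sq[OF gM(1)] in auto)
    also have "of_nat n * ennreal ((nrm M g)\<^sup>2) = ennreal (real n * (nrm M g)\<^sup>2)"
      by (simp add: ennreal_mult ennreal_of_nat_eq_real_of_nat)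
    finally have le: "(\<integral>\<^sup>+ t. ennreal ((cmod (indicator (\<Delta> n) t * g t))\<^sup>2) \<partial>\<rho>) \<le> ennreal (real n * (nrm M g)\<^sup>2)" .
    have "(nrm \<rho> (\<lambda>t. indicator (\<Delta> n) t * g t))\<^sup>2 = enn2real (\<integral>\<^sup>+ t. ennreal ((cmod (indicator (\<Delta> n) t * g t))\<^sup>2) \<partial>\<rho>)"
      unfolding nrm_sq by (rule integral_eq_nn_integral) auto
    also have "\<dots> \<le> real n * (nrm M g)\<^sup>2"
      by (rule enn2real_leI[OF _ le]) auto
    finally show ?thesis unfolding fg gM(2) by (simp add: mult.assoc)
  qed
  show ?thesis
  proof (rule that[of "\<Delta> n" "real n * (2 * pi)"])
    show "\<Delta> n \<subseteq> {a..b}" using b' unfolding \<Delta>_def by auto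
  qed (use n win in auto)
qed

section \<open>From the datum of \<open>u\<close> to the estimates\<close>

text \<open>Existence of all projections is drawn from the datum instead of BMOA theory. A single
  failure would give \<open>B u = 0\<close>, so the integral of \<open>s\<close> over
  \<open>\<rho>\<close>, being \<open><B u, u>\<close>, would vanish; this is impossible for a
  nonzero measure on the positive axis.\<close>

lemma hankel_setup_if_spectral_measure:
  assumes u: "u \<in> H2" and B: "is_modulus circ H2 (hankel u) B" and sm: "is_spectral_measure_at circ H2 B u \<rho>"
    and rho_pos: "AE t in \<rho>. 0 < t" and nz: "emeasure \<rho> (space \<rho>) \<noteq> 0"
  shows "hankel_setup u"
proof
  show "hankel_ok u f" if f: "f \<in> H2" for f
  proof (rule ccontr)
    assume "\<not> hankel_ok u f"
    then have Bu: "nrm circ (B u) = 0" by (intro modulus_zero_if_not_ok[OF H2_L2[OF u] B f _ u])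
    obtain E where E: "is_spectral_resolution circ H2 B E"
      and c: "\<And>f :: real \<Rightarrow> complex. continuous_on UNIV f \<Longrightarrow>
           integrable \<rho> f \<and> (\<exists>y. has_pvm_integral circ H2 E f u y \<and> (LINT s|\<rho>. f s) = ip circ y u)"
      using sm unfolding is_spectral_measure_at_def by blast
    interpret spectral circ H2 B E
      by unfold_locales (use lin_sub_H2 E is_modulusD(2)[OF B] in auto)
    obtain y where i: "integrable \<rho> complex_of_real" and y: "rel complex_of_real u y"
      and eq: "(LINT s|\<rho>. complex_of_real s) = ip circ y u"
      using c[of complex_of_real] by (auto intro: continuous_intros)
    have "nrm circ y = nrm circ (B u)" using relD(4)[OF y] relD(4)[OF rel_id[OF u]] by simp
    then have "cmod (ip circ y u) \<le> 0"
      using ip_Cauchy_Schwarz[OF relD(5)[OF y] H2_L2[OF u]] Bu by simp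
    then have "(LINT s|\<rho>. s) = 0" using eq by (simp add: integral_complex_of_real)
    moreover have "integrable \<rho> (\<lambda>s. s)" using integrable_Re[OF i] by simp
    moreover have "AE s in \<rho>. 0 \<le> s" using rho_pos by (auto elim!: eventually_mono)
    ultimately have "AE s in \<rho>. s = 0" using integral_nonneg_eq_0_iff_AE[of \<rho> "\<lambda>s. s"] by simp
    then have "AE s in \<rho>. \<not> s = s" using rho_pos by eventually_elim simp
    from emeasure_eq_0_AE[OF this] show False using nz by simp
  qed
qed (rule u)

theorem corollary8p8:
  fixes \<rho> :: "real measure" and \<Psi> \<Psi>t :: "real \<Rightarrow> complex" and a b :: real
  assumes "abstract_spectral_datum (\<rho>, \<Psi>, \<Psi>t)"
    and "absolutely_continuous lborel \<rho>"
    and "0 < a" and "a < b" and "msupport \<rho> = {a..b}"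
    and "\<And>s. s > 0 \<Longrightarrow> \<Psi> s = exp (\<i> * complex_of_real s)"
    and "\<And>s. s > 0 \<Longrightarrow> \<Psi>t s = 1"
  shows "(\<rho>, \<Psi>, \<Psi>t) \<notin> Lambda_BMOA_simp"
proof
  assume "(\<rho>, \<Psi>, \<Psi>t) \<in> Lambda_BMOA_simp"
  then obtain u where u: "u \<in> BMOA_simp" and datum: "has_spectral_datum u (\<rho>, \<Psi>, \<Psi>t)"
    by (auto simp: Lambda_BMOA_simp_def)
  have uH: "u \<in> H2" using u by (auto simp: BMOA_simp_def BMOA_def)
  have sets[measurable_cong, simp]: "sets \<rho> = sets borel" and fin: "finite_measure \<rho>"
    using assms(1) by (auto simp: abstract_spectral_datum_def)
  have sp: "space \<rho> = UNIV" using sets_eq_imp_space_eq[OF sets] by simp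
  have supp: "AE t in \<rho>. t \<in> {a..b}" using AE_msupport[OF sets] assms(5) by simp
  have pos: "AE t in \<rho>. 0 < t" using supp by eventually_elim (use assms(3) in auto)
  have nz: "emeasure \<rho> (space \<rho>) \<noteq> 0"
  proof -
    have "a \<in> msupport \<rho>" using assms(4,5) by simp
    then show ?thesis unfolding msupport_def sp by (auto dest!: spec[of _ UNIV])
  qed
  obtain B0 where B0: "is_modulus circ H2 (hankel u) B0" and sm0: "is_spectral_measure_at circ H2 B0 u \<rho>"
    and acts: "acts_as circ (hankel_ran u) (hankel u) u \<rho> (\<lambda>s. cnj (\<Psi> s))"
    using datum unfolding has_spectral_datum_def by auto
  obtain \<rho>t Bt where smt: "is_spectral_measure_at circ H2 Bt u \<rho>t"
    and actst: "acts_as circ (hankel_ran u) (hankel_tilde u) u \<rho>t \<Psi>t"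
    using datum unfolding has_spectral_datum_def by auto
  interpret hankel_setup u by (rule hankel_setup_if_spectral_measure[OF uH B0 sm0 pos nz])
  obtain B E where B: "is_modulus circ K H B" and E: "is_spectral_resolution circ K B E"
    and act: "\<And>f. f \<in> L2 \<rho> \<Longrightarrow> \<exists>x y z. has_pvm_integral circ K E f u x \<and>
           has_pvm_integral circ K E (\<lambda>s. cnj (f s)) u y \<and>
           has_pvm_integral circ K E (\<lambda>s. cnj (\<Psi> s)) y z \<and> (AE w in circ. H x w = B z w)"
    using acts unfolding acts_as_def by blast
  obtain A E2 where A: "is_modulus circ K Ht A" and E2: "is_spectral_resolution circ K A E2"
    and actt: "\<And>f. f \<in> L2 \<rho>t \<Longrightarrow> \<exists>x y z. has_pvm_integral circ K E2 f u x \<and>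
           has_pvm_integral circ K E2 (\<lambda>s. cnj (f s)) u y \<and>
           has_pvm_integral circ K E2 \<Psi>t y z \<and> (AE w in circ. Ht x w = A z w)"
    using actst unfolding acts_as_def by blast
  obtain E0 where E0: "is_spectral_resolution circ H2 B0 E0"
    and c0: "\<And>f :: real \<Rightarrow> complex. continuous_on UNIV f \<Longrightarrow>
       integrable \<rho> f \<and> (\<exists>y. has_pvm_integral circ H2 E0 f u y \<and> (LINT s|\<rho>. f s) = ip circ y u)"
    using sm0 unfolding is_spectral_measure_at_def by blast
  interpret S0: spectral circ H2 B0 E0
    by unfold_locales (use lin_sub_H2 E0 is_modulusD(2)[OF B0] in auto)
  interpret S1: spectral circ K B E
    by unfold_locales (use lin_sub_K E is_modulusD(2)[OF B] in auto)
  interpret S2: spectral circ K A E2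
    by unfold_locales (use lin_sub_K E2 is_modulusD(2)[OF A] in auto)
  \<comment> \<open>Membership of the base vector in the space is part of
    \<open>has_pvm_integral\<close>; the symbol 0 suffices to extract it.\<close>
  have uK: "u \<in> K" using act[OF L2_zero] S1.relD(1) by blast

  \<comment> \<open>\<open>B0\<close> and \<open>B\<close> are moduli on different spaces with no
    direct link between them; their squares agree because both are \<open>H^2\<close>.\<close>
  have pow_eq: "AE z in circ. (B0 ^^ (2 * j)) u z = (B ^^ (2 * j)) u z" for j
  proof (induction j)
    case (Suc j)
    let ?x = "(B0 ^^ (2 * j)) u" and ?y = "(B ^^ (2 * j)) u"
    have x: "?x \<in> H2" by (rule S0.funpow_in[OF uH])
    have y: "?y \<in> K" by (rule S1.funpow_in[OF uK])
    then have yH: "?y \<in> H2" using K_H2 by blast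
    have "AE z in circ. H (H ?x) z = H (H ?y) z"
      by (intro H_cong H_H2 x yH Suc)
    then have "AE z in circ. B0 (B0 ?x) z = B (B ?y) z"
      using is_modulusD(3)[OF B0 x] is_modulusD(3)[OF B y] by eventually_elim simp
    then show ?case by simp
  qed simp
  \<comment> \<open>The datum defines \<open>\<rho>\<close> on \<open>H2\<close>, while the action
    of \<open>H\<close> is described through \<open>E\<close> on \<open>K\<close>. Equality of the
    even moments identifies the two measures.\<close>
  have mu: "pvm_measure circ E u = \<rho>"
  proof (rule measure_eqI_even_moments[OF S1.sets_mu sets S1.finite_mu[OF uK] fin S1.AE_mu_nonneg[OF uK]])
    show "AE t in \<rho>. t \<in> {0..b}" using supp by eventually_elim (use assms(3) in auto)
    show "integrable (pvm_measure circ E u) (\<lambda>t. t ^ (2 * j))" for j by (rule S1.moment_mu(1)[OF uK])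
    fix j :: nat
    have "continuous_on UNIV (\<lambda>t. complex_of_real (t ^ (2 * j)))" by (intro continuous_intros)
    from c0[OF this] obtain y where y: "S0.rel (\<lambda>t. complex_of_real (t ^ (2 * j))) u y"
      and eq: "(LINT t|\<rho>. complex_of_real (t ^ (2 * j))) = ip circ y u" by blast
    have "AE z in circ. y z = (B ^^ (2 * j)) u z"
      using S0.rel_unique[OF y S0.rel_pow[OF uH]] pow_eq[of j] by eventually_elim simp
    then have "ip circ y u = ip circ ((B ^^ (2 * j)) u) u"
      using S0.relD(5)[OF y] S1.VD(1)[OF S1.funpow_in[OF uK]] uL by (intro ip_cong_AE) auto
    then have "complex_of_real (LINT t|\<rho>. t ^ (2 * j)) = complex_of_real (LINT t|pvm_measure circ E u. t ^ (2 * j))"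
      using eq S1.moment_mu(2)[OF uK] unfolding integral_complex_of_real by simp
    then show "(LINT t|pvm_measure circ E u. t ^ (2 * j)) = (LINT t|\<rho>. t ^ (2 * j))"
      unfolding of_real_eq_iff by simp
  qed
  have H_act: "\<exists>x y z. S1.rel f u x \<and> S1.rel (\<lambda>t. cnj (f t)) u y \<and>
      S1.rel (\<lambda>t. cis (- t)) y z \<and> (AE w in circ. H x w = B z w)" if f: "f \<in> L2 \<rho>" for f
  proof -
    obtain x y z where R: "S1.rel f u x" "S1.rel (\<lambda>t. cnj (f t)) u y" "S1.rel (\<lambda>s. cnj (\<Psi> s)) y z"
      "AE w in circ. H x w = B z w" using act[OF f] by blast
    have [measurable]: "f \<in> borel_measurable \<rho>" using f by (rule L2_measurable)
    \<comment> \<open>The formula for \<open>\<Psi>\<close> holds on the positive axis only. This is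
      enough: the measure of \<open>y\<close> has a density with respect to \<open>\<rho>\<close>,
      which does not charge the nonpositive axis.\<close>
    have "AE t in pvm_measure circ E y. cnj (\<Psi> t) = cis (- t)"
      unfolding S1.mu_rel[OF R(2)] mu
    proof (subst AE_density)
      show "AE t in \<rho>. 0 < ennreal ((cmod (cnj (f t)))\<^sup>2) \<longrightarrow> cnj (\<Psi> t) = cis (- t)"
        using pos by eventually_elim (simp add: assms(6) cis_conv_exp exp_cnj)
    qed simp
    then have "S1.rel (\<lambda>t. cis (- t)) y z"
      using S1.relD(2)[OF R(3)] by (intro S1.rel_cong[OF R(3)]) auto
    then show ?thesis using R by blast
  qed
  \<comment> \<open>The symbol \<open>t^(2 i)\<close> is real, so conjugation does not affect it,
    and it lies in \<open>L2 \<rho>t\<close> because continuous functions are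
    \<open>\<rho>t\<close>-integrable. No identification of \<open>\<rho>t\<close> with the measure
    of \<open>A\<close> on \<open>K\<close> enters.\<close>
  have Ht_even: "AE z in circ. Ht ((A ^^ (2 * i)) u) z = A ((A ^^ (2 * i)) u) z" for i
  proof -
    let ?f = "\<lambda>t. complex_of_real (t ^ (2 * i))"
    have setst: "sets \<rho>t = sets borel" using smt by (simp add: is_spectral_measure_at_def)
    have cont: "integrable \<rho>t f" if "continuous_on UNIV f" for f :: "real \<Rightarrow> complex"
      using smt that unfolding is_spectral_measure_at_def by blast
    have "integrable \<rho>t (\<lambda>t. complex_of_real (t ^ (4 * i)))"
      by (rule cont) (intro continuous_intros)
    from integrable_Re[OF this] have "integrable \<rho>t (\<lambda>t. t ^ (4 * i))" by simp
    moreover have "(cmod (?f t))\<^sup>2 = t ^ (4 * i)" for t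
    proof -
      have "(cmod (?f t))\<^sup>2 = t ^ (2 * i * 2)" by (simp only: norm_of_real power2_abs power_mult)
      then show ?thesis by (simp add: mult.commute)
    qed
    ultimately have "integrable \<rho>t (\<lambda>t. (cmod (?f t))\<^sup>2)" by (simp only:)
    then have fL: "?f \<in> L2 \<rho>t" unfolding L2_def using setst by simp
    obtain x y z where R: "S2.rel ?f u x" "S2.rel (\<lambda>t. cnj (?f t)) u y" "S2.rel \<Psi>t y z"
      and Hx: "AE w in circ. Ht x w = A z w" using actt[OF fL] by blast
    let ?v = "(A ^^ (2 * i)) u"
    have v: "S2.rel ?f u ?v" by (rule S2.rel_pow[OF uK])
    have xv: "AE w in circ. x w = ?v w" by (rule S2.rel_unique[OF R(1) v])
    have yv: "AE w in circ. y w = ?v w" using R(2) v by (intro S2.rel_unique[of ?f]) simp_all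
    have in': "x \<in> K" "y \<in> K" "z \<in> K" "?v \<in> K"
      using S2.relD(2)[OF R(1)] S2.relD(2)[OF R(2)] S2.relD(2)[OF R(3)] S2.relD(2)[OF v] .
    \<comment> \<open>\<open>\<Psi>t\<close> is unspecified at 0, where the measure of
      \<open>y\<close> may have an atom, so \<open>z = y\<close> cannot be claimed. The difference
      lies in the kernel of \<open>A\<close>, and \<open>A z = A y\<close> is all that
      matters.\<close>
    have "S2.rel (\<lambda>t. \<Psi>t t - 1) y (\<lambda>w. z w - y w)" by (rule S2.rel_diff[OF R(3) S2.rel_one[OF in'(2)]])
    then have "nrm circ (A (\<lambda>w. z w - y w)) = 0" by (rule S2.nonpos_function_zero) (simp add: assms(7))
    then have "nrm circ (\<lambda>w. A z w - A y w) = 0"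
      by (simp only: nrm_bounded_op_diff[OF lin_sub_K S2.A_bop in'(3,2)])
    then have Azy: "AE w in circ. A z w = A y w"
      using in' by (subst (asm) nrm_eq_0_iff) (auto intro: L2_diff S2.VD(1) S2.A_in)
    have Ayv: "AE w in circ. A y w = A ?v w" by (rule bounded_op_cong[OF lin_sub_K S2.A_bop in'(2,4) yv])
    have xH: "x \<in> H2" "?v \<in> H2" using in' K_H2 by blast+
    have "AE w in circ. shift x w = shift ?v w" using xv by eventually_elim (simp add: shift_def)
    then have "AE w in circ. Ht x w = Ht ?v w"
      unfolding hankel_tilde_def by (intro H_cong shift_H2 xH)
    then show ?thesis using Hx Azy Ayv by eventually_elim simp
  qed
  obtain C' where C': "C' > 0" "\<And>f. f \<in> K \<Longrightarrow> nrm circ (A f) \<le> C' * nrm circ f"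
    using bounded_op_bound[OF S2.A_bop] by metis
  \<comment> \<open>\<open>C'\<close> bounds \<open>A\<close>, and \<open>2 * b\<close> keeps
    \<open>1 - 2 t / \<kappa>\<close> nonnegative on the support of \<open>\<rho>\<close>.\<close>
  define \<kappa> where "\<kappa> = max C' (2 * b)"
  have \<kappa>: "nrm circ (A f) \<le> \<kappa> * nrm circ f" if "f \<in> K" for f
    by (rule order_trans[OF C'(2)[OF that] mult_right_mono]) (auto simp: \<kappa>_def)
  obtain \<Delta> C where window_props: "\<Delta> \<in> sets borel" "\<Delta> \<subseteq> {a..b}" "C \<ge> 0" "measure \<rho> \<Delta> \<noteq> 0"
    and win: "\<And>F (q :: nat \<Rightarrow> complex). finite F \<Longrightarrow>
      (nrm \<rho> (\<lambda>t. \<Sum>k\<in>F. q k * (indicator \<Delta> t * cis (real k * t))))\<^sup>2 \<le> C * (\<Sum>k\<in>F. (cmod (q k))\<^sup>2)"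
    by (rule exists_window[OF sets fin assms(2,4,5)]) (rule that)
  interpret hankel_window u B E A E2 b \<Delta> a b C \<kappa>
  proof unfold_locales
    show "AE t in pvm_measure circ E u. t \<in> {0<..b}"
      unfolding mu using supp by eventually_elim (use assms(3) in auto)
    show "2 * b \<le> \<kappa>" by (simp add: \<kappa>_def)
    show "AE z in circ. B (B x) z = H (H x) z" if "x \<in> K" for x by (rule is_modulusD(3)[OF B that])
    show "AE z in circ. A (A x) z = Ht (Ht x) z" if "x \<in> K" for x by (rule is_modulusD(3)[OF A that])
    show "\<exists>x y z. S1.rel f u x \<and> S1.rel (\<lambda>t. cnj (f t)) u y \<and>
        S1.rel (\<lambda>t. cis (- t)) y z \<and> (AE w in circ. H x w = B z w)" if "f \<in> L2 (pvm_measure circ E u)" for f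
      using H_act that unfolding mu by simp
    show "(nrm (pvm_measure circ E u) (\<lambda>t. \<Sum>k\<in>F. q k * (indicator \<Delta> t * cis (real k * t))))\<^sup>2
        \<le> C * (\<Sum>k\<in>F. (cmod (q k))\<^sup>2)" if "finite F" for F and q :: "nat \<Rightarrow> complex"
      unfolding mu by (rule win[OF that])
    show "a \<le> b" using assms(4) by simp
  qed (fact uK Ht_even window_props \<kappa> assms(3))+
  show False using measure_window window_props(4) unfolding mu by simp
qed

end
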